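(* Let $\lambda>0$, $v>0$. Let $\Phi=\{X_i\}$ be a homogeneous Poisson point process on $\mathbb R^2$ of intensity $\lambda$, $(\Theta_i)$ i.i.d. uniform on $[-\pi,\pi)$ independent of $\Phi$, and let station $i$ be at $X_i+vt(\cos\Theta_i,\sin\Theta_i)$ at time $t\in\mathbb R$. Then the intensity of the handover point process $\mathcal V$ (the handover frequency) is $\lambda_{\mathcal V}=\frac{4v\sqrt\lambda}{\pi}$.
   Context: A user at the origin is served at each time by the closest station. A handover epoch is a time $t$ at which two stations are at the same distance from the origin and no station is strictly closer; $\mathcal V$ is the point process on $\mathbb R$ of handover epochs, which is stationary, and its intensity is the expected number of handover epochs in $[0,1]$. *)

theory Defs
  imports "HOL-Probability.Probability"
begin

text \<open>Number of points of the enumerated configuration X(omega) = (X omega n)_n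
  falling in the set B, counted with multiplicity (infinite if infinitely many).\<close>
definition pp_count :: "('w \<Rightarrow> nat \<Rightarrow> real \<times> real) \<Rightarrow> 'w \<Rightarrow> (real \<times> real) set \<Rightarrow> ennreal" where
  "pp_count X \<omega> B = emeasure (count_space UNIV) {n. X \<omega> n \<in> B}"

definition homogeneous_PPP :: "'w measure \<Rightarrow> real \<Rightarrow> ('w \<Rightarrow> nat \<Rightarrow> real \<times> real) \<Rightarrow> bool" where
  "homogeneous_PPP M lam X \<longleftrightarrow>
     prob_space M \<and>
     (\<forall>n. (\<lambda>\<omega>. X \<omega> n) \<in> borel_measurable M) \<and>
     (\<forall>B k. B \<in> sets lborel \<longrightarrow> bounded B \<longrightarrow>
        measure M {\<omega> \<in> space M. pp_count X \<omega> B = of_nat k}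
          = (lam * measure lborel B) ^ k / fact k * exp (- (lam * measure lborel B))) \<and>
     (\<forall>(I::nat set) B. finite I \<longrightarrow> (\<forall>i\<in>I. B i \<in> sets lborel \<and> bounded (B i)) \<longrightarrow>
        disjoint_family_on B I \<longrightarrow>
        prob_space.indep_vars M (\<lambda>_. borel) (\<lambda>i \<omega>. pp_count X \<omega> (B i)) I)"

definition station_pos ::
  "('w \<Rightarrow> nat \<Rightarrow> real \<times> real) \<Rightarrow> ('w \<Rightarrow> nat \<Rightarrow> real) \<Rightarrow> real \<Rightarrow> 'w \<Rightarrow> nat \<Rightarrow> real \<Rightarrow> real \<times> real" where
  "station_pos X \<Theta> v \<omega> i t = X \<omega> i + (v * t * cos (\<Theta> \<omega> i), v * t * sin (\<Theta> \<omega> i))"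

definition handover_epoch ::
  "('w \<Rightarrow> nat \<Rightarrow> real \<times> real) \<Rightarrow> ('w \<Rightarrow> nat \<Rightarrow> real) \<Rightarrow> real \<Rightarrow> 'w \<Rightarrow> real \<Rightarrow> bool" where
  "handover_epoch X \<Theta> v \<omega> t \<longleftrightarrow>
     (\<exists>i j. i \<noteq> j \<and>
        norm (station_pos X \<Theta> v \<omega> i t) = norm (station_pos X \<Theta> v \<omega> j t) \<and>
        (\<forall>k. norm (station_pos X \<Theta> v \<omega> i t) \<le> norm (station_pos X \<Theta> v \<omega> k t)))"

definition handover_intensity ::
  "'w measure \<Rightarrow> ('w \<Rightarrow> nat \<Rightarrow> real \<times> real) \<Rightarrow> ('w \<Rightarrow> nat \<Rightarrow> real) \<Rightarrow> real \<Rightarrow> ennreal" where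
  "handover_intensity M X \<Theta> v =
     (\<integral>\<^sup>+ \<omega>. emeasure (count_space UNIV) {t \<in> {0..1}. handover_epoch X \<Theta> v \<omega> t} \<partial>M)"

end

theory Submission
  imports Defs
begin

text \<open>
  Rotate the initial position of each station by minus its direction of motion. The rotated points
  \<open>Y k\<close> again form a Poisson process of intensity \<open>lam\<close>, and the distance of station \<open>k\<close> at time
  \<open>t\<close> is the distance of \<open>Y k\<close> from \<open>(- v t, 0)\<close>: all stations may be taken to move in the same
  direction.

  The squared distances at time \<open>t\<close>, minus \<open>v^2 t^2\<close>, are affine in \<open>t\<close>, so handovers are the
  kinks of a lower envelope of lines. If the nearest station is unique at every rational time, then
  the number of kinks in \<open>[0, 1]\<close> is the limit of the number of \<open>k < n\<close> for which the nearest
  stations at \<open>k/n\<close> and \<open>(k+1)/n\<close> differ. Hence the intensity is the limit of \<open>n (1 - Q (v/n))\<close>,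
  where \<open>Q h\<close> is the probability that the same point is nearest to the origin and to \<open>(- h, 0)\<close>.

  The Mecke formula gives \<open>Q h\<close> as the integral of \<open>lam exp (- lam |U|)\<close> over \<open>y\<close>, where \<open>U\<close> is
  the union of the two discs centred at these points with \<open>y\<close> on their boundaries. For \<open>h = 0\<close> the
  integral is 1, so that the expected number of nearest points is 1 and ties are null. To first order
  in \<open>h\<close> the second disc adds to the first a crescent of area \<open>h r\<close> times the integral of
  \<open>max 0 (cos phi - cos psi)\<close> over \<open>psi\<close>, where \<open>(r, phi)\<close> are the polar coordinates of \<open>y\<close>;
  integrating over \<open>phi\<close> gives \<open>16 h r\<close>, and a Gaussian moment gives \<open>4 v sqrt lam / pi\<close>.
\<close>

section \<open>Polar coordinates\<close>

text \<open>Each station is rotated by its own random angle, so rotation invariance of the Poisson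
  law does not apply to the configuration as a whole. The remedy is to integrate out the angles with
  the positions frozen: the probability that no rotated point lies in \<open>B\<close> becomes the
  mean of a product of factors \<open>1 - b (X \<omega> k)\<close>, where \<open>b x\<close> is the
  chance that a random rotation takes \<open>x\<close> into \<open>B\<close>. The Laplace functional
  evaluates this mean, and the integral of \<open>b\<close> is the area of \<open>B\<close>. What
  this yields are void probabilities and, likewise, the intensity measure; the Mecke formula is
  therefore rebuilt from these two alone. Counts dominate indicators of non-void strips, and the
  total mean leaves no room for a strict inequality. Uniqueness of the nearest station is asked at
  rational times only: almost sure statements survive countable intersections, whereas uniqueness at
  all times fails at every handover. The grid counts never exceed the number of handovers, so
  Fatou's lemma and monotonicity give the limit without an integrable majorant.\<close>

lemma nn_integral_periodic_shift:
  fixes g :: "real \<Rightarrow> ennreal"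
  assumes [measurable]: "g \<in> borel_measurable borel"
    and per: "\<And>x. g (x + T) = g x" and ab: "\<bar>a - b\<bar> \<le> T"
  shows "(\<integral>\<^sup>+x\<in>{a..<a+T}. g x \<partial>lborel) = (\<integral>\<^sup>+x\<in>{b..<b+T}. g x \<partial>lborel)"
proof -
  \<comment> \<open>At most one period apart, the two windows overlap. The part of the first that
    precedes \<open>b\<close> is carried by one shift by \<open>T\<close> onto the part of the
    second that follows \<open>a + T\<close>.\<close>
  have *: "(\<integral>\<^sup>+x\<in>{a..<a+T}. g x \<partial>lborel) = (\<integral>\<^sup>+x\<in>{b..<b+T}. g x \<partial>lborel)"
    if "a \<le> b" "b \<le> a + T" for a b
  proof -
    have "(\<integral>\<^sup>+x\<in>{a..<a+T}. g x \<partial>lborel) =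
        (\<integral>\<^sup>+x. g x * indicator {a..<b} x + g x * indicator {b..<a+T} x \<partial>lborel)"
      using that by (intro nn_integral_cong) (auto split: split_indicator)
    also have "\<dots> = (\<integral>\<^sup>+x\<in>{a..<b}. g x \<partial>lborel) + (\<integral>\<^sup>+x\<in>{b..<a+T}. g x \<partial>lborel)"
      by (intro nn_integral_add) auto
    also have "(\<integral>\<^sup>+x\<in>{a..<b}. g x \<partial>lborel) = (\<integral>\<^sup>+x\<in>{a+T..<b+T}. g x \<partial>lborel)"
    proof -
      have "(\<integral>\<^sup>+x\<in>{a+T..<b+T}. g x \<partial>lborel)
          = (\<integral>\<^sup>+x. g (T + 1 * x) * indicator {a+T..<b+T} (T + 1 * x) \<partial>lborel)"
        by (subst nn_integral_real_affine[where c=1 and t=T]) auto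
      also have "\<dots> = (\<integral>\<^sup>+x\<in>{a..<b}. g x \<partial>lborel)"
        using per by (intro nn_integral_cong) (auto split: split_indicator simp: add.commute)
      finally show ?thesis by simp
    qed
    also have "\<dots> + (\<integral>\<^sup>+x\<in>{b..<a+T}. g x \<partial>lborel) =
        (\<integral>\<^sup>+x. g x * indicator {a+T..<b+T} x + g x * indicator {b..<a+T} x \<partial>lborel)"
      by (intro nn_integral_add[symmetric]) auto
    also have "\<dots> = (\<integral>\<^sup>+x\<in>{b..<b+T}. g x \<partial>lborel)"
      using that by (intro nn_integral_cong) (auto split: split_indicator)
    finally show ?thesis .
  qed
  show ?thesis
  proof (cases "a \<le> b")
    case True then show ?thesis using ab by (intro *) auto
  next
    case False then show ?thesis using ab by (intro *[symmetric]) auto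
  qed
qed

lemma borel_measurable_tan [measurable]: "(tan :: real \<Rightarrow> real) \<in> borel_measurable borel"
  unfolding tan_def by measurable

text \<open>The substitution rule for compact intervals is applied on \<open>[-n, n]\<close>, whose
  preimage under \<open>tan\<close> stays away from the zeros of \<open>cos\<close>. Both sides grow
  with \<open>n\<close> and exhaust the line and the open interval, so monotone convergence
  finishes.\<close>

lemma nn_integral_tan_substitution:
  fixes g :: "real \<Rightarrow> ennreal"
  assumes [measurable]: "g \<in> borel_measurable borel"
  shows "(\<integral>\<^sup>+s. g s \<partial>lborel) =
    (\<integral>\<^sup>+\<psi>\<in>{-(pi/2)<..<pi/2}. g (tan \<psi>) * ennreal (inverse ((cos \<psi>)\<^sup>2)) \<partial>lborel)"
proof -
  let ?h = "\<lambda>\<psi>. g (tan \<psi>) * ennreal (inverse ((cos \<psi>)\<^sup>2))"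
  have bnd: "- (pi/2) < arctan x" "arctan x < pi/2" for x
    using arctan_bounded[of x] by auto
  have step: "(\<integral>\<^sup>+s\<in>{-real n..real n}. g s \<partial>lborel) =
      (\<integral>\<^sup>+\<psi>\<in>{arctan (-real n)..arctan (real n)}. ?h \<psi> \<partial>lborel)"
    if "n > 0" for n :: nat
  proof -
    have cz: "cos x \<noteq> 0" if "x \<in> {arctan (-real n)..arctan (real n)}" for x
      using that bnd(1)[of "-real n"] bnd(2)[of "real n"] cos_gt_zero_pi[of x] by force
    have "(\<integral>\<^sup>+s\<in>{tan (arctan (-real n))..tan (arctan (real n))}. g s \<partial>lborel) =
      (\<integral>\<^sup>+\<psi>\<in>{arctan (-real n)..arctan (real n)}. ?h \<psi> \<partial>lborel)"
    proof (rule nn_integral_substitution_aux)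
      show "continuous_on {arctan (-real n)..arctan (real n)} (\<lambda>x. inverse ((cos x)\<^sup>2))"
        using cz by (intro continuous_intros) auto
      show "arctan (-real n) < arctan (real n)" unfolding arctan_less_iff using that by simp
    qed (use cz in \<open>auto intro!: DERIV_tan\<close>)
    then show ?thesis by (simp only: tan_arctan)
  qed
  \<comment> \<open>The exhaustion uses \<open>Suc n\<close> because substitution on
    \<open>[-n, n]\<close> needs a nondegenerate interval.\<close>
  have "(\<integral>\<^sup>+s. g s \<partial>lborel) = (\<integral>\<^sup>+s. (SUP n. g s * indicator {-real (Suc n)..real (Suc n)} s) \<partial>lborel)"
  proof (rule nn_integral_cong)
    fix s :: real
    obtain n where n: "\<bar>s\<bar> \<le> real n" using real_arch_simple by blast
    show "g s = (SUP n. g s * indicator {-real (Suc n)..real (Suc n)} s)"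
    proof (rule antisym)
      have "g s = g s * indicator {-real (Suc n)..real (Suc n)} s"
        using n by (simp add: indicator_def abs_le_iff)
      then show "g s \<le> (SUP n. g s * indicator {-real (Suc n)..real (Suc n)} s)"
        by (metis (mono_tags, lifting) SUP_upper UNIV_I)
      show "(SUP n. g s * indicator {-real (Suc n)..real (Suc n)} s) \<le> g s"
        by (intro SUP_least) (auto split: split_indicator)
    qed
  qed
  also have "\<dots> = (SUP n. \<integral>\<^sup>+s\<in>{-real (Suc n)..real (Suc n)}. g s \<partial>lborel)"
    by (intro nn_integral_monotone_convergence_SUP) (auto simp: mono_def le_fun_def split: split_indicator)
  also have "\<dots> = (SUP n. \<integral>\<^sup>+\<psi>. ?h \<psi> *
      indicator {arctan (-real (Suc n))..arctan (real (Suc n))} \<psi> \<partial>lborel)"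
    by (intro SUP_cong refl step) auto
  also have "\<dots> = (\<integral>\<^sup>+\<psi>. (SUP n. ?h \<psi> *
      indicator {arctan (-real (Suc n))..arctan (real (Suc n))} \<psi>) \<partial>lborel)"
  proof (intro nn_integral_monotone_convergence_SUP[symmetric])
    have "indicator {arctan (-real (Suc m))..arctan (real (Suc m))} \<psi> \<le> (indicator {arctan (-real (Suc n))..arctan (real (Suc n))} \<psi> :: ennreal)"
      if "m \<le> n" for m n \<psi>
    proof -
      have "arctan (-real (Suc n)) \<le> arctan (-real (Suc m))" "arctan (real (Suc m)) \<le> arctan (real (Suc n))"
        unfolding arctan_le_iff using that by auto
      then show ?thesis by (intro indicator_leI) auto
    qed
    then show "mono (\<lambda>n \<psi>. ?h \<psi> *
      indicator {arctan (-real (Suc n))..arctan (real (Suc n))} \<psi>)"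
      by (intro monoI le_funI mult_left_mono) auto
  qed measurable
  also have "\<dots> = (\<integral>\<^sup>+\<psi>\<in>{-(pi/2)<..<pi/2}. ?h \<psi> \<partial>lborel)"
  proof (rule nn_integral_cong)
    fix s :: real
    show "(SUP n. ?h s * indicator {arctan (-real (Suc n))..arctan (real (Suc n))} s) = ?h s * indicator {-(pi/2)<..<pi/2} s"
    proof (rule antisym)
      show "(SUP n. ?h s * indicator {arctan (-real (Suc n))..arctan (real (Suc n))} s) \<le> ?h s * indicator {-(pi/2)<..<pi/2} s"
      proof (intro SUP_least)
        fix n show "?h s * indicator {arctan (-real (Suc n))..arctan (real (Suc n))} s \<le> ?h s * indicator {-(pi/2)<..<pi/2} s"
          using bnd(1)[of "-real (Suc n)"] bnd(2)[of "real (Suc n)"] by (force split: split_indicator)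
      qed
      show "?h s * indicator {-(pi/2)<..<pi/2} s \<le> (SUP n. ?h s * indicator {arctan (-real (Suc n))..arctan (real (Suc n))} s)"
      proof (cases "s \<in> {-(pi/2)<..<pi/2}")
        case True
        obtain n where n: "\<bar>tan s\<bar> \<le> real n" using real_arch_simple by blast
        have "arctan (-real (Suc n)) \<le> arctan (tan s)" "arctan (tan s) \<le> arctan (real (Suc n))"
          unfolding arctan_le_iff using n by auto
        moreover have "arctan (tan s) = s" using True by (intro arctan_tan) auto
        ultimately have "?h s * indicator {-(pi/2)<..<pi/2} s = ?h s * indicator {arctan (-real (Suc n))..arctan (real (Suc n))} s"
          using True by auto
        then show ?thesis by (metis (mono_tags, lifting) SUP_upper UNIV_I)
      qed auto
    qed
  qed
  finally show ?thesis .
qed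

text \<open>On the vertical line at \<open>x > 0\<close> the substitution
  \<open>y = x tan \<psi>\<close> introduces the angle, with Jacobian
  \<open>x / cos^2 \<psi>\<close>. After exchanging the integrals, \<open>x = r cos \<psi>\<close>
  is substituted for each fixed angle; its factor \<open>cos \<psi>\<close> turns the Jacobian into
  \<open>r\<close>.\<close>

lemma nn_integral_right_half_plane_polar:
  fixes f :: "real \<times> real \<Rightarrow> ennreal"
  assumes [measurable]: "f \<in> borel_measurable borel"
  shows "(\<integral>\<^sup>+x. \<integral>\<^sup>+y. f (x, y) * indicator {0<..} x \<partial>lborel \<partial>lborel) =
    (\<integral>\<^sup>+r. \<integral>\<^sup>+\<psi>. ennreal r * indicator {0<..} r * (f (r * cos \<psi>, r * sin \<psi>) * indicator {-(pi/2)<..<pi/2} \<psi>) \<partial>lborel \<partial>lborel)"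
    (is "_ = ?R")
proof -
  let ?A = "\<lambda>x \<psi>. ennreal x * indicator {0<..} x * f (x, x * tan \<psi>) * ennreal (inverse ((cos \<psi>)\<^sup>2))"
  let ?J = "{-(pi/2)<..<pi/2}"
  have [measurable]: "f \<in> borel_measurable (borel \<Otimes>\<^sub>M borel)" by (simp add: borel_prod)
  have inner: "(\<integral>\<^sup>+y. f (x, y) * indicator {0<..} x \<partial>lborel) =
     (\<integral>\<^sup>+\<psi>\<in>?J. ?A x \<psi> \<partial>lborel)"
    for x :: real
  proof (cases "x > 0")
    case True
    have "(\<integral>\<^sup>+y. f (x, y) * indicator {0<..} x \<partial>lborel) = ennreal x * (\<integral>\<^sup>+s. f (x, x * s) \<partial>lborel)"
      using True by (subst nn_integral_real_affine[where c=x and t=0]) auto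
    also have "\<dots> = ennreal x * (\<integral>\<^sup>+\<psi>\<in>?J. f (x, x * tan \<psi>) * ennreal (inverse ((cos \<psi>)\<^sup>2)) \<partial>lborel)"
      by (subst nn_integral_tan_substitution) auto
    also have "\<dots> = (\<integral>\<^sup>+\<psi>. ennreal x * (f (x, x * tan \<psi>) * ennreal (inverse ((cos \<psi>)\<^sup>2)) * indicator ?J \<psi>) \<partial>lborel)"
      by (rule nn_integral_cmult[symmetric]) auto
    finally show ?thesis using True by (simp add: mult.assoc)
  qed auto
  have "(\<integral>\<^sup>+x. \<integral>\<^sup>+y. f (x, y) * indicator {0<..} x \<partial>lborel \<partial>lborel) =
    (\<integral>\<^sup>+\<psi>. \<integral>\<^sup>+x. ?A x \<psi> * indicator ?J \<psi> \<partial>lborel \<partial>lborel)"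
    unfolding inner by (rule lborel_pair.Fubini') measurable
  also have "\<dots> = (\<integral>\<^sup>+\<psi>. \<integral>\<^sup>+r. ennreal r * indicator {0<..} r * (f (r * cos \<psi>, r * sin \<psi>) * indicator ?J \<psi>) \<partial>lborel \<partial>lborel)"
  proof (rule nn_integral_cong)
    fix \<psi> :: real
    show "(\<integral>\<^sup>+x. ?A x \<psi> * indicator ?J \<psi> \<partial>lborel) =
      (\<integral>\<^sup>+r. ennreal r * indicator {0<..} r * (f (r * cos \<psi>, r * sin \<psi>) * indicator ?J \<psi>) \<partial>lborel)"
    proof (cases "\<psi> \<in> ?J")
      case True
      then have c: "cos \<psi> > 0" using cos_gt_zero_pi[of \<psi>] by auto
      have "(\<integral>\<^sup>+x. ?A x \<psi> \<partial>lborel) =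
        ennreal (cos \<psi>) * (\<integral>\<^sup>+r. ?A (cos \<psi> * r) \<psi> \<partial>lborel)"
        using c by (subst nn_integral_real_affine[where c="cos \<psi>" and t=0]) auto
      also have "\<dots> = (\<integral>\<^sup>+r. ennreal (cos \<psi>) * (?A (cos \<psi> * r) \<psi>) \<partial>lborel)"
        by (rule nn_integral_cmult[symmetric]) auto
      also have "\<dots> = (\<integral>\<^sup>+r. ennreal r * indicator {0<..} r * f (r * cos \<psi>, r * sin \<psi>) \<partial>lborel)"
      proof (rule nn_integral_cong)
        fix r :: real
        show "ennreal (cos \<psi>) * (?A (cos \<psi> * r) \<psi>)
           = ennreal r * indicator {0<..} r * f (r * cos \<psi>, r * sin \<psi>)"
        proof (cases "r > 0")
          case True
          have "cos \<psi> * r * tan \<psi> = r * sin \<psi>" using c by (simp add: tan_def)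
          moreover have "ennreal (cos \<psi>) * ennreal (cos \<psi> * r) * ennreal (inverse ((cos \<psi>)\<^sup>2)) = ennreal r"
            using c True by (simp add: ennreal_mult[symmetric] power2_eq_square field_simps)
          ultimately have "(ennreal (cos \<psi>) * ennreal (cos \<psi> * r) * ennreal (inverse ((cos \<psi>)\<^sup>2))) * f (cos \<psi> * r, cos \<psi> * r * tan \<psi>)
              = ennreal r * f (r * cos \<psi>, r * sin \<psi>)"
            by (simp only: mult.commute[of r])
          then have "ennreal (cos \<psi>) * (ennreal (cos \<psi> * r) * 1 * f (cos \<psi> * r, cos \<psi> * r * tan \<psi>) * ennreal (inverse ((cos \<psi>)\<^sup>2)))
              = ennreal r * 1 * f (r * cos \<psi>, r * sin \<psi>)"
            by (simp only: mult_1_right mult.assoc mult.commute[of "f _"])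
          then show ?thesis using True c by simp
        qed (use c in \<open>auto simp: zero_less_mult_iff split: split_indicator\<close>)
      qed
      finally show ?thesis using True by simp
    qed auto
  qed
  also have "\<dots> = ?R" by (rule lborel_pair.Fubini') measurable
  finally show ?thesis .
qed

text \<open>The axis \<open>x = 0\<close> is null, and the left half-plane is the image of the right
  one under \<open>z \<mapsto> - z\<close>, which adds \<open>pi\<close> to the angle. The two open
  arcs so obtained form a full period up to two angles, and the period is then moved to
  \<open>[-pi, pi)\<close>.\<close>

lemma nn_integral_polar:
  fixes f :: "real \<times> real \<Rightarrow> ennreal"
  assumes f[measurable]: "f \<in> borel_measurable borel"
  shows "(\<integral>\<^sup>+z. f z \<partial>lborel) =
    (\<integral>\<^sup>+r. ennreal r * indicator {0<..} r * (\<integral>\<^sup>+\<psi>\<in>{-pi..<pi}. f (r * cos \<psi>, r * sin \<psi>) \<partial>lborel) \<partial>lborel)"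
proof -
  let ?J = "{-(pi/2)<..<pi/2}"
  have [measurable]: "f \<in> borel_measurable (borel \<Otimes>\<^sub>M borel)" by (simp add: borel_prod)
  have "(\<integral>\<^sup>+z. f z \<partial>lborel) = (\<integral>\<^sup>+x. \<integral>\<^sup>+y. f (x, y) \<partial>lborel \<partial>lborel)"
    by (simp add: lborel_prod[symmetric] lborel.nn_integral_fst[symmetric])
  also have "\<dots> = (\<integral>\<^sup>+x. (\<integral>\<^sup>+y. f (x, y) * indicator {0<..} x \<partial>lborel) + (\<integral>\<^sup>+y. f (x, y) * indicator {..<0} x \<partial>lborel) \<partial>lborel)"
    by (intro nn_integral_cong_AE AE_I[of _ _ "{0}"]) (auto split: split_indicator)
  also have "\<dots> = (\<integral>\<^sup>+x. (\<integral>\<^sup>+y. f (x, y) * indicator {0<..} x \<partial>lborel) \<partial>lborel) + (\<integral>\<^sup>+x. (\<integral>\<^sup>+y. f (x, y) * indicator {..<0} x \<partial>lborel) \<partial>lborel)"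
    by (intro nn_integral_add) measurable
  also have "(\<integral>\<^sup>+x. (\<integral>\<^sup>+y. f (x, y) * indicator {..<0} x \<partial>lborel) \<partial>lborel) = (\<integral>\<^sup>+x. (\<integral>\<^sup>+y. f (-x, -y) * indicator {0<..} x \<partial>lborel) \<partial>lborel)"
  proof -
    have "(\<integral>\<^sup>+x. (\<integral>\<^sup>+y. f (x, y) * indicator {..<0} x \<partial>lborel) \<partial>lborel) = (\<integral>\<^sup>+x. (\<integral>\<^sup>+y. f (-x, y) * indicator {..<0} (-x) \<partial>lborel) \<partial>lborel)"
      by (subst nn_integral_real_affine[where c="-1" and t=0]) auto
    also have "\<dots> = (\<integral>\<^sup>+x. (\<integral>\<^sup>+y. f (-x, -y) * indicator {..<0} (-x) \<partial>lborel) \<partial>lborel)"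
    proof (rule nn_integral_cong)
      fix x :: real
      show "(\<integral>\<^sup>+y. f (-x, y) * indicator {..<0} (-x) \<partial>lborel) = (\<integral>\<^sup>+y. f (-x, -y) * indicator {..<0} (-x) \<partial>lborel)"
        by (subst nn_integral_real_affine[where c="-1" and t=0]) auto
    qed
    also have "\<dots> = (\<integral>\<^sup>+x. (\<integral>\<^sup>+y. f (-x, -y) * indicator {0<..} x \<partial>lborel) \<partial>lborel)"
      by (intro nn_integral_cong) (simp add: indicator_def)
    finally show ?thesis .
  qed
  also have "\<dots> = (\<integral>\<^sup>+r. \<integral>\<^sup>+\<psi>. ennreal r * indicator {0<..} r * (f (-(r * cos \<psi>), -(r * sin \<psi>)) * indicator ?J \<psi>) \<partial>lborel \<partial>lborel)"
  proof -
    have "(\<lambda>z. f (- z)) \<in> borel_measurable borel" by measurable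
    from nn_integral_right_half_plane_polar[OF this] show ?thesis by simp
  qed
  also have "(\<integral>\<^sup>+x. (\<integral>\<^sup>+y. f (x, y) * indicator {0<..} x \<partial>lborel) \<partial>lborel) =
      (\<integral>\<^sup>+r. \<integral>\<^sup>+\<psi>. ennreal r * indicator {0<..} r * (f (r * cos \<psi>, r * sin \<psi>) * indicator ?J \<psi>) \<partial>lborel \<partial>lborel)"
    by (rule nn_integral_right_half_plane_polar) measurable
  also have "\<dots> + (\<integral>\<^sup>+r. \<integral>\<^sup>+\<psi>. ennreal r * indicator {0<..} r * (f (-(r * cos \<psi>), -(r * sin \<psi>)) * indicator ?J \<psi>) \<partial>lborel \<partial>lborel)
    = (\<integral>\<^sup>+r. (\<integral>\<^sup>+\<psi>. ennreal r * indicator {0<..} r * (f (r * cos \<psi>, r * sin \<psi>) * indicator ?J \<psi>) \<partial>lborel) +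
       (\<integral>\<^sup>+\<psi>. ennreal r * indicator {0<..} r * (f (-(r * cos \<psi>), -(r * sin \<psi>)) * indicator ?J \<psi>) \<partial>lborel) \<partial>lborel)"
    by (intro nn_integral_add[symmetric]) measurable
  also have "\<dots> = (\<integral>\<^sup>+r. ennreal r * indicator {0<..} r * (\<integral>\<^sup>+\<psi>\<in>{-pi..<pi}. f (r * cos \<psi>, r * sin \<psi>) \<partial>lborel) \<partial>lborel)"
  proof (rule nn_integral_cong)
    fix r :: real
    let ?g = "\<lambda>\<psi>. f (r * cos \<psi>, r * sin \<psi>)"
    have "(\<integral>\<^sup>+\<psi>\<in>?J. f (-(r * cos \<psi>), -(r * sin \<psi>)) \<partial>lborel) =
       (\<integral>\<^sup>+\<psi>\<in>{pi/2<..<3*pi/2}. ?g \<psi> \<partial>lborel)"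
      by (subst (2) nn_integral_real_affine[where c=1 and t=pi])
         (auto simp: cos_add sin_add indicator_def intro!: nn_integral_cong)
    then have "(\<integral>\<^sup>+\<psi>\<in>?J. ?g \<psi> \<partial>lborel) +
       (\<integral>\<^sup>+\<psi>\<in>?J. f (-(r * cos \<psi>), -(r * sin \<psi>)) \<partial>lborel) =
       (\<integral>\<^sup>+\<psi>. ?g \<psi> * indicator ?J \<psi> + ?g \<psi> * indicator {pi/2<..<3*pi/2} \<psi> \<partial>lborel)"
      by (simp add: nn_integral_add)
    also have "\<dots> = (\<integral>\<^sup>+\<psi>\<in>{-(pi/2)..<-(pi/2) + 2*pi}. ?g \<psi> \<partial>lborel)"
      by (intro nn_integral_cong_AE AE_I[of _ _ "{-(pi/2), pi/2}"])
         (auto split: split_indicator simp: emeasure_lborel_countable)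
    also have "\<dots> = (\<integral>\<^sup>+\<psi>\<in>{-pi..<-pi + 2*pi}. ?g \<psi> \<partial>lborel)"
      by (rule nn_integral_periodic_shift) auto
    finally have *: "(\<integral>\<^sup>+\<psi>\<in>?J. ?g \<psi> \<partial>lborel) +
       (\<integral>\<^sup>+\<psi>\<in>?J. f (-(r * cos \<psi>), -(r * sin \<psi>)) \<partial>lborel) = (\<integral>\<^sup>+\<psi>\<in>{-pi..<pi}. ?g \<psi> \<partial>lborel)"
      by simp
    show "(\<integral>\<^sup>+\<psi>. ennreal r * indicator {0<..} r * (f (r * cos \<psi>, r * sin \<psi>) * indicator ?J \<psi>) \<partial>lborel) +
       (\<integral>\<^sup>+\<psi>. ennreal r * indicator {0<..} r * (f (-(r * cos \<psi>), -(r * sin \<psi>)) * indicator ?J \<psi>) \<partial>lborel)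
      = ennreal r * indicator {0<..} r * (\<integral>\<^sup>+\<psi>\<in>{-pi..<pi}. f (r * cos \<psi>, r * sin \<psi>) \<partial>lborel)"
      unfolding *[symmetric] by (simp add: nn_integral_cmult distrib_left)
  qed
  finally show ?thesis .
qed

section \<open>Point processes given by void probabilities and intensity\<close>

lemma bounded_borel_fmeasurable:
  fixes A :: "'a::euclidean_space set"
  shows "A \<in> sets borel \<Longrightarrow> bounded A \<Longrightarrow> A \<in> fmeasurable lborel"
  using emeasure_bounded_finite[of A] by (simp add: fmeasurable_def)

text \<open>What the later estimate needs is a partition into \<open>n\<close> pieces each of area
  of order \<open>1 / n\<close>; their shape is free, so the bounding square of side
  \<open>2 R\<close> is cut in one direction only. A strip has width \<open>2 R / n\<close> and
  height \<open>2 R\<close>, hence \<open>K = 4 R^2\<close>; \<open>h\<close> rescales the first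
  coordinate from \<open>(-R, R)\<close> to \<open>(0, n)\<close>, and its floor is the strip
  number.\<close>

lemma thin_strips:
  fixes A :: "(real \<times> real) set"
  assumes [measurable]: "A \<in> sets borel" and "bounded A"
  obtains K where "K \<ge> 0"
    "\<And>n. n > 0 \<Longrightarrow> \<exists>C. (\<forall>k<n. C k \<in> sets borel \<and> measure lborel (C k) \<le> K / real n) \<and>
       disjoint_family_on C {..<n} \<and> A = (\<Union>k<n. C k)"
proof -
  obtain R where R: "R > 0" "\<And>z. z \<in> A \<Longrightarrow> norm z < R"
    using \<open>bounded A\<close> bounded_pos_less by blast
  have fR: "\<bar>fst z\<bar> < R" "\<bar>snd z\<bar> < R" if "z \<in> A" for z
    using R(2)[OF that] norm_fst_le[of "fst z" "snd z"] norm_snd_le[of "snd z" "fst z"] by auto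
  show thesis
  proof (rule that)
    show "4 * R\<^sup>2 \<ge> 0" by simp
    fix n :: nat assume n: "n > 0"
    define h where "h z = n * (fst z + R) / (2 * R)" for z :: "real \<times> real"
    have h: "0 \<le> h z" "h z < n" if "z \<in> A" for z
    proof -
      show "0 \<le> h z" using fR[OF that] R(1) unfolding h_def by (intro divide_nonneg_pos mult_nonneg_nonneg) auto
      have "(fst z + R) / (2 * R) < 1" using fR[OF that] R(1) by (simp add: field_simps)
      then have "n * ((fst z + R) / (2 * R)) < real n * 1" using n by (intro mult_strict_left_mono) auto
      then show "h z < n" unfolding h_def by simp
    qed
    have [measurable]: "h \<in> borel_measurable borel"
      unfolding h_def[abs_def] by (intro borel_measurable_continuous_onI continuous_intros) (use R in auto)
    define C where "C k = {z \<in> A. \<lfloor>h z\<rfloor> = int k}" for k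
    have Cm: "C k \<in> sets borel" for k
    proof -
      have "C k = A \<inter> {z \<in> space borel. \<lfloor>h z\<rfloor> = int k}" by (auto simp: C_def)
      also have "\<dots> \<in> sets borel" by measurable
      finally show ?thesis .
    qed
    have "measure lborel (C k) \<le> 4 * R\<^sup>2 / n" for k
    proof -
      let ?a = "2 * R * k / n - R"
      let ?S = "cbox (?a, -R) (?a + 2 * R / n, R)"
      have "C k \<subseteq> ?S"
      proof
        fix z assume z: "z \<in> C k"
        then have "real k \<le> h z" "h z \<le> real k + 1" unfolding C_def by (auto simp: floor_eq_iff)
        then have "?a \<le> fst z" "fst z \<le> ?a + 2 * R / n"
          using R(1) n unfolding h_def by (auto simp: field_simps)
        moreover have "\<bar>snd z\<bar> < R" using z fR unfolding C_def by auto
        ultimately show "z \<in> ?S"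
          by (cases z) (auto simp: cbox_Pair_eq abs_less_iff)
      qed
      then have "measure lborel (C k) \<le> measure lborel ?S"
        using Cm by (intro measure_mono_fmeasurable) auto
      also have "\<dots> = 4 * R\<^sup>2 / n"
        using R(1) n by (simp add: content_Pair power2_eq_square)
      finally show ?thesis .
    qed
    moreover have "disjoint_family_on C {..<n}" unfolding disjoint_family_on_def C_def by auto
    moreover have "A = (\<Union>k<n. C k)"
    proof -
      have "\<exists>k<n. \<lfloor>h z\<rfloor> = int k" if "z \<in> A" for z
        using h[OF that] by (intro exI[of _ "nat \<lfloor>h z\<rfloor>"]) (auto simp: floor_less_iff nat_less_iff)
      then show ?thesis unfolding C_def by auto
    qed
    ultimately show "\<exists>C. (\<forall>k<n. C k \<in> sets borel \<and> measure lborel (C k) \<le> 4 * R\<^sup>2 / real n) \<and>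
       disjoint_family_on C {..<n} \<and> A = (\<Union>k<n. C k)"
      using Cm by blast
  qed
qed

text \<open>Void probabilities and the intensity measure are all that the argument uses of the Poisson property.\<close>

locale planar_poisson = prob_space M for M :: "'w measure" +
  fixes lam :: real and Y :: "nat \<Rightarrow> 'w \<Rightarrow> real \<times> real"
  assumes lam_pos: "lam > 0"
    and Y_measurable [measurable]: "\<And>k. Y k \<in> borel_measurable M"
    and void_prob: "\<And>B. B \<in> sets borel \<Longrightarrow> bounded B \<Longrightarrow>
      prob {\<omega> \<in> space M. \<forall>k. Y k \<omega> \<notin> B} = exp (- (lam * measure lborel B))"
    and mean_count: "\<And>A. A \<in> sets borel \<Longrightarrow>
      (\<Sum>k. emeasure M {\<omega> \<in> space M. Y k \<omega> \<in> A}) = ennreal lam * emeasure lborel A"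
begin

definition Void :: "(real \<times> real) set \<Rightarrow> 'w set" where
  "Void B = {\<omega> \<in> space M. \<forall>k. Y k \<omega> \<notin> B}"

definition count :: "(real \<times> real) set \<Rightarrow> 'w \<Rightarrow> ennreal" where
  "count A \<omega> = (\<Sum>k. indicator A (Y k \<omega>))"

lemma sets_Void [measurable]:
  assumes [measurable]: "B \<in> sets borel" shows "Void B \<in> sets M"
  unfolding Void_def by measurable

lemma prob_Void: "B \<in> sets borel \<Longrightarrow> bounded B \<Longrightarrow> prob (Void B) = exp (- (lam * measure lborel B))"
  unfolding Void_def by (rule void_prob)

lemma Void_Int: "Void B \<inter> Void C = Void (B \<union> C)"
  unfolding Void_def by auto

lemma borel_measurable_count [measurable]:
  assumes [measurable]: "A \<in> sets borel" shows "count A \<in> borel_measurable M"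
  unfolding count_def[abs_def] by measurable

lemma nn_integral_count:
  assumes [measurable]: "A \<in> sets borel"
  shows "(\<integral>\<^sup>+\<omega>. count A \<omega> \<partial>M) = ennreal lam * emeasure lborel A"
proof -
  have "(\<integral>\<^sup>+\<omega>. count A \<omega> \<partial>M) = (\<Sum>k. \<integral>\<^sup>+\<omega>. indicator A (Y k \<omega>) \<partial>M)"
    unfolding count_def by (rule nn_integral_suminf) measurable
  also have "(\<lambda>k. \<integral>\<^sup>+\<omega>. indicator A (Y k \<omega>) \<partial>M) = (\<lambda>k. emeasure M {\<omega> \<in> space M. Y k \<omega> \<in> A})"
  proof
    fix k
    have "(\<integral>\<^sup>+\<omega>. indicator A (Y k \<omega>) \<partial>M) = (\<integral>\<^sup>+\<omega>. indicator {\<omega> \<in> space M. Y k \<omega> \<in> A} \<omega> \<partial>M)"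
      by (intro nn_integral_cong) (auto split: split_indicator)
    then show "(\<integral>\<^sup>+\<omega>. indicator A (Y k \<omega>) \<partial>M) = emeasure M {\<omega> \<in> space M. Y k \<omega> \<in> A}"
      by simp
  qed
  finally show ?thesis by (simp add: mean_count)
qed

lemma count_finite_disjoint_Union:
  assumes "finite J" "disjoint_family_on C J" "A = (\<Union>j\<in>J. C j)"
  shows "count A \<omega> = (\<Sum>j\<in>J. count (C j) \<omega>)"
proof -
  have "indicator A y = (\<Sum>j\<in>J. indicator (C j) y :: ennreal)" for y
    unfolding assms(3) using assms(1,2) by (rule indicator_UN_disjoint)
  then have "count A \<omega> = (\<Sum>k. \<Sum>j\<in>J. indicator (C j) (Y k \<omega>))"
    unfolding count_def by simp
  also have "\<dots> = (\<Sum>j\<in>J. count (C j) \<omega>)"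
    unfolding count_def by (rule suminf_sum) auto
  finally show ?thesis .
qed

lemma not_Void_le_count:
  assumes "\<omega> \<in> space M" shows "indicator (space M - Void C) \<omega> \<le> count C \<omega>"
proof (cases "\<omega> \<in> Void C")
  case False
  then obtain k where k: "Y k \<omega> \<in> C" using assms by (auto simp: Void_def)
  have "(\<Sum>i\<in>{k}. indicator C (Y i \<omega>)) \<le> count C \<omega>"
    unfolding count_def by (rule sum_le_suminf) auto
  with k show ?thesis by (auto split: split_indicator)
qed auto

text \<open>A point of \<open>C\<close> makes \<open>count C\<close> at least 1; summing over ever thinner strips \<open>C\<close> of \<open>A\<close> gives the bound.\<close>

lemma nn_integral_count_ge:
  assumes A[measurable]: "A \<in> sets borel" and bA: "bounded A" and V[measurable]: "V \<in> sets M" and "q \<ge> 0"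
    and key: "\<And>C. C \<in> sets borel \<Longrightarrow> C \<subseteq> A \<Longrightarrow> prob (V - Void C) = q * (1 - exp (- (lam * measure lborel C)))"
  shows "ennreal (q * (lam * measure lborel A)) \<le> (\<integral>\<^sup>+\<omega>\<in>V. count A \<omega> \<partial>M)"
proof -
  obtain K where K: "K \<ge> 0"
    "\<And>n. n > 0 \<Longrightarrow> \<exists>C. (\<forall>k<n. C k \<in> sets borel \<and> measure lborel (C k) \<le> K / real n) \<and>
       disjoint_family_on C {..<n} \<and> A = (\<Union>k<n. C k)"
    using thin_strips[OF A bA] by blast
  \<comment> \<open>From \<open>exp c \<ge> 1 + c\<close> follows
    \<open>1 - exp (- c) \<ge> c / (1 + c)\<close>. With \<open>c \<le> lam K / n\<close> on every
    strip, the loss is the single factor \<open>1 / (1 + lam K / n)\<close>, which tends to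
    1.\<close>
  have "ennreal (q * (lam * measure lborel A / (1 + lam * K / real n))) \<le> (\<integral>\<^sup>+\<omega>\<in>V. count A \<omega> \<partial>M)"
    if "n > 0" for n
  proof -
    obtain C where C: "\<And>k. k < n \<Longrightarrow> C k \<in> sets borel" "\<And>k. k < n \<Longrightarrow> measure lborel (C k) \<le> K / real n"
       "disjoint_family_on C {..<n}" "A = (\<Union>k<n. C k)"
      using K(2)[OF \<open>n > 0\<close>] by blast
    have bC: "bounded (C k)" if "k < n" for k
      using bA bounded_subset C(4) that by blast
    have fin: "C k \<in> fmeasurable lborel" if "k < n" for k
      using bC[OF that] C(1)[OF that] by (intro bounded_borel_fmeasurable)
    have "lam * measure lborel A / (1 + lam * K / n) = (\<Sum>k<n. lam * measure lborel (C k) / (1 + lam * K / n))"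
      unfolding C(4) using C fin
      by (subst measure_UNION') (auto simp: sum_divide_distrib sum_distrib_left disjoint_family_on_def pairwise_def disjnt_def)
    also have "\<dots> \<le> (\<Sum>k<n. 1 - exp (- (lam * measure lborel (C k))))"
    proof (rule sum_mono)
      fix k assume "k \<in> {..<n}"
      let ?c = "lam * measure lborel (C k)"
      have c: "0 \<le> ?c" "?c \<le> lam * K / n" using lam_pos C(2)[of k] \<open>k \<in> _\<close>
        by (auto simp flip: times_divide_eq_right)
      have "?c / (1 + lam * K / n) \<le> ?c / (1 + ?c)"
        using c by (intro divide_left_mono) (auto intro!: mult_pos_pos)
      also have "\<dots> = 1 - inverse (1 + ?c)" using c by (simp add: field_simps)
      also have "\<dots> \<le> 1 - exp (- ?c)"
        using c exp_ge_add_one_self[of ?c] by (auto simp: exp_minus intro!: le_imp_inverse_le)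
      finally show "?c / (1 + lam * K / n) \<le> 1 - exp (- ?c)" .
    qed
    finally have "ennreal (q * (lam * measure lborel A / (1 + lam * K / n))) \<le>
        ennreal (\<Sum>k<n. q * (1 - exp (- (lam * measure lborel (C k)))))"
      using \<open>q \<ge> 0\<close> unfolding sum_distrib_left[symmetric] by (intro ennreal_leI mult_left_mono)
    also have "\<dots> = ennreal (\<Sum>k<n. prob (V - Void (C k)))"
      using C by (intro arg_cong[where f=ennreal] sum.cong refl key[symmetric]) auto
    also have "\<dots> = (\<Sum>k<n. emeasure M (V - Void (C k)))"
      by (simp add: emeasure_eq_measure)
    also have "\<dots> = (\<Sum>k<n. \<integral>\<^sup>+\<omega>. indicator (V - Void (C k)) \<omega> \<partial>M)"
      using C(1) by (intro sum.cong refl nn_integral_indicator[symmetric]) auto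
    also have "\<dots> = (\<integral>\<^sup>+\<omega>. (\<Sum>k<n. indicator (V - Void (C k)) \<omega>) \<partial>M)"
      using C(1) by (intro nn_integral_sum[symmetric]) auto
    also have "\<dots> \<le> (\<integral>\<^sup>+\<omega>\<in>V. count A \<omega> \<partial>M)"
    proof (intro nn_integral_mono)
      fix \<omega> assume \<omega>: "\<omega> \<in> space M"
      have "(\<Sum>k<n. indicator (V - Void (C k)) \<omega>) = (\<Sum>k<n. indicator (space M - Void (C k)) \<omega>) * (indicator V \<omega> :: ennreal)"
        unfolding sum_distrib_right using \<omega> by (intro sum.cong) (auto simp: indicator_def)
      also have "\<dots> \<le> (\<Sum>k<n. count (C k) \<omega>) * indicator V \<omega>"
        using not_Void_le_count[OF \<omega>] by (intro mult_right_mono sum_mono) auto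
      also have "(\<Sum>k<n. count (C k) \<omega>) = count A \<omega>"
        using C by (intro count_finite_disjoint_Union[symmetric]) auto
      finally show "(\<Sum>k<n. indicator (V - Void (C k)) \<omega>) \<le> count A \<omega> * indicator V \<omega>" .
    qed
    finally show ?thesis .
  qed
  moreover have "(\<lambda>n. ennreal (q * (lam * measure lborel A / (1 + lam * K / real n)))) \<longlonglongrightarrow> ennreal (q * (lam * measure lborel A / (1 + 0)))"
    by (intro tendsto_ennrealI tendsto_intros lim_const_over_n) auto
  ultimately show ?thesis
    by (intro LIMSEQ_le_const2) (auto intro!: exI[of _ 1])
qed

text \<open>The lower bounds on \<open>Void B\<close> and on its complement add up to the mean of \<open>count A\<close>, so both are equalities.\<close>

lemma nn_integral_count_Void:
  assumes [measurable]: "A \<in> sets borel" "B \<in> sets borel" and b: "bounded A" "bounded B" and disj: "A \<inter> B = {}"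
  shows "(\<integral>\<^sup>+\<omega>\<in>(Void B). count A \<omega> \<partial>M) = ennreal (lam * measure lborel A * exp (- (lam * measure lborel B)))"
    (is "?f1 = _")
proof -
  define p where "p = exp (- (lam * measure lborel B))"
  define a where "a = lam * measure lborel A"
  have p: "0 < p" "p \<le> 1" and a: "a \<ge> 0" using lam_pos by (auto simp: p_def a_def)
  let ?f2 = "\<integral>\<^sup>+\<omega>\<in>(space M - Void B). count A \<omega> \<partial>M"
  have PB: "prob (Void B) = p" unfolding p_def using b by (intro prob_Void) auto
  \<comment> \<open>Area is additive over the disjoint sets \<open>B\<close> and \<open>C\<close>
    and \<open>exp\<close> turns sums into products: this is the independence of voids in disjoint
    sets.\<close>
  have PC: "prob (Void C) = exp (- (lam * measure lborel C))" "prob (Void B \<inter> Void C) = p * exp (- (lam * measure lborel C))"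
    if [measurable]: "C \<in> sets borel" and CA: "C \<subseteq> A" for C
  proof -
    have bC: "bounded C" using CA b bounded_subset by blast
    then show "prob (Void C) = exp (- (lam * measure lborel C))" by (intro prob_Void) auto
    have "measure lborel (B \<union> C) = measure lborel B + measure lborel C"
      using disj CA b bC by (intro measure_Un2[THEN trans] arg_cong2[where f="(+)"] bounded_borel_fmeasurable)
        (auto intro!: arg_cong[where f="measure lborel"])
    moreover have "B \<inter> C = {}" using disj CA by auto
    ultimately show "prob (Void B \<inter> Void C) = p * exp (- (lam * measure lborel C))"
      unfolding Void_Int using b bC by (subst prob_Void) (auto simp: p_def exp_add[symmetric] algebra_simps)
  qed
  have f1: "ennreal (p * a) \<le> ?f1"
    unfolding a_def
  proof (rule nn_integral_count_ge)
    fix C :: "(real \<times> real) set" assume C[measurable]: "C \<in> sets borel" and "C \<subseteq> A"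
    then show "prob (Void B - Void C) = p * (1 - exp (- (lam * measure lborel C)))"
      using finite_measure_Diff'[of "Void B" "Void C"] PB PC(2)[of C] by (simp add: algebra_simps)
  qed (use b p in auto)
  have f2: "ennreal ((1 - p) * a) \<le> ?f2"
    unfolding a_def
  proof (rule nn_integral_count_ge)
    fix C :: "(real \<times> real) set" assume C[measurable]: "C \<in> sets borel" and "C \<subseteq> A"
    \<comment> \<open>Inclusion and exclusion: independence of two events passes to their
      complements.\<close>
    have "space M - Void B - Void C = space M - (Void B \<union> Void C)" by auto
    then show "prob (space M - Void B - Void C) = (1 - p) * (1 - exp (- (lam * measure lborel C)))"
      using prob_compl[of "Void B \<union> Void C"] finite_measure_Union'[of "Void B" "Void C"]
        finite_measure_Diff'[of "Void C" "Void B"] PB PC[OF C \<open>C \<subseteq> A\<close>] by (simp add: algebra_simps Int_commute)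
  qed (use b p in auto)
  have "?f1 + ?f2 = (\<integral>\<^sup>+\<omega>. count A \<omega> * indicator (Void B) \<omega> + count A \<omega> * indicator (space M - Void B) \<omega> \<partial>M)"
    by (intro nn_integral_add[symmetric]) measurable
  also have "\<dots> = (\<integral>\<^sup>+\<omega>. count A \<omega> \<partial>M)"
    by (intro nn_integral_cong) (auto split: split_indicator)
  also have "\<dots> = ennreal a"
    using b lam_pos emeasure_bounded_finite[of A]
    by (simp add: nn_integral_count a_def emeasure_eq_ennreal_measure ennreal_mult)
  finally have sum: "?f1 + ?f2 = ennreal a" .
  then have fin: "?f1 \<noteq> \<top>" "?f2 \<noteq> \<top>" by (auto simp: ennreal_add_eq_top[symmetric])
  define r1 r2 where "r1 = enn2real ?f1" and "r2 = enn2real ?f2"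
  have r: "?f1 = ennreal r1" "r1 \<ge> 0" "?f2 = ennreal r2" "r2 \<ge> 0"
    using fin by (auto simp: r1_def r2_def less_top)
  from sum have "r1 + r2 = a" unfolding r(1,3) using r(2,4) a by (simp add: ennreal_plus[symmetric] del: ennreal_plus)
  moreover have "p * a \<le> r1" "(1 - p) * a \<le> r2"
    using f1 f2 unfolding r(1,3) using r(2,4) by (auto simp: ennreal_le_iff)
  ultimately have "r1 = p * a" by (simp add: algebra_simps)
  then show ?thesis unfolding r(1) by (simp add: p_def a_def mult.commute)
qed

end

section \<open>Nearest points\<close>

lemma nn_integral_of_bool:
  assumes [measurable]: "Measurable.pred M P"
  shows "(\<integral>\<^sup>+\<omega>. of_bool (P \<omega>) \<partial>M) = emeasure M {\<omega> \<in> space M. P \<omega>}"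
proof -
  have "(\<integral>\<^sup>+\<omega>. of_bool (P \<omega>) \<partial>M) = (\<integral>\<^sup>+\<omega>. indicator {\<omega> \<in> space M. P \<omega>} \<omega> \<partial>M)"
    by (intro nn_integral_cong) (simp add: indicator_def)
  then show ?thesis by simp
qed

section \<open>Rounded radii and the area of a union of two discs\<close>

lemma floor_scaled_tendsto:
  fixes d :: real
  shows "(\<lambda>n. of_int \<lfloor>real n * d\<rfloor> / real n) \<longlonglongrightarrow> d"
proof (rule tendsto_sandwich)
  show "\<forall>\<^sub>F n in sequentially. d - 1 / real n \<le> of_int \<lfloor>real n * d\<rfloor> / real n"
    using eventually_gt_at_top[of 0]
  proof eventually_elim
    case (elim n)
    have "real n * d - 1 \<le> of_int \<lfloor>real n * d\<rfloor>" by linarith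
    then have "(real n * d - 1) / real n \<le> of_int \<lfloor>real n * d\<rfloor> / real n" by (intro divide_right_mono) auto
    then show ?case using elim by (simp add: diff_divide_distrib)
  qed
  show "\<forall>\<^sub>F n in sequentially. of_int \<lfloor>real n * d\<rfloor> / real n \<le> d"
    using eventually_gt_at_top[of 0]
  proof eventually_elim
    case (elim n)
    have "of_int \<lfloor>real n * d\<rfloor> \<le> real n * d" by linarith
    then show ?case using elim by (simp add: field_simps)
  qed
  have "(\<lambda>n. d - 1 / real n) \<longlonglongrightarrow> d - 0" by (intro tendsto_intros lim_const_over_n)
  then show "(\<lambda>n. d - 1 / real n) \<longlonglongrightarrow> d" by simp
qed auto

lemma floor_scaled_le:
  fixes d :: real
  assumes "d \<ge> 0" shows "of_int \<lfloor>real n * d\<rfloor> / real n \<le> d"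
proof (cases "n = 0")
  case False
  have "of_int \<lfloor>real n * d\<rfloor> \<le> real n * d" by linarith
  then show ?thesis using False by (simp add: field_simps)
qed (use assms in auto)

text \<open>The area is an integral over \<open>z\<close> of a condition jointly measurable in
  \<open>y\<close> and \<open>z\<close>, so measurability in \<open>y\<close> comes from Tonelli's
  theorem.\<close>

lemma borel_measurable_measure_two_balls:
  fixes c c' :: "real \<times> real"
  assumes [measurable]: "r \<in> borel_measurable borel" "r' \<in> borel_measurable borel"
  shows "(\<lambda>y :: real \<times> real. measure lborel (ball c (r y) \<union> ball c' (r' y))) \<in> borel_measurable borel"
proof -
  have "(\<lambda>y :: real \<times> real. \<integral>\<^sup>+z. of_bool (dist c z < r y \<or> dist c' z < r' y) \<partial>lborel) \<in> borel_measurable borel"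
    by measurable
  also have "(\<lambda>y. \<integral>\<^sup>+z. of_bool (dist c z < r y \<or> dist c' z < r' y) \<partial>lborel) = (\<lambda>y. emeasure lborel (ball c (r y) \<union> ball c' (r' y)))"
  proof
    fix y
    have "(\<integral>\<^sup>+z. of_bool (dist c z < r y \<or> dist c' z < r' y) \<partial>lborel) = (\<integral>\<^sup>+z. indicator (ball c (r y) \<union> ball c' (r' y)) z \<partial>lborel)"
      by (intro nn_integral_cong) (auto split: split_indicator)
    then show "(\<integral>\<^sup>+z. of_bool (dist c z < r y \<or> dist c' z < r' y) \<partial>lborel) = emeasure lborel (ball c (r y) \<union> ball c' (r' y))"
      by simp
  qed
  finally show ?thesis unfolding measure_def by measurable
qed

text \<open>Approaching the radii from below makes the indicators converge at every point, boundary
  circles included: a point of an open ball lies strictly inside and is eventually captured, and a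
  point outside is never in a smaller ball.\<close>

lemma measure_two_balls_tendsto:
  fixes c c' :: "'a::euclidean_space"
  assumes r: "\<And>n. s n \<le> r" "s \<longlonglongrightarrow> r" and r': "\<And>n. s' n \<le> r'" "s' \<longlonglongrightarrow> r'"
  shows "(\<lambda>n. measure lborel (ball c (s n) \<union> ball c' (s' n))) \<longlonglongrightarrow> measure lborel (ball c r \<union> ball c' r')"
proof -
  have fin: "emeasure lborel (ball c a \<union> ball c' b) \<noteq> \<infinity>" for a b
    using emeasure_bounded_finite[of "ball c a \<union> ball c' b"] by auto
  have "(\<lambda>n. \<integral>\<^sup>+z. indicator (ball c (s n) \<union> ball c' (s' n)) z \<partial>lborel) \<longlonglongrightarrow> (\<integral>\<^sup>+z. indicator (ball c r \<union> ball c' r') z \<partial>lborel)"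
  proof (rule nn_integral_dominated_convergence)
    show "(\<integral>\<^sup>+z. indicator (ball c r \<union> ball c' r') z \<partial>lborel) < \<infinity>"
      using fin[of r r'] by (simp add: less_top)
    show "AE z in lborel. indicator (ball c (s n) \<union> ball c' (s' n)) z \<le> (indicator (ball c r \<union> ball c' r') z :: ennreal)" for n
      using r(1)[of n] r'(1)[of n] by (intro AE_I2) (auto split: split_indicator)
    show "AE z in lborel. (\<lambda>n. indicator (ball c (s n) \<union> ball c' (s' n)) z :: ennreal) \<longlonglongrightarrow> indicator (ball c r \<union> ball c' r') z"
    proof (intro AE_I2 tendsto_eventually)
      fix z
      show "\<forall>\<^sub>F n in sequentially. (indicator (ball c (s n) \<union> ball c' (s' n)) z :: ennreal) = indicator (ball c r \<union> ball c' r') z"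
      proof (cases "z \<in> ball c r \<union> ball c' r'")
        case True
        then have "(\<forall>\<^sub>F n in sequentially. dist c z < s n) \<or> (\<forall>\<^sub>F n in sequentially. dist c' z < s' n)"
          using order_tendstoD(1)[OF r(2), of "dist c z"] order_tendstoD(1)[OF r'(2), of "dist c' z"] by auto
        then show ?thesis using True by (auto elim!: eventually_mono)
      next
        case False
        then have "z \<notin> ball c (s n) \<union> ball c' (s' n)" for n
          using r(1)[of n] r'(1)[of n] by auto
        with False show ?thesis by auto
      qed
    qed
  qed (auto intro!: borel_measurable_indicator)
  then have "(\<lambda>n. ennreal (measure lborel (ball c (s n) \<union> ball c' (s' n)))) \<longlonglongrightarrow> ennreal (measure lborel (ball c r \<union> ball c' r'))"
    using fin by (simp add: emeasure_eq_ennreal_measure)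
  then show ?thesis by (subst (asm) tendsto_ennreal_iff) auto
qed

section \<open>The Mecke formula for an exclusion region made of two discs\<close>

context planar_poisson
begin

text \<open>On the class \<open>C j\<close> of points with \<open>\<tau> y = j\<close> the region is
  the fixed set \<open>W j\<close>, so the sum over the points is a count times a void indicator. No
  point lies in its own region, hence \<open>C j\<close> and \<open>W j\<close> are disjoint and
  \<open>nn_integral_count_Void\<close> gives the mean of this product. The finitely many classes
  are then added up.\<close>

lemma mecke_step:
  assumes A[measurable]: "A \<in> sets borel" and "bounded A" and J: "finite J"
    and \<tau>: "\<And>y. y \<in> A \<Longrightarrow> \<tau> y \<in> J" "\<And>j. j \<in> J \<Longrightarrow> {y \<in> A. \<tau> y = j} \<in> sets borel"
    and W: "\<And>j. j \<in> J \<Longrightarrow> W j \<in> sets borel" "\<And>j. j \<in> J \<Longrightarrow> bounded (W j)" "\<And>y. y \<in> A \<Longrightarrow> y \<notin> W (\<tau> y)"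
  shows "(\<Sum>i. \<integral>\<^sup>+\<omega>. indicator A (Y i \<omega>) * indicator (Void (W (\<tau> (Y i \<omega>)))) \<omega> \<partial>M) =
    (\<integral>\<^sup>+y. indicator A y * ennreal (lam * exp (- (lam * measure lborel (W (\<tau> y))))) \<partial>lborel)"
proof -
  let ?e = "\<lambda>B. ennreal (lam * exp (- (lam * measure lborel B)))"
  define C where "C j = {y \<in> A. \<tau> y = j}" for j
  have Cm[measurable]: "C j \<in> sets borel" if "j \<in> J" for j using \<tau>(2)[OF that] by (simp add: C_def)
  have bC: "bounded (C j)" for j using \<open>bounded A\<close> by (rule bounded_subset) (auto simp: C_def)
  have dec: "indicator A y * h (\<tau> y) = (\<Sum>j\<in>J. indicator (C j) y * h j)" for y and h :: "_ \<Rightarrow> ennreal"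
  proof (cases "y \<in> A")
    case True
    have "(\<Sum>j\<in>J. indicator (C j) y * h j) = (\<Sum>j\<in>{\<tau> y}. indicator (C j) y * h j)"
      using J \<tau>(1)[OF True] by (intro sum.mono_neutral_right) (auto simp: C_def)
    then show ?thesis using True by (simp add: C_def)
  qed (simp add: C_def)
  have "(\<Sum>i. \<integral>\<^sup>+\<omega>. indicator A (Y i \<omega>) * indicator (Void (W (\<tau> (Y i \<omega>)))) \<omega> \<partial>M) =
     (\<Sum>i. \<integral>\<^sup>+\<omega>. (\<Sum>j\<in>J. indicator (C j) (Y i \<omega>) * indicator (Void (W j)) \<omega>) \<partial>M)"
    by (subst dec) simp
  also have "\<dots> = (\<Sum>i. \<Sum>j\<in>J. \<integral>\<^sup>+\<omega>\<in>(Void (W j)). indicator (C j) (Y i \<omega>) \<partial>M)"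
  proof (intro suminf_cong nn_integral_sum)
    fix i j assume j: "j \<in> J"
    note [measurable] = Cm[OF j] W(1)[OF j]
    show "(\<lambda>\<omega>. indicator (C j) (Y i \<omega>) * (indicator (Void (W j)) \<omega> :: ennreal)) \<in> borel_measurable M"
      by measurable
  qed
  also have "\<dots> = (\<Sum>j\<in>J. \<Sum>i. \<integral>\<^sup>+\<omega>\<in>(Void (W j)). indicator (C j) (Y i \<omega>) \<partial>M)"
    by (rule suminf_sum) auto
  also have "\<dots> = (\<Sum>j\<in>J. \<integral>\<^sup>+y. indicator (C j) y * ?e (W j) \<partial>lborel)"
  proof (rule sum.cong[OF refl])
    fix j assume j: "j \<in> J"
    note [measurable] = Cm[OF j] W(1)[OF j]
    have "(\<Sum>i. \<integral>\<^sup>+\<omega>\<in>(Void (W j)). indicator (C j) (Y i \<omega>) \<partial>M) =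
        (\<integral>\<^sup>+\<omega>. (\<Sum>i. indicator (C j) (Y i \<omega>) * indicator (Void (W j)) \<omega>) \<partial>M)"
      by (rule nn_integral_suminf[symmetric]) measurable
    also have "\<dots> = (\<integral>\<^sup>+\<omega>\<in>(Void (W j)). count (C j) \<omega> \<partial>M)"
      unfolding count_def by simp
    also have "\<dots> = ennreal (lam * measure lborel (C j) * exp (- (lam * measure lborel (W j))))"
      using j bC W Cm[OF j] by (intro nn_integral_count_Void) (auto simp: C_def)
    also have "\<dots> = emeasure lborel (C j) * ?e (W j)"
      using bC[of j] lam_pos emeasure_bounded_finite[of "C j"]
      by (simp add: emeasure_eq_ennreal_measure ennreal_mult[symmetric] mult_ac)
    also have "\<dots> = (\<integral>\<^sup>+y. indicator (C j) y * ?e (W j) \<partial>lborel)"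
      by (subst nn_integral_multc) auto
    finally show "(\<Sum>i. \<integral>\<^sup>+\<omega>\<in>(Void (W j)). indicator (C j) (Y i \<omega>) \<partial>M) =
       (\<integral>\<^sup>+y. indicator (C j) y * ?e (W j) \<partial>lborel)" .
  qed
  also have "\<dots> = (\<integral>\<^sup>+y. (\<Sum>j\<in>J. indicator (C j) y * ?e (W j)) \<partial>lborel)"
    using Cm by (intro nn_integral_sum[symmetric]) measurable
  also have "\<dots> = (\<integral>\<^sup>+y. indicator A y * ?e (W (\<tau> y)) \<partial>lborel)"
    by (subst dec) simp
  finally show ?thesis .
qed

text \<open>Rounding the two radii down to multiples of \<open>1/n\<close> makes the exclusion region constant on finitely
  many pieces, each disjoint from its region.\<close>

lemma mecke_window:
  fixes c c' :: "real \<times> real" and R :: real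
  defines "A \<equiv> ball 0 R" and "U \<equiv> \<lambda>y. ball c (dist c y) \<union> ball c' (dist c' y)"
  shows "(\<Sum>i. \<integral>\<^sup>+\<omega>. indicator A (Y i \<omega>) * indicator (Void (U (Y i \<omega>))) \<omega> \<partial>M) =
    (\<integral>\<^sup>+y. indicator A y * ennreal (lam * exp (- (lam * measure lborel (U y)))) \<partial>lborel)"
proof -
  let ?e = "\<lambda>B. ennreal (lam * exp (- (lam * measure lborel B)))"
  define s where "s n d = of_int \<lfloor>real n * d\<rfloor> / real n" for n :: nat and d :: real
  define \<tau> where "\<tau> n y = (\<lfloor>real n * dist c y\<rfloor>, \<lfloor>real n * dist c' y\<rfloor>)" for n :: nat and y :: "real \<times> real"
  define W where "W n j = ball c (of_int (fst j) / real n) \<union> ball c' (of_int (snd j) / real n)" for n :: nat and j :: "int \<times> int"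
  let ?V = "\<lambda>n i \<omega>. (indicator (Void (W n (\<tau> n (Y i \<omega>)))) \<omega> :: ennreal)"
  let ?VU = "\<lambda>i \<omega>. (indicator (Void (U (Y i \<omega>))) \<omega> :: ennreal)"
  have sle: "s n (dist a b) \<le> dist a b" for n and a b :: "real \<times> real" unfolding s_def by (rule floor_scaled_le) auto
  have slim: "(\<lambda>n. s n d) \<longlonglongrightarrow> d" for d unfolding s_def by (rule floor_scaled_tendsto)
  have W\<tau>: "W n (\<tau> n y) = ball c (s n (dist c y)) \<union> ball c' (s n (dist c' y))" for n y
    by (simp add: W_def \<tau>_def s_def)
  have WU: "W n (\<tau> n y) \<subseteq> U y" for n y
    using sle[of n c y] sle[of n c' y] unfolding W\<tau> U_def by (auto intro: less_le_trans)
  have [measurable]: "A \<in> sets borel" by (simp add: A_def)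
  have [measurable]: "s n \<in> borel_measurable borel" for n unfolding s_def[abs_def] by measurable
  have Vset: "?VU i \<omega> = (of_bool (\<forall>k. \<not> (dist c (Y k \<omega>) < dist c (Y i \<omega>) \<or> dist c' (Y k \<omega>) < dist c' (Y i \<omega>))) :: ennreal)"
    if "\<omega> \<in> space M" for i \<omega>
    using that by (auto simp: Void_def U_def indicator_def)
  have Vset': "?V n i \<omega> = (of_bool (\<forall>k. \<not> (dist c (Y k \<omega>) < s n (dist c (Y i \<omega>)) \<or> dist c' (Y k \<omega>) < s n (dist c' (Y i \<omega>)))) :: ennreal)"
    if "\<omega> \<in> space M" for i \<omega> n
    using that by (auto simp: Void_def W\<tau> indicator_def)
  have Vm[measurable]: "(\<lambda>\<omega>. ?VU i \<omega>) \<in> borel_measurable M" for i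
    by (subst measurable_cong[OF Vset]) measurable
  have Vm'[measurable]: "(\<lambda>\<omega>. ?V n i \<omega>) \<in> borel_measurable M" for i n
    by (subst measurable_cong[OF Vset']) measurable
  define F where "F n i = (\<integral>\<^sup>+\<omega>. indicator A (Y i \<omega>) * ?V n i \<omega> \<partial>M)" for n i
  define F0 where "F0 i = (\<integral>\<^sup>+\<omega>. indicator A (Y i \<omega>) * ?VU i \<omega> \<partial>M)" for i
  have FP: "F n i \<le> emeasure M {\<omega> \<in> space M. Y i \<omega> \<in> A}" for n i
  proof -
    have "F n i \<le> (\<integral>\<^sup>+\<omega>. indicator {\<omega> \<in> space M. Y i \<omega> \<in> A} \<omega> \<partial>M)"
      unfolding F_def by (intro nn_integral_mono) (auto split: split_indicator)
    then show ?thesis by simp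
  qed
  have Flim: "(\<lambda>n. F n i) \<longlonglongrightarrow> F0 i" for i
    unfolding F_def F0_def
  proof (rule nn_integral_dominated_convergence[where w="\<lambda>_. 1"])
    show "AE \<omega> in M. (\<lambda>n. indicator A (Y i \<omega>) * ?V n i \<omega>) \<longlonglongrightarrow> indicator A (Y i \<omega>) * ?VU i \<omega>"
    proof (intro AE_I2 tendsto_eventually)
      fix \<omega> assume \<omega>: "\<omega> \<in> space M"
      \<comment> \<open>The rounded regions lie inside \<open>U\<close>, so a void \<open>U\<close>
        stays void. Otherwise one fixed point \<open>Y k \<omega>\<close> strictly inside
        \<open>U\<close> already lies in the rounded regions for all large \<open>n\<close>.\<close>
      have "\<forall>\<^sub>F n in sequentially. ?V n i \<omega> = ?VU i \<omega>"
      proof (cases "\<omega> \<in> Void (U (Y i \<omega>))")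
        case True
        then have "\<omega> \<in> Void (W n (\<tau> n (Y i \<omega>)))" for n using WU unfolding Void_def by blast
        then show ?thesis using True by simp
      next
        case False
        then obtain k where "dist c (Y k \<omega>) < dist c (Y i \<omega>) \<or> dist c' (Y k \<omega>) < dist c' (Y i \<omega>)"
          using \<omega> by (auto simp: Void_def U_def)
        then have "\<forall>\<^sub>F n in sequentially. Y k \<omega> \<in> W n (\<tau> n (Y i \<omega>))"
          using order_tendstoD(1)[OF slim, of "dist c (Y k \<omega>)" "dist c (Y i \<omega>)"] order_tendstoD(1)[OF slim, of "dist c' (Y k \<omega>)" "dist c' (Y i \<omega>)"]
          unfolding W\<tau> by (auto elim!: eventually_mono)
        then show ?thesis
        proof eventually_elim
          case (elim n)
          then have "\<omega> \<notin> Void (W n (\<tau> n (Y i \<omega>)))" unfolding Void_def by blast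
          then show ?case using False by simp
        qed
      qed
      then show "\<forall>\<^sub>F n in sequentially. indicator A (Y i \<omega>) * ?V n i \<omega> = indicator A (Y i \<omega>) * ?VU i \<omega>"
        by eventually_elim simp
    qed
  qed (auto split: split_indicator simp: emeasure_space_1)
  \<comment> \<open>Limit and sum over the points are exchanged by dominated convergence for
    counting measure. The majorant is the probability that point \<open>i\<close> lies in the
    window, with sum \<open>lam\<close> times the area of the window.\<close>
  have "(\<lambda>n. \<integral>\<^sup>+i. F n i \<partial>count_space UNIV) \<longlonglongrightarrow> (\<integral>\<^sup>+i. F0 i \<partial>count_space UNIV)"
  proof (rule nn_integral_dominated_convergence)
    show "(\<integral>\<^sup>+i. emeasure M {\<omega> \<in> space M. Y i \<omega> \<in> A} \<partial>count_space UNIV) < \<infinity>"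
      using emeasure_bounded_finite[of A] bounded_ball[of "0 :: real \<times> real" R]
      unfolding nn_integral_count_space_nat mean_count[OF \<open>A \<in> sets borel\<close>]
      by (auto simp: A_def intro!: ennreal_mult_less_top[THEN iffD2])
  qed (use FP Flim in auto)
  then have lim1: "(\<lambda>n. \<Sum>i. F n i) \<longlonglongrightarrow> (\<Sum>i. F0 i)"
    by (simp add: nn_integral_count_space_nat)
  have step: "(\<Sum>i. F n i) = (\<integral>\<^sup>+y. indicator A y * ?e (W n (\<tau> n y)) \<partial>lborel)" for n
  proof -
    define N where "N = \<lceil>real n * (R + norm c + norm c')\<rceil>"
    show ?thesis unfolding F_def
    proof (rule mecke_step[where \<tau>="\<tau> n" and W="W n"])
      show "finite ({0..N} \<times> {0..N})" by simp
      fix y assume y: "y \<in> A"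
      have "dist c y \<le> R + norm c + norm c'" "dist c' y \<le> R + norm c + norm c'"
        using y norm_triangle_ineq4[of c y] norm_triangle_ineq4[of c' y] norm_ge_zero[of c] norm_ge_zero[of c']
        unfolding A_def dist_norm mem_ball by (simp_all only: diff_0 norm_minus_cancel)
      then have "real n * dist c y \<le> real n * (R + norm c + norm c')" "real n * dist c' y \<le> real n * (R + norm c + norm c')"
        by (intro mult_left_mono; simp)+
      then have "real n * dist c y \<le> N" "real n * dist c' y \<le> N" unfolding N_def by linarith+
      then show "\<tau> n y \<in> {0..N} \<times> {0..N}"
        unfolding \<tau>_def by (auto simp: floor_le_iff)
      show "y \<notin> W n (\<tau> n y)" using WU[of n y] by (auto simp: U_def)
    next
      fix j :: "int \<times> int"
      have "{y \<in> A. \<tau> n y = j} = A \<inter> {y \<in> space borel. \<lfloor>real n * dist c y\<rfloor> = fst j \<and> \<lfloor>real n * dist c' y\<rfloor> = snd j}"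
        by (cases j) (auto simp: \<tau>_def)
      also have "\<dots> \<in> sets borel" by measurable
      finally show "{y \<in> A. \<tau> n y = j} \<in> sets borel" .
    qed (auto simp: A_def W_def)
  qed
  have lim2: "(\<lambda>n. \<integral>\<^sup>+y. indicator A y * ?e (W n (\<tau> n y)) \<partial>lborel) \<longlonglongrightarrow>
     (\<integral>\<^sup>+y. indicator A y * ?e (U y) \<partial>lborel)"
  proof (rule nn_integral_dominated_convergence[where w="\<lambda>y. indicator A y * ennreal lam"])
    show "(\<integral>\<^sup>+y. indicator A y * ennreal lam \<partial>lborel) < \<infinity>"
      using emeasure_bounded_finite[of A] by (subst nn_integral_multc) (auto simp: A_def ennreal_mult_less_top intro!: borel_measurable_indicator)
    show "AE y in lborel. indicator A y * ?e (W n (\<tau> n y)) \<le> indicator A y * ennreal lam" for n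
      using lam_pos by (intro AE_I2 mult_left_mono ennreal_leI) auto
    show "AE y in lborel. (\<lambda>n. indicator A y * ?e (W n (\<tau> n y))) \<longlonglongrightarrow> indicator A y * ?e (U y)"
    proof (rule AE_I2)
      fix y
      have "(\<lambda>n. measure lborel (W n (\<tau> n y))) \<longlonglongrightarrow> measure lborel (U y)"
        unfolding W\<tau> U_def by (intro measure_two_balls_tendsto sle slim)
      then show "(\<lambda>n. indicator A y * ?e (W n (\<tau> n y))) \<longlonglongrightarrow> indicator A y * ?e (U y)"
        by (intro tendsto_mult_ennreal tendsto_const tendsto_ennrealI tendsto_intros) (auto simp: indicator_def)
    qed
    have [measurable]: "(\<lambda>y. measure lborel (W n (\<tau> n y))) \<in> borel_measurable borel" for n
      unfolding W\<tau> by (intro borel_measurable_measure_two_balls) measurable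
    have [measurable]: "(\<lambda>y. measure lborel (U y)) \<in> borel_measurable borel"
      unfolding U_def by (intro borel_measurable_measure_two_balls) measurable
    show "(\<lambda>y. indicator A y * ?e (W n (\<tau> n y))) \<in> borel_measurable lborel" for n
      by measurable
    show "(\<lambda>y. indicator A y * ?e (U y)) \<in> borel_measurable lborel"
      by measurable
  qed auto
  have "(\<Sum>i. F0 i) = (\<integral>\<^sup>+y. indicator A y * ?e (U y) \<partial>lborel)"
    using lim1 lim2 unfolding step by (rule LIMSEQ_unique)
  then show ?thesis unfolding F0_def .
qed


text \<open>The inequality is weak, so a tie makes several indices nearest at once; a handover is
  then the failure of uniqueness.\<close>

definition nearest :: "real \<times> real \<Rightarrow> nat \<Rightarrow> 'w \<Rightarrow> bool" where
  "nearest c i \<omega> \<longleftrightarrow> (\<forall>k. dist c (Y i \<omega>) \<le> dist c (Y k \<omega>))"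

lemma pred_nearest [measurable]: "Measurable.pred M (nearest c i)"
  unfolding nearest_def[abs_def] by measurable

text \<open>A point \<open>y\<close> of the process is nearest to both centres exactly when the
  union of the two open discs through \<open>y\<close> is void. Balls of integer radius exhaust the
  plane, and monotone convergence on both sides removes the window. Taking \<open>c = c'\<close>
  gives the expected number of points nearest to \<open>c\<close>.\<close>

lemma sum_prob_nearest_both:
  "(\<Sum>i. emeasure M {\<omega> \<in> space M. nearest c i \<omega> \<and> nearest c' i \<omega>}) =
    (\<integral>\<^sup>+y. ennreal (lam * exp (- (lam * measure lborel (ball c (dist c y) \<union> ball c' (dist c' y))))) \<partial>lborel)"
    (is "_ = (\<integral>\<^sup>+y. ?g y \<partial>lborel)")
proof -
  let ?U = "\<lambda>y. ball c (dist c y) \<union> ball c' (dist c' y)"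
  let ?E = "\<lambda>i. {\<omega> \<in> space M. nearest c i \<omega> \<and> nearest c' i \<omega>}"
  let ?f = "\<lambda>i R \<omega>. (indicator (?E i) \<omega> * indicator (ball 0 (real R)) (Y i \<omega>) :: ennreal)"
  have [measurable]: "(\<lambda>y. measure lborel (?U y)) \<in> borel_measurable borel"
    by (intro borel_measurable_measure_two_balls) measurable
  have [measurable]: "ball (0 :: real \<times> real) (real R) \<in> sets borel" for R by simp
  have E: "\<omega> \<in> Void (?U (Y i \<omega>)) \<longleftrightarrow> \<omega> \<in> ?E i" for i \<omega>
    by (auto simp: Void_def nearest_def not_less)
  have sup: "(SUP R. f * indicator (ball 0 (real R)) y) = f" for f :: ennreal and y :: "real \<times> real"
  proof (rule antisym)
    obtain R where "norm y < real R" using reals_Archimedean2 by blast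
    then have "f = f * indicator (ball 0 (real R)) y" by simp
    then show "f \<le> (SUP R. f * indicator (ball 0 (real R)) y)" by (metis (mono_tags, lifting) SUP_upper UNIV_I)
    show "(SUP R. f * indicator (ball 0 (real R)) y) \<le> f" by (intro SUP_least) (auto split: split_indicator)
  qed
  have mono: "f * indicator (ball 0 (real m)) y \<le> f * indicator (ball 0 (real n)) y" if "m \<le> n" for f :: ennreal and y :: "real \<times> real" and m n
    using that by (intro mult_left_mono) (auto split: split_indicator)
  have win: "(\<Sum>i. \<integral>\<^sup>+\<omega>. ?f i R \<omega> \<partial>M) =
      (\<integral>\<^sup>+y\<in>(ball 0 (real R)). ?g y \<partial>lborel)" for R
  proof -
    have "(indicator (Void (?U (Y i \<omega>))) \<omega> :: ennreal) = indicator (?E i) \<omega>" for i \<omega>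
      using E[of \<omega> i] unfolding indicator_def by simp
    then show ?thesis
      using mecke_window[of "real R" c c'] by (simp add: mult.commute)
  qed
  have "(\<Sum>i. emeasure M (?E i)) = (\<integral>\<^sup>+i. (SUP R. \<integral>\<^sup>+\<omega>. ?f i R \<omega> \<partial>M) \<partial>count_space UNIV)"
    unfolding nn_integral_count_space_nat
  proof (rule suminf_cong)
    fix i
    have "emeasure M (?E i) = (\<integral>\<^sup>+\<omega>. (SUP R. ?f i R \<omega>) \<partial>M)"
      unfolding sup by simp
    also have "\<dots> = (SUP R. \<integral>\<^sup>+\<omega>. ?f i R \<omega> \<partial>M)"
    proof (rule nn_integral_monotone_convergence_SUP)
      show "(\<lambda>\<omega>. ?f i R \<omega>) \<in> borel_measurable M" for R
        by measurable
    qed (auto simp: mono_def le_fun_def mono)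
    finally show "emeasure M (?E i) = (SUP R. \<integral>\<^sup>+\<omega>. ?f i R \<omega> \<partial>M)" .
  qed
  also have "\<dots> = (SUP R. \<integral>\<^sup>+i. \<integral>\<^sup>+\<omega>. ?f i R \<omega> \<partial>M \<partial>count_space UNIV)"
    by (rule nn_integral_monotone_convergence_SUP) (auto simp: mono_def le_fun_def intro!: nn_integral_mono mono)
  also have "\<dots> = (SUP R. \<integral>\<^sup>+y\<in>(ball 0 (real R)). ?g y \<partial>lborel)"
    unfolding nn_integral_count_space_nat win ..
  also have "\<dots> = (\<integral>\<^sup>+y. (SUP R. ?g y * indicator (ball 0 (real R)) y) \<partial>lborel)"
    by (rule nn_integral_monotone_convergence_SUP[symmetric]) (auto simp: mono_def le_fun_def mono)
  also have "\<dots> = (\<integral>\<^sup>+y. ?g y \<partial>lborel)"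
    unfolding sup ..
  finally show ?thesis .
qed

lemma count_eq_emeasure: "count A \<omega> = emeasure (count_space UNIV) {k. Y k \<omega> \<in> A}"
proof -
  have "emeasure (count_space UNIV) {k. Y k \<omega> \<in> A} = (\<integral>\<^sup>+k. indicator {k. Y k \<omega> \<in> A} k \<partial>count_space UNIV)"
    by simp
  also have "\<dots> = (\<integral>\<^sup>+k. indicator A (Y k \<omega>) \<partial>count_space UNIV)"
    by (intro nn_integral_cong) (auto split: split_indicator)
  finally show ?thesis by (simp add: nn_integral_count_space_nat count_def)
qed

text \<open>The count in a ball has finite mean and is thus almost surely finite; the countably many
  integer radii cover all others.\<close>

lemma AE_locally_finite: "AE \<omega> in M. \<forall>R::real. finite {k. norm (Y k \<omega>) \<le> R}"
proof -
  have "AE \<omega> in M. \<forall>n::nat. count (ball 0 (real n)) \<omega> \<noteq> \<infinity>"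
    unfolding AE_all_countable
  proof
    fix n :: nat
    have "(\<integral>\<^sup>+\<omega>. count (ball 0 (real n)) \<omega> \<partial>M) \<noteq> \<infinity>"
      using emeasure_bounded_finite[of "ball 0 (real n) :: (real \<times> real) set"]
      by (simp add: nn_integral_count ennreal_mult_eq_top_iff)
    then show "AE \<omega> in M. count (ball 0 (real n)) \<omega> \<noteq> \<infinity>"
      by (intro nn_integral_noteq_infinite) auto
  qed
  then show ?thesis
  proof eventually_elim
    case (elim \<omega>)
    show ?case
    proof
      fix R :: real
      obtain n where n: "R < real n" using reals_Archimedean2 by blast
      have "finite {k. Y k \<omega> \<in> ball 0 (real n)}"
        using elim[rule_format, of n] unfolding count_eq_emeasure
        by (cases "finite {k. Y k \<omega> \<in> ball 0 (real n)}") auto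
      moreover have "{k. norm (Y k \<omega>) \<le> R} \<subseteq> {k. Y k \<omega> \<in> ball 0 (real n)}" using n by auto
      ultimately show "finite {k. norm (Y k \<omega>) \<le> R}" using finite_subset by blast
    qed
  qed
qed

text \<open>Only indices at least as close to \<open>c\<close> as index 0 can compete, and these lie
  in a bounded region, so a minimum over a finite nonempty set remains.\<close>

lemma nearest_exists:
  assumes "\<forall>R::real. finite {k. norm (Y k \<omega>) \<le> R}"
  shows "\<exists>i. nearest c i \<omega>"
proof -
  let ?S = "{k. dist c (Y k \<omega>) \<le> dist c (Y 0 \<omega>)}"
  have "?S \<subseteq> {k. norm (Y k \<omega>) \<le> norm c + dist c (Y 0 \<omega>)}"
  proof
    fix k assume "k \<in> ?S"
    then show "k \<in> {k. norm (Y k \<omega>) \<le> norm c + dist c (Y 0 \<omega>)}"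
      using norm_triangle_sub[of "Y k \<omega>" c] by (auto simp: dist_norm norm_minus_commute)
  qed
  then have fin: "finite ?S" using assms finite_subset by blast
  moreover have "?S \<noteq> {}" by auto
  ultimately obtain i where i: "i \<in> ?S" "\<And>k. k \<in> ?S \<Longrightarrow> dist c (Y i \<omega>) \<le> dist c (Y k \<omega>)"
    using arg_min_if_finite[of ?S "\<lambda>k. dist c (Y k \<omega>)"] by (metis (no_types, lifting) not_less)
  then have "nearest c i \<omega>" unfolding nearest_def
    by (metis (mono_tags, lifting) linorder_le_cases mem_Collect_eq order_trans)
  then show ?thesis ..
qed

end

section \<open>Radial and Gaussian integrals in the plane\<close>

lemma nn_integral_translate:
  fixes f :: "'a::euclidean_space \<Rightarrow> ennreal"
  assumes [measurable]: "f \<in> borel_measurable borel"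
  shows "(\<integral>\<^sup>+y. f (c + y) \<partial>lborel) = (\<integral>\<^sup>+y. f y \<partial>lborel)"
proof -
  have "(\<integral>\<^sup>+y. f y \<partial>lborel) = (\<integral>\<^sup>+y. f y \<partial>distr lborel borel ((+) c))"
    by (simp only: lborel_distr_plus)
  also have "\<dots> = (\<integral>\<^sup>+y. f (c + y) \<partial>lborel)"
    by (rule nn_integral_distr) auto
  finally show ?thesis by simp
qed

lemma measure_ball_plane: "r \<ge> 0 \<Longrightarrow> measure lborel (ball (c :: real \<times> real) r) = pi * r\<^sup>2"
  by (simp add: content_ball unit_ball_vol_2 power2_eq_square)

text \<open>Substituting \<open>x = sqrt a * r\<close> brings out \<open>m + 1\<close> factors
  \<open>sqrt a\<close>, one from the differential and \<open>m\<close> from the power. For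
  \<open>m > 0\<close> the integrand vanishes at 0, which reconciles the open half-line with the
  closed one in \<open>I\<close>.\<close>

lemma nn_integral_gaussian_moment_scaled:
  assumes I: "has_bochner_integral lborel (\<lambda>x::real. indicator {0..} x *\<^sub>R (exp (- x\<^sup>2) * x ^ m)) I"
    and a: "a > 0" and m: "m > 0"
  shows "(\<integral>\<^sup>+r\<in>{0<..}. ennreal (exp (- (a * r\<^sup>2)) * r ^ m) \<partial>lborel) = ennreal (I / sqrt a ^ Suc m)"
proof -
  let ?s = "sqrt a"
  have s: "?s > 0" "?s\<^sup>2 = a" using a by auto
  have "(\<integral>\<^sup>+x\<in>{0<..}. ennreal (exp (- x\<^sup>2) * x ^ m) \<partial>lborel) =
      (\<integral>\<^sup>+x. ennreal (indicator {0..} x *\<^sub>R (exp (- x\<^sup>2) * x ^ m)) \<partial>lborel)"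
    using m by (intro nn_integral_cong) (auto split: split_indicator)
  also have "\<dots> = ennreal I"
    using I by (subst nn_integral_eq_integral) (auto simp: has_bochner_integral_iff split: split_indicator)
  finally have "ennreal I = (\<integral>\<^sup>+x\<in>{0<..}. ennreal (exp (- x\<^sup>2) * x ^ m) \<partial>lborel)" by simp
  also have "\<dots> = ennreal ?s * (\<integral>\<^sup>+r. ennreal (exp (- (?s * r)\<^sup>2) * (?s * r) ^ m) * indicator {0<..} (?s * r) \<partial>lborel)"
    using s by (subst nn_integral_real_affine[where c="?s" and t=0]) auto
  also have "\<dots> = ennreal ?s * (\<integral>\<^sup>+r. ennreal (?s ^ m) * (ennreal (exp (- (a * r\<^sup>2)) * r ^ m) * indicator {0<..} r) \<partial>lborel)"
  proof (rule arg_cong2[where f="(*)", OF refl], rule nn_integral_cong)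
    fix r :: real
    show "ennreal (exp (- (?s * r)\<^sup>2) * (?s * r) ^ m) * indicator {0<..} (?s * r) =
        ennreal (?s ^ m) * (ennreal (exp (- (a * r\<^sup>2)) * r ^ m) * indicator {0<..} r)"
    proof (cases "r > 0")
      case True
      have "exp (- (?s * r)\<^sup>2) * (?s * r) ^ m = ?s ^ m * (exp (- (a * r\<^sup>2)) * r ^ m)"
        using s(2) by (simp add: power_mult_distrib)
      then have "ennreal (exp (- (?s * r)\<^sup>2) * (?s * r) ^ m) = ennreal (?s ^ m) * ennreal (exp (- (a * r\<^sup>2)) * r ^ m)"
        using True s(1) by (simp add: ennreal_mult)
      then show ?thesis using True s(1) by simp
    next
      case False
      then have "\<not> ?s * r > 0" using s(1) by (simp add: zero_less_mult_iff)
      with False show ?thesis by simp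
    qed
  qed
  also have "\<dots> = ennreal (?s ^ Suc m) * (\<integral>\<^sup>+r\<in>{0<..}. ennreal (exp (- (a * r\<^sup>2)) * r ^ m) \<partial>lborel)"
    using s by (subst nn_integral_cmult) (auto simp: ennreal_mult mult.assoc)
  finally have *: "ennreal I = ennreal (?s ^ Suc m) * (\<integral>\<^sup>+r\<in>{0<..}. ennreal (exp (- (a * r\<^sup>2)) * r ^ m) \<partial>lborel)"
    (is "_ = _ * ?N") .
  have N: "?N = (?N * ennreal (?s ^ Suc m)) / ennreal (?s ^ Suc m)"
    using s by (intro ennreal_mult_divide_eq[symmetric]) (auto simp: ennreal_eq_0_iff not_le)
  have "integral\<^sup>L lborel (\<lambda>x::real. indicator {0..} x *\<^sub>R (exp (- x\<^sup>2) * x ^ m)) \<ge> 0"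
    by (rule integral_nonneg_AE) (auto split: split_indicator)
  then have "I \<ge> 0" using I by (simp add: has_bochner_integral_iff)
  then show ?thesis
    using s by (subst N, subst mult.commute, subst *[symmetric]) (simp add: divide_ennreal del: power_Suc)
qed

lemma norm_polar: "r > 0 \<Longrightarrow> norm (r * cos \<psi>, r * sin \<psi>) = r"
proof -
  assume r: "r > 0"
  have "(r * cos \<psi>)\<^sup>2 + (r * sin \<psi>)\<^sup>2 = r\<^sup>2 * ((cos \<psi>)\<^sup>2 + (sin \<psi>)\<^sup>2)"
    by (simp only: power_mult_distrib distrib_left)
  then show ?thesis using r by (simp add: norm_Pair)
qed

lemma nn_integral_radial:
  fixes g :: "real \<Rightarrow> ennreal"
  assumes [measurable]: "g \<in> borel_measurable borel"
  shows "(\<integral>\<^sup>+y. g (norm y) \<partial>(lborel :: (real \<times> real) measure)) = (\<integral>\<^sup>+r. ennreal (2 * pi * r) * indicator {0<..} r * g r \<partial>lborel)"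
proof -
  have "(\<integral>\<^sup>+y. g (norm y) \<partial>(lborel :: (real \<times> real) measure)) =
    (\<integral>\<^sup>+r. ennreal r * indicator {0<..} r * (\<integral>\<^sup>+\<psi>\<in>{-pi..<pi}. g (norm (r * cos \<psi>, r * sin \<psi>)) \<partial>lborel) \<partial>lborel)"
    by (rule nn_integral_polar) measurable
  also have "\<dots> = (\<integral>\<^sup>+r. ennreal (2 * pi * r) * indicator {0<..} r * g r \<partial>lborel)"
  proof (rule nn_integral_cong)
    fix r :: real
    show "ennreal r * indicator {0<..} r * (\<integral>\<^sup>+\<psi>\<in>{-pi..<pi}. g (norm (r * cos \<psi>, r * sin \<psi>)) \<partial>lborel) =
        ennreal (2 * pi * r) * indicator {0<..} r * g r"
    proof (cases "r > 0")
      case True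
      then show ?thesis
        by (simp add: norm_polar nn_integral_cmult ennreal_mult' mult_ac)
    qed auto
  qed
  finally show ?thesis .
qed

text \<open>In polar coordinates the integrand becomes \<open>2 pi lam r exp (- lam pi r^2)\<close>,
  the density of the distance from a fixed centre to the nearest point of the process.\<close>

lemma nn_integral_gaussian_plane:
  assumes lam_pos: "lam > 0"
  shows "(\<integral>\<^sup>+y. ennreal (lam * exp (- (lam * (pi * (norm y)\<^sup>2)))) \<partial>(lborel :: (real \<times> real) measure)) = 1"
proof -
  have "(\<integral>\<^sup>+y. ennreal (lam * exp (- (lam * (pi * (norm y)\<^sup>2)))) \<partial>(lborel :: (real \<times> real) measure)) = (\<integral>\<^sup>+r. ennreal (2 * pi * r) * indicator {0<..} r * ennreal (lam * exp (- (lam * (pi * r\<^sup>2)))) \<partial>lborel)"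
    by (rule nn_integral_radial) measurable
  also have "\<dots> = (\<integral>\<^sup>+r. ennreal (2 * pi * lam) * (ennreal (exp (- ((lam * pi) * r\<^sup>2)) * r ^ 1) * indicator {0<..} r) \<partial>lborel)"
    using lam_pos by (intro nn_integral_cong) (auto simp: ennreal_mult[symmetric] mult_ac split: split_indicator)
  also have "\<dots> = ennreal (2 * pi * lam) * (\<integral>\<^sup>+r\<in>{0<..}. ennreal (exp (- ((lam * pi) * r\<^sup>2)) * r ^ 1) \<partial>lborel)"
    by (rule nn_integral_cmult) measurable
  also have "(\<integral>\<^sup>+r\<in>{0<..}. ennreal (exp (- ((lam * pi) * r\<^sup>2)) * r ^ 1) \<partial>lborel) = ennreal ((1 / 2) / sqrt (lam * pi) ^ Suc 1)"
    using gaussian_moment_odd_pos[of 0] lam_pos by (intro nn_integral_gaussian_moment_scaled) auto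
  also have "ennreal (2 * pi * lam) * \<dots> = 1"
    using lam_pos by (simp add: ennreal_mult[symmetric] field_simps flip: power2_eq_square)
  finally show ?thesis .
qed

context planar_poisson
begin

text \<open>The expected number of nearest points is 1, and almost surely there is at least one.\<close>

lemma AE_nearest_unique: "AE \<omega> in M. \<exists>!i. nearest c i \<omega>"
proof -
  define f where "f \<omega> = (\<Sum>i. of_bool (nearest c i \<omega>) :: ennreal)" for \<omega>
  have [measurable]: "f \<in> borel_measurable M" unfolding f_def[abs_def] by measurable
  have "(\<integral>\<^sup>+\<omega>. f \<omega> \<partial>M) = (\<Sum>i. \<integral>\<^sup>+\<omega>. of_bool (nearest c i \<omega>) \<partial>M)"
    unfolding f_def by (rule nn_integral_suminf) measurable
  also have "\<dots> = (\<Sum>i. emeasure M {\<omega> \<in> space M. nearest c i \<omega> \<and> nearest c i \<omega>})"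
    by (simp add: nn_integral_of_bool)
  also have "\<dots> = (\<integral>\<^sup>+y. ennreal (lam * exp (- (lam * (pi * (dist c y)\<^sup>2)))) \<partial>lborel)"
    unfolding sum_prob_nearest_both by (simp add: measure_ball_plane)
  also have "\<dots> = (\<integral>\<^sup>+y. ennreal (lam * exp (- (lam * (pi * (dist c (c + y))\<^sup>2)))) \<partial>lborel)"
    by (rule nn_integral_translate[symmetric]) measurable
  also have "\<dots> = 1" using nn_integral_gaussian_plane[OF lam_pos] by (simp add: dist_norm)
  finally have int: "(\<integral>\<^sup>+\<omega>. f \<omega> \<partial>M) = 1" .
  have ge: "AE \<omega> in M. 1 \<le> f \<omega>"
    using AE_locally_finite
  proof eventually_elim
    case (elim \<omega>)
    obtain i where i: "nearest c i \<omega>" using nearest_exists[OF elim] by blast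
    have "(\<Sum>j\<in>{i}. of_bool (nearest c j \<omega>)) \<le> f \<omega>" unfolding f_def by (rule sum_le_suminf) auto
    then show ?case using i by simp
  qed
  \<comment> \<open>Subtraction on \<open>ennreal\<close> is truncated, so
    \<open>f \<omega> - 1 = 0\<close> means \<open>f \<omega> \<le> 1\<close>; a second nearest
    index would force \<open>f \<omega> \<ge> 2\<close>.\<close>
  have "(\<integral>\<^sup>+\<omega>. f \<omega> - 1 \<partial>M) = (\<integral>\<^sup>+\<omega>. f \<omega> \<partial>M) - (\<integral>\<^sup>+\<omega>. 1 \<partial>M)"
    using ge by (intro nn_integral_diff) (auto simp: emeasure_space_1)
  also have "\<dots> = 0" using int by (simp add: emeasure_space_1)
  finally have "AE \<omega> in M. f \<omega> - 1 = 0" by (subst (asm) nn_integral_0_iff_AE) auto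
  with AE_locally_finite show ?thesis
  proof eventually_elim
    case (elim \<omega>)
    obtain i where i: "nearest c i \<omega>" using nearest_exists[OF elim(1)] by blast
    have "j = i" if "nearest c j \<omega>" for j
    proof (rule ccontr)
      assume "j \<noteq> i"
      have "(\<Sum>j\<in>{i, j}. of_bool (nearest c j \<omega>)) \<le> f \<omega>" unfolding f_def by (rule sum_le_suminf) auto
      then have "2 \<le> f \<omega>" using i that \<open>j \<noteq> i\<close> by simp
      moreover have "f \<omega> \<le> 1" using elim(2) by (simp add: diff_eq_0_iff_ennreal split: if_splits)
      ultimately have "(2::ennreal) \<le> 1" by (rule order_trans)
      then show False by simp
    qed
    with i show ?case by blast
  qed
qed

end

section \<open>Kinks of a lower envelope of lines\<close>

locale lower_envelope =
  fixes a b :: "nat \<Rightarrow> real" and S :: "nat set"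
  assumes finite_S: "finite S"
begin

definition serves :: "nat \<Rightarrow> real \<Rightarrow> bool" where
  "serves i t \<longleftrightarrow> (\<forall>k. a i + b i * t \<le> a k + b k * t)"

definition kinks :: "real set" where
  "kinks = {t \<in> {0..1}. \<exists>i j. i \<noteq> j \<and> serves i t \<and> serves j t}"

text \<open>Phrased without naming the lowest line at either end, so that it makes sense before
  uniqueness is known. For the process it is the complement of the event that some point is nearest
  at both times, which the Mecke formula evaluates.\<close>

definition changes :: "nat \<Rightarrow> nat set" where
  "changes n = {k. k < n \<and> \<not> (\<exists>i. serves i (real k / real n) \<and> serves i (real (Suc k) / real n))}"

lemma closed_serves: "closed {t. serves i t}"
proof -
  have "{t. serves i t} = (\<Inter>k. {t. a i + b i * t \<le> a k + b k * t})" by (auto simp: serves_def)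
  also have "closed \<dots>" by (intro closed_INT ballI closed_Collect_le continuous_intros)
  finally show ?thesis .
qed

text \<open>An affine function that is positive at both ends of an interval is positive inside. It
  is applied to line \<open>j\<close> minus line \<open>i\<close>, which is strictly positive at the
  ends because \<open>i\<close> is the only lowest line there.\<close>

lemma no_kink_between:
  assumes i: "serves i d" "serves i d'" and u: "\<exists>!j. serves j d" "\<exists>!j. serves j d'"
    and t: "d \<le> t" "t \<le> d'" and j: "serves j t"
  shows "j = i"
proof (rule ccontr)
  assume ne: "j \<noteq> i"
  have pos: "a j + b j * s > a i + b i * s" if "serves i s" "\<exists>!j. serves j s" for s
  proof (rule ccontr)
    assume "\<not> a j + b j * s > a i + b i * s"
    then have "serves j s" using that(1) unfolding serves_def not_less by (meson order_trans)
    with that ne show False by blast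
  qed
  have p: "(a j - a i) + (b j - b i) * d > 0" "(a j - a i) + (b j - b i) * d' > 0"
    using pos[OF i(1) u(1)] pos[OF i(2) u(2)] by (auto simp: algebra_simps)
  have "(a j - a i) + (b j - b i) * t > 0"
  proof (cases "b j - b i \<ge> 0")
    case True
    then have "(b j - b i) * d \<le> (b j - b i) * t" using t by (intro mult_left_mono)
    with p show ?thesis by simp
  next
    case False
    then have "(b j - b i) * d' \<le> (b j - b i) * t" using t by (intro mult_left_mono_neg) auto
    with p show ?thesis by simp
  qed
  moreover have "a j + b j * t \<le> a i + b i * t" using j unfolding serves_def by blast
  ultimately show False by (simp add: algebra_simps)
qed

end

text \<open>There are infinitely many lines, but at each time in \<open>[0, 1]\<close> a lowest one
  is found in the finite set \<open>S\<close>. Uniqueness is asked at rational times only: a kink is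
  precisely a time at which it fails.\<close>

locale generic_lower_envelope = lower_envelope +
  assumes serves_exists: "\<And>t. t \<in> {0..1} \<Longrightarrow> \<exists>i\<in>S. serves i t"
    and serves_unique: "\<And>m n. m \<le> n \<Longrightarrow> n > 0 \<Longrightarrow> \<exists>!i. serves i (real m / real n)"
begin

text \<open>Connectedness of \<open>[d, d']\<close>: the times at which \<open>i\<close> is lowest
  and those at which some other index of \<open>S\<close> is lowest are closed, the latter as a
  finite union, they cover the interval, and both meet it. Hence they share a time, which is no
  endpoint by uniqueness.\<close>

lemma kink_between:
  assumes d: "0 \<le> d" "d < d'" "d' \<le> 1" and u: "\<exists>!j. serves j d" "\<exists>!j. serves j d'"
    and no: "\<not> (\<exists>i. serves i d \<and> serves i d')"
  shows "\<exists>t\<in>kinks. d < t \<and> t < d'"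
proof -
  obtain i where i: "serves i d" using u by blast
  let ?A = "{t. serves i t}" and ?B = "\<Union>j\<in>S - {i}. {t. serves j t}"
  have "connected {d..d'}" by simp
  moreover have "closed ?A" "closed ?B"
    using finite_S by (auto intro!: closed_UN closed_serves)
  moreover have "{d..d'} \<subseteq> ?A \<union> ?B"
  proof
    fix t assume "t \<in> {d..d'}"
    then obtain j where "j \<in> S" "serves j t" using serves_exists[of t] d by auto
    then show "t \<in> ?A \<union> ?B" by (cases "j = i") auto
  qed
  moreover have "?A \<inter> {d..d'} \<noteq> {}" using i d by auto
  moreover have "?B \<inter> {d..d'} \<noteq> {}"
  proof -
    obtain j where "j \<in> S" "serves j d'" using serves_exists[of d'] d by auto
    moreover have "j \<noteq> i" using no i \<open>serves j d'\<close> by blast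
    ultimately show ?thesis using d by auto
  qed
  ultimately have "?A \<inter> ?B \<inter> {d..d'} \<noteq> {}"
    unfolding connected_closed by blast
  then obtain t j where t: "t \<in> {d..d'}" "serves i t" "serves j t" "j \<noteq> i" by blast
  moreover have "t \<noteq> d" "t \<noteq> d'" using t u by auto
  ultimately show ?thesis using d unfolding kinks_def
    by (intro bexI[of _ t]) auto
qed

text \<open>Every changing cell has a kink strictly inside, and the cell number is the floor of
  \<open>n\<close> times that kink, so the chosen kinks are distinct.\<close>

lemma card_changes_le: "of_nat (card (changes n)) \<le> emeasure (count_space UNIV) kinks"
proof -
  have "\<exists>t\<in>kinks. real k / real n < t \<and> t < real (Suc k) / real n" if "k \<in> changes n" for k
    using that unfolding changes_def
    by (intro kink_between serves_unique) (auto simp: divide_strict_right_mono)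
  then obtain f where f: "\<And>k. k \<in> changes n \<Longrightarrow> f k \<in> kinks \<and> real k / real n < f k \<and> f k < real (Suc k) / real n"
    by metis
  have n: "n > 0" if "k \<in> changes n" for k using that by (auto simp: changes_def)
  have fl: "k = nat \<lfloor>real n * f k\<rfloor>" if "k \<in> changes n" for k
  proof -
    have "real k \<le> real n * f k" "real n * f k < real k + 1"
      using f[OF that] n[OF that] by (auto simp: field_simps)
    then show ?thesis by linarith
  qed
  have "inj_on f (changes n)" by (rule inj_onI) (metis fl)
  moreover have "finite (changes n)" unfolding changes_def by simp
  ultimately have "of_nat (card (changes n)) = emeasure (count_space UNIV) (f ` changes n)"
    by (simp add: card_image)
  also have "\<dots> \<le> emeasure (count_space UNIV) kinks"
    using f by (intro emeasure_mono) auto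
  finally show ?thesis .
qed

text \<open>Once \<open>1 / n\<close> is below every gap in \<open>F\<close>, distinct elements of
  \<open>F\<close> fall into distinct cells. Such a cell must be a change: a line lowest at both of
  its ends would by \<open>no_kink_between\<close> be the only lowest one at the kink.\<close>

lemma card_le_changes:
  assumes F: "finite F" "F \<subseteq> kinks"
  shows "\<forall>\<^sub>F n in sequentially. card F \<le> card (changes n)"
proof -
  have "\<forall>\<^sub>F n in sequentially. \<forall>s\<in>F. \<forall>t\<in>F. s \<noteq> t \<longrightarrow> 1 / real n < \<bar>s - t\<bar>"
  proof (intro eventually_ball_finite F ballI)
    fix s t :: real
    show "\<forall>\<^sub>F n in sequentially. s \<noteq> t \<longrightarrow> 1 / real n < \<bar>s - t\<bar>"
      using order_tendstoD(2)[OF lim_const_over_n[of "1::real"], of "\<bar>s - t\<bar>"] by (cases "s = t") auto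
  qed
  moreover have "\<forall>\<^sub>F n in sequentially. n > (0::nat)" by (rule eventually_gt_at_top)
  ultimately show ?thesis
  proof eventually_elim
    case (elim n)
    define k where "k t = nat \<lfloor>real n * t\<rfloor>" for t
    have k: "real (k t) \<le> real n * t" "real n * t < real (k t) + 1" if "t \<in> F" for t
    proof -
      have "real n * t \<ge> 0" using that F(2) by (auto simp: kinks_def)
      then show "real (k t) \<le> real n * t" "real n * t < real (k t) + 1" unfolding k_def by linarith+
    qed
    have "k t \<in> changes n" if t: "t \<in> F" for t
    proof -
      have tk: "t \<in> {0..1}" "\<not> (\<exists>!i. serves i t)" using t F(2) by (auto simp: kinks_def)
      \<comment> \<open>A kink at 1 would have cell number \<open>n\<close>, outside the range of
        \<open>changes n\<close>; uniqueness at the rational time 1 rules it out.\<close>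
      then have "t \<noteq> 1" using serves_unique[of 1 1] by auto
      then have "real n * t < real n" using tk elim by auto
      then have kn: "k t < n" using k(1)[OF t] by linarith
      have "\<not> (\<exists>i. serves i (real (k t) / real n) \<and> serves i (real (Suc (k t)) / real n))"
      proof
        assume "\<exists>i. serves i (real (k t) / real n) \<and> serves i (real (Suc (k t)) / real n)"
        then obtain i where i: "serves i (real (k t) / real n)" "serves i (real (Suc (k t)) / real n)" by blast
        have "real (k t) / real n \<le> t" "t \<le> real (Suc (k t)) / real n"
          using k[OF t] elim(2) by (auto simp: field_simps)
        then have "j = i" if "serves j t" for j
          using i that kn by (intro no_kink_between[OF i] serves_unique) auto
        with tk t F(2) show False by (auto simp: kinks_def)
      qed
      with kn show ?thesis by (simp add: changes_def)
    qed
    moreover have "inj_on k F"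
    proof (rule inj_onI, rule ccontr)
      fix s t assume st: "s \<in> F" "t \<in> F" "k s = k t" "s \<noteq> t"
      then have "\<bar>real n * s - real n * t\<bar> < 1" using k[OF st(1)] k[OF st(2)] by linarith
      then have "real n * \<bar>s - t\<bar> < 1" by (simp add: abs_mult flip: right_diff_distrib)
      moreover have "1 / real n < \<bar>s - t\<bar>" using elim(1) st by blast
      ultimately show False using elim(2) by (simp add: field_simps)
    qed
    moreover have "finite (changes n)" by (simp add: changes_def)
    ultimately show ?case by (intro card_inj_on_le) auto
  qed
qed

text \<open>Finite sets of kinks are eventually resolved by the grid. If there are infinitely many
  kinks, finite subsets of every size push the limit inferior up to \<open>\<top>\<close>.\<close>

lemma kinks_le_liminf: "emeasure (count_space UNIV) kinks \<le> liminf (\<lambda>n. of_nat (card (changes n)))"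
proof -
  have *: "of_nat (card F) \<le> liminf (\<lambda>n. of_nat (card (changes n)) :: ennreal)" if "finite F" "F \<subseteq> kinks" for F
    using card_le_changes[OF that] by (intro Liminf_bounded) (auto elim!: eventually_mono)
  show ?thesis
  proof (cases "finite kinks")
    case True
    then show ?thesis using *[of kinks] by simp
  next
    case False
    have "of_nat m \<le> liminf (\<lambda>n. of_nat (card (changes n)) :: ennreal)" for m
      using infinite_arbitrarily_large[OF False, of m] * by blast
    then have "liminf (\<lambda>n. of_nat (card (changes n)) :: ennreal) = \<top>"
      by (metis ennreal_SUP_of_nat_eq_top SUP_least top_unique)
    then show ?thesis by simp
  qed
qed

end

section \<open>Changes of the nearest point along a line\<close>

text \<open>The function \<open>Q\<close>, taken as its Mecke integral so that its behaviour for
  small \<open>h\<close> can be studied without a probability space.\<close>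

definition both_nearest_prob :: "real \<Rightarrow> real \<Rightarrow> ennreal" where
  "both_nearest_prob lam h = (\<integral>\<^sup>+y. ennreal (lam * exp (- (lam * measure lborel
     (ball 0 (norm y) \<union> ball (- h, 0 :: real) (dist (- h, 0) y))))) \<partial>(lborel :: (real \<times> real) measure))"

lemma dist_sq_shift: "(dist (- s, 0) (y :: real \<times> real))\<^sup>2 = s\<^sup>2 + (norm y)\<^sup>2 + 2 * s * fst y"
proof (cases y)
  case (Pair p q)
  then have "(dist (- s, 0) y)\<^sup>2 = (- s - p)\<^sup>2 + q\<^sup>2"
    by (simp add: dist_norm norm_Pair)
  then show ?thesis using Pair by (simp add: norm_Pair power2_eq_square algebra_simps)
qed

context planar_poisson
begin

text \<open>Almost surely one index alone is nearest to \<open>(c, 0)\<close>, so the events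
  \<open>?E i\<close> are disjoint up to a null set and the probability of their union is the sum
  given by the Mecke formula. Translating the plane by \<open>(c, 0)\<close> removes the dependence
  on \<open>c\<close>.\<close>

lemma prob_nearest_change:
  "emeasure M {\<omega> \<in> space M. \<not> (\<exists>i. nearest (c, 0) i \<omega> \<and> nearest (c - h, 0) i \<omega>)} = 1 - both_nearest_prob lam h"
proof -
  let ?e = "\<lambda>B. ennreal (lam * exp (- (lam * measure lborel B)))"
  let ?c = "(c, 0) :: real \<times> real" and ?c' = "(c - h, 0) :: real \<times> real"
  let ?E = "\<lambda>i. {\<omega> \<in> space M. nearest ?c i \<omega> \<and> nearest ?c' i \<omega>}"
  have Em: "?E i \<in> sets M" for i by measurable
  have "(\<Sum>i. emeasure M (?E i)) = (\<integral>\<^sup>+\<omega>. (\<Sum>i. indicator (?E i) \<omega>) \<partial>M)"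
    using Em by (subst nn_integral_suminf) auto
  also have "\<dots> = (\<integral>\<^sup>+\<omega>. indicator (\<Union>i. ?E i) \<omega> \<partial>M)"
  proof (rule nn_integral_cong_AE)
    show "AE \<omega> in M. (\<Sum>i. indicator (?E i) \<omega>) = (indicator (\<Union>i. ?E i) \<omega> :: ennreal)"
      using AE_nearest_unique[of ?c]
    proof eventually_elim
      case (elim \<omega>)
      then obtain j where j: "\<And>i. nearest ?c i \<omega> \<Longrightarrow> i = j" by blast
      then have nE: "\<omega> \<notin> ?E i" if "i \<noteq> j" for i using that by blast
      have iff: "\<omega> \<in> (\<Union>i. ?E i) \<longleftrightarrow> \<omega> \<in> ?E j"
      proof
        assume "\<omega> \<in> (\<Union>i. ?E i)"
        then obtain i where "\<omega> \<in> ?E i" by (rule UN_E)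
        with nE[of i] show "\<omega> \<in> ?E j" by (cases "i = j") simp_all
      qed (rule UN_I[OF UNIV_I])
      have "(\<Sum>i. indicator (?E i) \<omega> :: ennreal) = (\<Sum>i\<in>{j}. indicator (?E i) \<omega>)"
        by (intro suminf_finite finite.intros indicator_simps(2) nE) simp
      also have "\<dots> = indicator (\<Union>i. ?E i) \<omega>"
        unfolding indicator_def iff by simp
      finally show ?case .
    qed
  qed
  also have "\<dots> = emeasure M (\<Union>i. ?E i)" using Em by (intro nn_integral_indicator) auto
  finally have "emeasure M (\<Union>i. ?E i) =
      (\<integral>\<^sup>+y. ?e (ball ?c (dist ?c y) \<union> ball ?c' (dist ?c' y)) \<partial>lborel)"
    unfolding sum_prob_nearest_both by (rule sym)
  also have "\<dots> = (\<integral>\<^sup>+y. ?e (ball ?c (dist ?c (?c + y)) \<union> ball ?c' (dist ?c' (?c + y))) \<partial>lborel)"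
  proof (rule nn_integral_translate[symmetric])
    have [measurable]: "(\<lambda>y. measure lborel (ball ?c (dist ?c y) \<union> ball ?c' (dist ?c' y))) \<in> borel_measurable borel"
      by (intro borel_measurable_measure_two_balls) measurable
    show "(\<lambda>y. ?e (ball ?c (dist ?c y) \<union> ball ?c' (dist ?c' y))) \<in> borel_measurable borel"
      by measurable
  qed
  also have "\<dots> = both_nearest_prob lam h"
    unfolding both_nearest_prob_def
  proof (intro nn_integral_cong)
    fix y :: "real \<times> real"
    have "dist ?c (?c + y) = norm y" "dist ?c' (?c + y) = dist (- h, 0) y"
      using dist_add_cancel[of ?c 0 y] dist_add_cancel[of ?c "(- h, 0)" y] by simp_all
    moreover have "ball ?c (norm y) \<union> ball ?c' (dist (- h, 0) y) = (+) ?c ` (ball 0 (norm y) \<union> ball (- h, 0 :: real) (dist (- h, 0) y))"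
      unfolding image_Un using ball_translation[of ?c 0 "norm y"] ball_translation[of ?c "(- h, 0)" "dist (- h, 0) y"] by simp
    moreover have "measure lborel ((+) ?c ` A) = measure lborel A" if "open A" for A
      using measure_translation[of ?c A] open_translation[OF that, of ?c] that by (simp add: measure_completion)
    ultimately show "?e (ball ?c (dist ?c (?c + y)) \<union> ball ?c' (dist ?c' (?c + y))) =
        ?e (ball 0 (norm y) \<union> ball (- h, 0 :: real) (dist (- h, 0) y))"
      by (simp add: open_Un)
  qed
  finally have U: "emeasure M (\<Union>i. ?E i) = both_nearest_prob lam h" .
  have "{\<omega> \<in> space M. \<not> (\<exists>i. nearest ?c i \<omega> \<and> nearest ?c' i \<omega>)} = space M - (\<Union>i. ?E i)" by auto
  then have "emeasure M {\<omega> \<in> space M. \<not> (\<exists>i. nearest ?c i \<omega> \<and> nearest ?c' i \<omega>)} = emeasure M (space M) - emeasure M (\<Union>i. ?E i)"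
    using Em by (simp only:) (intro emeasure_compl, auto)
  then show ?thesis unfolding U by (simp add: emeasure_space_1)
qed

definition crossings :: "real \<Rightarrow> 'w \<Rightarrow> real set" where
  "crossings v \<omega> = {t \<in> {0..1}. \<exists>i j. i \<noteq> j \<and> nearest (- (v * t), 0) i \<omega> \<and> nearest (- (v * t), 0) j \<omega>}"

definition changes_count :: "real \<Rightarrow> nat \<Rightarrow> 'w \<Rightarrow> ennreal" where
  "changes_count v n \<omega> = (\<Sum>k<n. of_bool (\<not> (\<exists>i. nearest (- (v * (real k / real n)), 0) i \<omega> \<and>
     nearest (- (v * (real (Suc k) / real n)), 0) i \<omega>)))"

lemma borel_measurable_changes_count [measurable]: "changes_count v n \<in> borel_measurable M"
  unfolding changes_count_def[abs_def] by measurable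

lemma nn_integral_changes_count:
  assumes "n > 0"
  shows "(\<integral>\<^sup>+\<omega>. changes_count v n \<omega> \<partial>M) = of_nat n * (1 - both_nearest_prob lam (v / real n))"
proof -
  have "(\<integral>\<^sup>+\<omega>. changes_count v n \<omega> \<partial>M) = (\<Sum>k<n. \<integral>\<^sup>+\<omega>. of_bool (\<not> (\<exists>i. nearest (- (v * (real k / real n)), 0) i \<omega> \<and>
     nearest (- (v * (real (Suc k) / real n)), 0) i \<omega>)) \<partial>M)"
    unfolding changes_count_def by (rule nn_integral_sum) measurable
  also have "\<dots> = (\<Sum>k<n. 1 - both_nearest_prob lam (v / real n))"
  proof (rule sum.cong[OF refl])
    fix k
    let ?c = "- (v * (real k / real n))"
    have c: "- (v * (real (Suc k) / real n)) = ?c - v / real n" by (simp add: add_divide_distrib algebra_simps)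
    have "(\<integral>\<^sup>+\<omega>. of_bool (\<not> (\<exists>i. nearest (?c, 0) i \<omega> \<and> nearest (?c - v / real n, 0) i \<omega>)) \<partial>M) =
       emeasure M {\<omega> \<in> space M. \<not> (\<exists>i. nearest (?c, 0) i \<omega> \<and> nearest (?c - v / real n, 0) i \<omega>)}"
      by (rule nn_integral_of_bool) measurable
    also have "\<dots> = 1 - both_nearest_prob lam (v / real n)" by (rule prob_nearest_change)
    finally show "(\<integral>\<^sup>+\<omega>. of_bool (\<not> (\<exists>i. nearest (?c, 0) i \<omega> \<and> nearest (- (v * (real (Suc k) / real n)), 0) i \<omega>)) \<partial>M)
       = 1 - both_nearest_prob lam (v / real n)" unfolding c .
  qed
  finally show ?thesis by simp
qed

lemma AE_crossings:
  assumes v: "v > 0"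
  shows "AE \<omega> in M. (\<forall>n. changes_count v n \<omega> \<le> emeasure (count_space UNIV) (crossings v \<omega>)) \<and>
     emeasure (count_space UNIV) (crossings v \<omega>) \<le> liminf (\<lambda>n. changes_count v n \<omega>)"
proof -
  have "AE \<omega> in M. \<forall>m n. \<exists>!i. nearest (- (v * (real m / real n)), 0) i \<omega>"
    unfolding AE_all_countable by (intro allI AE_nearest_unique)
  with AE_locally_finite show ?thesis
  proof eventually_elim
    case (elim \<omega>)
    define a where "a k = (norm (Y k \<omega>))\<^sup>2" for k
    define b where "b k = 2 * v * fst (Y k \<omega>)" for k
    \<comment> \<open>For \<open>t\<close> in \<open>[0, 1]\<close> the centre is within
      \<open>v\<close> of the origin, and a nearest point is no farther from the centre than
      \<open>Y 0 \<omega>\<close>; two triangle inequalities give the radius.\<close>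
    define S where "S = {k. norm (Y k \<omega>) \<le> norm (Y 0 \<omega>) + 2 * v}"
    interpret L: lower_envelope a b S using elim(1) by unfold_locales (simp add: S_def)
    have eq: "L.serves i t \<longleftrightarrow> nearest (- (v * t), 0) i \<omega>" for i t
    proof -
      have "dist (- (v * t), 0) (Y i \<omega>) \<le> dist (- (v * t), 0) (Y k \<omega>) \<longleftrightarrow> a i + b i * t \<le> a k + b k * t" for k
        unfolding a_def b_def
        by (subst power_mono_iff[symmetric, of _ _ 2]) (simp_all add: dist_sq_shift mult_ac)
      then show ?thesis unfolding L.serves_def nearest_def by simp
    qed
    interpret L: generic_lower_envelope a b S
    proof
      fix t :: real assume t: "t \<in> {0..1}"
      obtain i where i: "nearest (- (v * t), 0) i \<omega>" using nearest_exists[OF elim(1)] by blast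
      let ?c = "(- (v * t), 0) :: real \<times> real"
      have "norm ?c \<le> v" using t v by (simp add: norm_Pair mult_left_le)
      moreover have "norm (Y i \<omega>) \<le> norm ?c + dist ?c (Y i \<omega>)"
        using norm_triangle_sub[of "Y i \<omega>" ?c] by (simp add: dist_norm norm_minus_commute)
      moreover have "dist ?c (Y i \<omega>) \<le> dist ?c (Y 0 \<omega>)" using i unfolding nearest_def by blast
      moreover have "dist ?c (Y 0 \<omega>) \<le> norm ?c + norm (Y 0 \<omega>)"
        unfolding dist_norm by (rule norm_triangle_ineq4)
      ultimately have "i \<in> S" unfolding S_def by simp
      with i show "\<exists>i\<in>S. L.serves i t" unfolding eq by blast
    next
      fix m n :: nat
      show "\<exists>!i. L.serves i (real m / real n)" unfolding eq using elim(2) by blast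
    qed
    have k: "L.kinks = crossings v \<omega>" unfolding L.kinks_def crossings_def eq ..
    have c: "of_nat (card (L.changes n)) = changes_count v n \<omega>" for n
    proof -
      have "changes_count v n \<omega> = (\<Sum>k<n. of_bool (k \<in> L.changes n))"
        unfolding changes_count_def L.changes_def eq by (intro sum.cong) auto
      also have "\<dots> = of_nat (card ({..<n} \<inter> L.changes n))"
        by (simp add: sum.If_cases of_bool_def Collect_mem_eq)
      also have "{..<n} \<inter> L.changes n = L.changes n" unfolding L.changes_def by auto
      finally show ?thesis by simp
    qed
    show ?case using L.card_changes_le L.kinks_le_liminf unfolding k c by blast
  qed
qed

text \<open>Fatou's lemma gives the upper bound and the pointwise bound on
  \<open>changes_count\<close> the lower one. The number of crossings enters only through
  monotonicity of the integral, so its measurability never comes up.\<close>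

lemma nn_integral_crossings:
  assumes v: "v > 0" and lim: "(\<lambda>n. of_nat n * (1 - both_nearest_prob lam (v / real n))) \<longlonglongrightarrow> L"
  shows "(\<integral>\<^sup>+\<omega>. emeasure (count_space UNIV) (crossings v \<omega>) \<partial>M) = L"
proof -
  let ?N = "\<lambda>\<omega>. emeasure (count_space UNIV) (crossings v \<omega>)"
  have lim': "(\<lambda>n. \<integral>\<^sup>+\<omega>. changes_count v n \<omega> \<partial>M) \<longlonglongrightarrow> L"
  proof (rule Lim_transform_eventually[OF lim])
    show "\<forall>\<^sub>F n in sequentially. of_nat n * (1 - both_nearest_prob lam (v / real n)) = (\<integral>\<^sup>+\<omega>. changes_count v n \<omega> \<partial>M)"
      using eventually_gt_at_top[of 0] by eventually_elim (simp add: nn_integral_changes_count)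
  qed
  show ?thesis
  proof (rule antisym)
    have "(\<integral>\<^sup>+\<omega>. ?N \<omega> \<partial>M) \<le> (\<integral>\<^sup>+\<omega>. liminf (\<lambda>n. changes_count v n \<omega>) \<partial>M)"
      using AE_crossings[OF v] by (intro nn_integral_mono_AE) auto
    also have "\<dots> \<le> liminf (\<lambda>n. \<integral>\<^sup>+\<omega>. changes_count v n \<omega> \<partial>M)"
      by (rule nn_integral_liminf) measurable
    also have "\<dots> = L" using lim' by (intro lim_imp_Liminf) auto
    finally show "(\<integral>\<^sup>+\<omega>. ?N \<omega> \<partial>M) \<le> L" .
    have "(\<integral>\<^sup>+\<omega>. changes_count v n \<omega> \<partial>M) \<le> (\<integral>\<^sup>+\<omega>. ?N \<omega> \<partial>M)" for n
      using AE_crossings[OF v] by (intro nn_integral_mono_AE) auto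
    with lim' show "L \<le> (\<integral>\<^sup>+\<omega>. ?N \<omega> \<partial>M)" by (intro LIMSEQ_le_const2) auto
  qed
qed

end

section \<open>Area of the crescent between two discs\<close>

lemma nn_integral_even_interval:
  fixes f :: "real \<Rightarrow> ennreal"
  assumes [measurable]: "f \<in> borel_measurable borel" and even: "\<And>x. f (- x) = f x"
  shows "(\<integral>\<^sup>+x\<in>{-pi..<pi}. f x \<partial>lborel) = 2 * (\<integral>\<^sup>+x\<in>{0..pi}. f x \<partial>lborel)"
proof -
  have "(\<integral>\<^sup>+x\<in>{-pi..<pi}. f x \<partial>lborel) = (\<integral>\<^sup>+x. f x * indicator {0..pi} x + f x * indicator {-pi..0} x \<partial>lborel)"
    by (intro nn_integral_cong_AE AE_I[of _ _ "{0, pi}"]) (auto simp: indicator_def emeasure_lborel_countable)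
  also have "\<dots> = (\<integral>\<^sup>+x\<in>{0..pi}. f x \<partial>lborel) + (\<integral>\<^sup>+x\<in>{-pi..0}. f x \<partial>lborel)"
    by (intro nn_integral_add) measurable
  also have "(\<integral>\<^sup>+x\<in>{-pi..0}. f x \<partial>lborel) = (\<integral>\<^sup>+x\<in>{0..pi}. f x \<partial>lborel)"
    by (subst nn_integral_real_affine[where c="-1" and t=0]) (auto simp: even indicator_def intro!: nn_integral_cong)
  finally show ?thesis by (simp add: mult_2)
qed

text \<open>\<open>ennreal\<close> sends negative reals to 0, so the integrand is the positive part
  of \<open>cos \<phi> - cos \<psi>\<close>. As \<open>cos\<close> decreases on
  \<open>[0, pi]\<close>, it is supported on \<open>[\<phi>, pi]\<close>.\<close>

lemma nn_integral_cos_diff: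
  assumes \<phi>: "0 \<le> \<phi>" "\<phi> \<le> pi"
  shows "(\<integral>\<^sup>+\<psi>\<in>{0..pi}. ennreal (cos \<phi> - cos \<psi>) \<partial>lborel) = ennreal ((pi - \<phi>) * cos \<phi> + sin \<phi>)"
proof -
  have cs: "cos \<psi> \<le> cos \<phi> \<longleftrightarrow> \<phi> \<le> \<psi>" if "0 \<le> \<psi>" "\<psi> \<le> pi" for \<psi>
    using that \<phi> by (simp add: cos_mono_le_eq)
  have "(\<integral>\<^sup>+\<psi>\<in>{0..pi}. ennreal (cos \<phi> - cos \<psi>) \<partial>lborel) = (\<integral>\<^sup>+\<psi>\<in>{\<phi>..pi}. ennreal (cos \<phi> - cos \<psi>) \<partial>lborel)"
  proof (rule nn_integral_cong)
    fix \<psi> :: real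
    show "ennreal (cos \<phi> - cos \<psi>) * indicator {0..pi} \<psi> = ennreal (cos \<phi> - cos \<psi>) * indicator {\<phi>..pi} \<psi>"
    proof (cases "0 \<le> \<psi> \<and> \<psi> \<le> pi \<and> \<psi> < \<phi>")
      case True
      then have "cos \<phi> - cos \<psi> \<le> 0" using cs[of \<psi>] by auto
      then have "ennreal (cos \<phi> - cos \<psi>) = 0" by (rule ennreal_neg)
      then show ?thesis by simp
    qed (use \<phi> in \<open>auto simp: indicator_def\<close>)
  qed
  also have "\<dots> = ennreal ((pi * cos \<phi> - sin pi) - (\<phi> * cos \<phi> - sin \<phi>))"
    by (rule nn_integral_FTC_Icc) (use \<phi> cs in \<open>auto intro!: derivative_eq_intros\<close>)
  finally show ?thesis by (simp add: algebra_simps)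
qed

text \<open>Needed to integrate this value once more by the fundamental theorem for nonnegative
  integrands. It is the increase of \<open>x * cos \<phi> - sin x\<close> from \<open>\<phi>\<close>
  to \<open>pi\<close>, where the derivative \<open>cos \<phi> - cos x\<close> is
  nonnegative.\<close>

lemma cos_diff_integral_nonneg:
  assumes \<phi>: "0 \<le> \<phi>" "\<phi> \<le> pi"
  shows "0 \<le> (pi - \<phi>) * cos \<phi> + sin \<phi>"
proof -
  have "\<phi> * cos \<phi> - sin \<phi> \<le> pi * cos \<phi> - sin pi"
  proof (rule DERIV_nonneg_imp_nondecreasing[OF \<phi>(2)])
    fix x assume "\<phi> \<le> x" "x \<le> pi"
    then show "\<exists>y. ((\<lambda>x. x * cos \<phi> - sin x) has_real_derivative y) (at x) \<and> 0 \<le> y"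
      using \<phi> by (intro exI[of _ "cos \<phi> - cos x"]) (auto intro!: derivative_eq_intros simp: cos_mono_le_eq)
  qed
  then show ?thesis by (simp add: algebra_simps)
qed

text \<open>Evenness in each angle contributes a factor 2. The remaining integral has the
  antiderivative \<open>(pi - \<phi>) sin \<phi> - 2 cos \<phi>\<close>, which increases by 4 over
  \<open>[0, pi]\<close>.\<close>

lemma nn_integral_cos_diff_double:
  "(\<integral>\<^sup>+\<phi>\<in>{-pi..<pi}. (\<integral>\<^sup>+\<psi>\<in>{-pi..<pi}. ennreal (cos \<phi> - cos \<psi>) \<partial>lborel) \<partial>lborel) = 16"
proof -
  have "(\<integral>\<^sup>+\<phi>\<in>{-pi..<pi}. (\<integral>\<^sup>+\<psi>\<in>{-pi..<pi}. ennreal (cos \<phi> - cos \<psi>) \<partial>lborel) \<partial>lborel) =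
      2 * (\<integral>\<^sup>+\<phi>\<in>{0..pi}. (\<integral>\<^sup>+\<psi>\<in>{-pi..<pi}. ennreal (cos \<phi> - cos \<psi>) \<partial>lborel) \<partial>lborel)"
    by (rule nn_integral_even_interval) auto
  also have "(\<integral>\<^sup>+\<phi>\<in>{0..pi}. (\<integral>\<^sup>+\<psi>\<in>{-pi..<pi}. ennreal (cos \<phi> - cos \<psi>) \<partial>lborel) \<partial>lborel) =
     (\<integral>\<^sup>+\<phi>. 2 * (ennreal ((pi - \<phi>) * cos \<phi> + sin \<phi>) * indicator {0..pi} \<phi>) \<partial>lborel)"
  proof (rule nn_integral_cong)
    fix \<phi> :: real
    have "(\<integral>\<^sup>+\<psi>\<in>{-pi..<pi}. ennreal (cos \<phi> - cos \<psi>) \<partial>lborel) = 2 * (\<integral>\<^sup>+\<psi>\<in>{0..pi}. ennreal (cos \<phi> - cos \<psi>) \<partial>lborel)"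
      by (rule nn_integral_even_interval) auto
    then show "(\<integral>\<^sup>+\<psi>\<in>{-pi..<pi}. ennreal (cos \<phi> - cos \<psi>) \<partial>lborel) * indicator {0..pi} \<phi> =
        2 * (ennreal ((pi - \<phi>) * cos \<phi> + sin \<phi>) * indicator {0..pi} \<phi>)"
      using nn_integral_cos_diff[of \<phi>] by (cases "\<phi> \<in> {0..pi}") simp_all
  qed
  also have "\<dots> = 2 * (\<integral>\<^sup>+\<phi>\<in>{0..pi}. ennreal ((pi - \<phi>) * cos \<phi> + sin \<phi>) \<partial>lborel)"
    by (rule nn_integral_cmult) measurable
  also have "(\<integral>\<^sup>+\<phi>\<in>{0..pi}. ennreal ((pi - \<phi>) * cos \<phi> + sin \<phi>) \<partial>lborel) =
      ennreal (((pi - pi) * sin pi - 2 * cos pi) - ((pi - 0) * sin 0 - 2 * cos 0))"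
    by (rule nn_integral_FTC_Icc) (use cos_diff_integral_nonneg in \<open>auto intro!: derivative_eq_intros simp: algebra_simps\<close>)
  also have "2 * (2 * \<dots>) = 16" by simp
  finally show ?thesis .
qed

text \<open>Completing the square leaves two roots in \<open>r\<close>. Since \<open>q > 0\<close>,
  the square root exceeds \<open>\<bar>h * c\<bar>\<close>, so one root is negative and only the
  other bounds a positive \<open>r\<close>.\<close>

lemma radial_crescent_iff:
  fixes r h c q :: real
  assumes "r > 0" "h > 0" "q > 0"
  shows "r\<^sup>2 + 2 * h * r * c < q \<longleftrightarrow> r < - (h * c) + sqrt (h\<^sup>2 * c\<^sup>2 + q)"
proof -
  let ?D = "h\<^sup>2 * c\<^sup>2 + q"
  have D: "\<bar>h * c\<bar> < sqrt ?D"
    using assms by (intro real_less_rsqrt) (simp add: power_mult_distrib)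
  have "r\<^sup>2 + 2 * h * r * c < q \<longleftrightarrow> (r + h * c)\<^sup>2 < ?D"
    by (simp add: power2_eq_square algebra_simps)
  also have "\<dots> \<longleftrightarrow> \<bar>r + h * c\<bar> < sqrt ?D"
    by (metis real_sqrt_abs real_sqrt_less_iff)
  also have "\<dots> \<longleftrightarrow> r < - (h * c) + sqrt ?D" using D assms(1) by linarith
  finally show ?thesis .
qed

lemma radial_crescent_root:
  fixes h c q :: real
  assumes "q > 0"
  defines "R \<equiv> - (h * c) + sqrt (h\<^sup>2 * c\<^sup>2 + q)"
  shows "R > 0" "R\<^sup>2 + 2 * h * R * c = q"
proof -
  have "\<bar>h * c\<bar> < sqrt (h\<^sup>2 * c\<^sup>2 + q)"
    using assms by (intro real_less_rsqrt) (simp add: power_mult_distrib)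
  then show "R > 0" unfolding R_def by linarith
  have "(sqrt (h\<^sup>2 * c\<^sup>2 + q))\<^sup>2 = h\<^sup>2 * c\<^sup>2 + q" using assms by (intro real_sqrt_pow2) auto
  moreover have "R\<^sup>2 + 2 * h * R * c = (R + h * c)\<^sup>2 - h\<^sup>2 * c\<^sup>2" by (simp add: power2_eq_square algebra_simps)
  ultimately show "R\<^sup>2 + 2 * h * R * c = q" unfolding R_def by simp
qed

text \<open>Hypothesis \<open>q\<close> says that the origin lies in the second disc, so the ray in
  direction \<open>\<psi>\<close> leaves that disc exactly once, at radius \<open>R \<psi>\<close>.
  Integrating \<open>r\<close> from \<open>norm y\<close> to \<open>R \<psi>\<close> gives half a
  difference of squares, and the quadratic equation of \<open>R \<psi>\<close> rewrites it as
  \<open>h * (fst y - cos \<psi> * R \<psi>)\<close>. The factor \<open>h\<close> thus comes out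
  exactly, and the first-order term is just the limit of the remaining integral.\<close>

lemma emeasure_crescent:
  fixes y :: "real \<times> real"
  assumes y: "y \<noteq> 0" and h: "h > 0" and q: "(norm y)\<^sup>2 + 2 * h * fst y > 0"
  defines "R \<equiv> \<lambda>\<psi>. - (h * cos \<psi>) + sqrt (h\<^sup>2 * (cos \<psi>)\<^sup>2 + ((norm y)\<^sup>2 + 2 * h * fst y))"
  shows "emeasure lborel (ball (- h, 0 :: real) (dist (- h, 0) y) - ball 0 (norm y)) =
    ennreal h * (\<integral>\<^sup>+\<psi>\<in>{-pi..<pi}. ennreal (fst y - cos \<psi> * R \<psi>) \<partial>lborel)"
proof -
  let ?S = "ball (- h, 0 :: real) (dist (- h, 0) y) - ball 0 (norm y)"
  define \<rho> where "\<rho> = norm y"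
  let ?F = "\<lambda>r \<psi>. (ennreal r * of_bool (\<rho> \<le> r \<and> r < R \<psi>) :: ennreal)"
  have \<rho>: "\<rho> > 0" using y by (simp add: \<rho>_def)
  have [measurable]: "R \<in> borel_measurable borel" unfolding R_def by measurable
  have mem: "(r * cos \<psi>, r * sin \<psi>) \<in> ?S \<longleftrightarrow> \<rho> \<le> r \<and> r < R \<psi>" if r: "r > 0" for r \<psi>
  proof -
    note nz = norm_polar[OF r, of \<psi>]
    have "dist (- h, 0) (r * cos \<psi>, r * sin \<psi>) < dist (- h, 0) y \<longleftrightarrow>
        (dist (- h, 0) (r * cos \<psi>, r * sin \<psi>))\<^sup>2 < (dist (- h, 0) y)\<^sup>2"
      by (meson power_strict_mono power_less_imp_less_base zero_le_dist pos2)
    also have "\<dots> \<longleftrightarrow> r\<^sup>2 + 2 * h * r * cos \<psi> < (norm y)\<^sup>2 + 2 * h * fst y"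
      unfolding dist_sq_shift nz by (simp add: mult.assoc)
    also have "\<dots> \<longleftrightarrow> r < R \<psi>" unfolding R_def by (rule radial_crescent_iff[OF r h q])
    finally show ?thesis unfolding Diff_iff mem_ball dist_0_norm nz \<rho>_def by auto
  qed
  have inner: "(\<integral>\<^sup>+r\<in>{\<rho>..<R \<psi>}. ennreal r \<partial>lborel) = ennreal (h * (fst y - cos \<psi> * R \<psi>))" for \<psi>
  proof -
    have R: "R \<psi> > 0" "(R \<psi>)\<^sup>2 + 2 * h * R \<psi> * cos \<psi> = \<rho>\<^sup>2 + 2 * h * fst y"
      unfolding R_def \<rho>_def by (rule radial_crescent_root[OF q])+
    then have eq: "h * (fst y - cos \<psi> * R \<psi>) = (R \<psi>)\<^sup>2 / 2 - \<rho>\<^sup>2 / 2" by (simp add: algebra_simps)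
    show ?thesis
    proof (cases "\<rho> \<le> R \<psi>")
      case True
      have "(\<integral>\<^sup>+r\<in>{\<rho>..<R \<psi>}. ennreal r \<partial>lborel) = (\<integral>\<^sup>+r\<in>{\<rho>..R \<psi>}. ennreal r \<partial>lborel)"
        by (intro nn_integral_cong_AE AE_I[of _ _ "{R \<psi>}"]) (auto simp: indicator_def)
      also have "\<dots> = ennreal ((R \<psi>)\<^sup>2 / 2 - \<rho>\<^sup>2 / 2)"
        by (rule nn_integral_FTC_Icc) (use True \<rho> in \<open>auto intro!: derivative_eq_intros\<close>)
      finally show ?thesis unfolding eq .
    next
      \<comment> \<open>Here the ray leaves the second disc before the first: the interval is empty,
        and the right side is a negative real sent to 0.\<close>
      case False
      then have "(R \<psi>)\<^sup>2 \<le> \<rho>\<^sup>2" using R(1) by (intro power_mono) auto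
      then have "ennreal ((R \<psi>)\<^sup>2 / 2 - \<rho>\<^sup>2 / 2) = 0" by (intro ennreal_neg) simp
      then show ?thesis using False unfolding eq by simp
    qed
  qed
  have "emeasure lborel ?S = (\<integral>\<^sup>+z. indicator ?S z \<partial>lborel)" by simp
  also have "\<dots> = (\<integral>\<^sup>+r. ennreal r * indicator {0<..} r * (\<integral>\<^sup>+\<psi>\<in>{-pi..<pi}. indicator ?S (r * cos \<psi>, r * sin \<psi>) \<partial>lborel) \<partial>lborel)"
    by (rule nn_integral_polar) (auto intro!: borel_measurable_indicator)
  also have "\<dots> = (\<integral>\<^sup>+r. (\<integral>\<^sup>+\<psi>\<in>{-pi..<pi}. ?F r \<psi> \<partial>lborel) \<partial>lborel)"
  proof (rule nn_integral_cong)
    fix r :: real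
    show "ennreal r * indicator {0<..} r * (\<integral>\<^sup>+\<psi>\<in>{-pi..<pi}. indicator ?S (r * cos \<psi>, r * sin \<psi>) \<partial>lborel) =
      (\<integral>\<^sup>+\<psi>\<in>{-pi..<pi}. ?F r \<psi> \<partial>lborel)"
    proof (cases "r > 0")
      case True
      have ind: "indicator ?S (r * cos \<psi>, r * sin \<psi>) = (of_bool (\<rho> \<le> r \<and> r < R \<psi>) :: ennreal)" for \<psi>
        using mem[OF True, of \<psi>] unfolding indicator_def by (rule arg_cong)
      have "(\<integral>\<^sup>+\<psi>\<in>{-pi..<pi}. ?F r \<psi> \<partial>lborel) =
        ennreal r * (\<integral>\<^sup>+\<psi>\<in>{-pi..<pi}. of_bool (\<rho> \<le> r \<and> r < R \<psi>) \<partial>lborel)"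
        by (subst nn_integral_cmult[symmetric]) (auto simp: mult.assoc)
      then show ?thesis using True ind by simp
    next
      case False
      then have "ennreal r = 0" by (intro ennreal_neg) simp
      then show ?thesis by simp
    qed
  qed
  also have "\<dots> = (\<integral>\<^sup>+\<psi>. (\<integral>\<^sup>+r. ?F r \<psi> * indicator {-pi..<pi} \<psi> \<partial>lborel) \<partial>lborel)"
    by (rule lborel_pair.Fubini'[symmetric]) measurable
  also have "\<dots> = (\<integral>\<^sup>+\<psi>. ennreal h * (ennreal (fst y - cos \<psi> * R \<psi>) * indicator {-pi..<pi} \<psi>) \<partial>lborel)"
  proof (rule nn_integral_cong)
    fix \<psi> :: real
    have "(\<integral>\<^sup>+r. ?F r \<psi> * indicator {-pi..<pi} \<psi> \<partial>lborel) =
        (\<integral>\<^sup>+r. (ennreal r * indicator {\<rho>..<R \<psi>} r) * indicator {-pi..<pi} \<psi> \<partial>lborel)"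
      by (intro nn_integral_cong) (simp add: indicator_def)
    also have "\<dots> = (\<integral>\<^sup>+r\<in>{\<rho>..<R \<psi>}. ennreal r \<partial>lborel) * indicator {-pi..<pi} \<psi>"
      by (rule nn_integral_multc) measurable
    also have "\<dots> = ennreal h * (ennreal (fst y - cos \<psi> * R \<psi>) * indicator {-pi..<pi} \<psi>)"
      unfolding inner using h by (simp add: ennreal_mult' mult.assoc)
    finally show "(\<integral>\<^sup>+r. ?F r \<psi> * indicator {-pi..<pi} \<psi> \<partial>lborel) =
        ennreal h * (ennreal (fst y - cos \<psi> * R \<psi>) * indicator {-pi..<pi} \<psi>)" .
  qed
  also have "\<dots> = ennreal h * (\<integral>\<^sup>+\<psi>\<in>{-pi..<pi}. ennreal (fst y - cos \<psi> * R \<psi>) \<partial>lborel)"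
    by (rule nn_integral_cmult) measurable
  finally show ?thesis .
qed

section \<open>Crescents in the limit of a small shift\<close>

definition crescent :: "real \<Rightarrow> real \<times> real \<Rightarrow> (real \<times> real) set" where
  "crescent h y = ball (- h, 0 :: real) (dist (- h, 0) y) - ball 0 (norm y)"

text \<open>The exact crescent area divided by \<open>h\<close>, with \<open>R \<psi>\<close>
  replaced by its value \<open>norm y\<close> at \<open>h = 0\<close>. For \<open>y\<close> with
  polar coordinates \<open>(r, \<phi>)\<close> it is \<open>r\<close> times the integral of the
  positive part of \<open>cos \<phi> - cos \<psi>\<close>.\<close>

definition crescent_rate :: "real \<times> real \<Rightarrow> ennreal" where
  "crescent_rate y = (\<integral>\<^sup>+\<psi>\<in>{-pi..<pi}. ennreal (fst y - cos \<psi> * norm y) \<partial>lborel)"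

lemma borel_measurable_fst_real [measurable]: "(fst :: real \<times> real \<Rightarrow> real) \<in> borel_measurable borel"
  by (intro borel_measurable_continuous_onI continuous_intros)

lemma borel_measurable_crescent_rate [measurable]: "crescent_rate \<in> borel_measurable borel"
  unfolding crescent_rate_def[abs_def] by measurable

lemma abs_fst_le_norm: "\<bar>fst (y :: real \<times> real)\<bar> \<le> norm y"
  using norm_fst_le[of "fst y" "snd y"] by simp

lemma crescent_rate_finite: "crescent_rate y < \<infinity>"
proof -
  have "crescent_rate y \<le> (\<integral>\<^sup>+\<psi>\<in>{-pi..<pi}. ennreal (2 * norm y) \<partial>lborel)"
    unfolding crescent_rate_def
  proof (intro nn_integral_mono mult_right_mono ennreal_leI)
    fix \<psi> :: real
    have "\<bar>cos \<psi> * norm y\<bar> \<le> 1 * norm y" unfolding abs_mult by (intro mult_mono) auto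
    then show "fst y - cos \<psi> * norm y \<le> 2 * norm y" using abs_fst_le_norm[of y] by linarith
  qed auto
  also have "\<dots> < \<infinity>" by (simp add: nn_integral_cmult ennreal_mult_less_top)
  finally show ?thesis .
qed

lemma fmeasurable_crescent: "crescent h y \<in> fmeasurable lborel"
  unfolding crescent_def by (intro bounded_borel_fmeasurable) (auto intro: bounded_diff)

lemma measure_union_crescent:
  "measure lborel (ball 0 (norm y) \<union> ball (- h, 0 :: real) (dist (- h, 0) y)) = pi * (norm y)\<^sup>2 + measure lborel (crescent h y)"
  unfolding crescent_def
  by (subst measure_Un2) (auto simp: measure_ball_plane intro!: bounded_borel_fmeasurable)

text \<open>The second disc is contained in the disc of radius \<open>norm y + 2 * h\<close> about
  the origin, so an annulus contains the crescent. The bound is linear in \<open>h\<close> up to a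
  quadratic term and serves as majorant in the limit of the change rate.\<close>

lemma measure_crescent_le:
  assumes h: "h \<ge> 0"
  shows "measure lborel (crescent h y) \<le> 4 * pi * h * (norm y + h)"
proof -
  let ?r = "norm y"
  have "crescent h y \<subseteq> ball 0 (?r + 2 * h) - ball 0 ?r"
  proof
    fix z assume z: "z \<in> crescent h y"
    have c: "norm (- h, 0 :: real) = h" using h by (simp add: norm_Pair)
    have "norm z \<le> norm (- h, 0 :: real) + dist (- h, 0) z"
      using norm_triangle_sub[of z "(- h, 0)"] by (simp add: dist_norm norm_minus_commute)
    moreover have "dist (- h, 0) y \<le> norm (- h, 0 :: real) + norm y"
      unfolding dist_norm by (rule norm_triangle_ineq4)
    moreover have "dist (- h, 0) z < dist (- h, 0) y" "\<not> norm z < norm y" using z by (auto simp: crescent_def)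
    ultimately show "z \<in> ball 0 (?r + 2 * h) - ball 0 ?r" unfolding c by auto
  qed
  then have "measure lborel (crescent h y) \<le> measure lborel (ball 0 (?r + 2 * h) - ball (0 :: real \<times> real) ?r)"
    using fmeasurable_crescent[of h y]
    by (intro measure_mono_fmeasurable) (auto intro!: bounded_borel_fmeasurable bounded_diff)
  also have "\<dots> = measure lborel (ball (0 :: real \<times> real) (?r + 2 * h)) - measure lborel (ball (0 :: real \<times> real) ?r)"
    using h by (intro measurable_measure_Diff) (auto intro!: bounded_borel_fmeasurable)
  also have "\<dots> = 4 * pi * h * (?r + h)"
    using h by (simp add: measure_ball_plane power2_eq_square algebra_simps)
  finally show ?thesis .
qed

text \<open>For \<open>y \<noteq> 0\<close> the hypothesis of the exact area formula holds as soon
  as \<open>v / n\<close> is small. Under the integral \<open>R n \<psi>\<close> tends to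
  \<open>norm y\<close> and stays bounded uniformly in \<open>n\<close> and
  \<open>\<psi>\<close>.\<close>

lemma crescent_tendsto:
  assumes y: "y \<noteq> 0" and v: "v > 0"
  shows "(\<lambda>n. real n * measure lborel (crescent (v / real n) y)) \<longlonglongrightarrow> v * enn2real (crescent_rate y)"
proof -
  define R where "R n \<psi> = - (v / real n * cos \<psi>) + sqrt ((v / real n)\<^sup>2 * (cos \<psi>)\<^sup>2 + ((norm y)\<^sup>2 + 2 * (v / real n) * fst y))" for n :: nat and \<psi>
  define I where "I n = (\<integral>\<^sup>+\<psi>\<in>{-pi..<pi}. ennreal (fst y - cos \<psi> * R n \<psi>) \<partial>lborel)" for n
  have vn: "(\<lambda>n. v / real n) \<longlonglongrightarrow> 0" by (rule lim_const_over_n)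
  \<comment> \<open>Division by zero yields 0, so the bounds include \<open>n = 0\<close>.\<close>
  have h: "0 \<le> v / real n" "v / real n \<le> v" for n
    using v by (cases "n = 0"; simp add: divide_le_eq mult_left_le_one_le)+
  have [measurable]: "R n \<in> borel_measurable borel" for n unfolding R_def[abs_def] by measurable
  \<comment> \<open>For small \<open>n\<close> the radicand may be negative. The real
    \<open>sqrt\<close> is odd, so \<open>\<bar>sqrt d\<bar> = sqrt \<bar>d\<bar>\<close> and the
    bound holds for every \<open>n\<close>.\<close>
  have Rb: "\<bar>R n \<psi>\<bar> \<le> norm y + 2 * v" for n \<psi>
  proof -
    let ?h = "v / real n" and ?c = "cos \<psi>"
    let ?D = "?h\<^sup>2 * ?c\<^sup>2 + ((norm y)\<^sup>2 + 2 * ?h * fst y)"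
    have c2: "?h\<^sup>2 * ?c\<^sup>2 \<le> ?h\<^sup>2 * 1" by (intro mult_left_mono) (auto simp: abs_square_le_1)
    have f: "\<bar>2 * ?h * fst y\<bar> \<le> 2 * ?h * norm y"
      unfolding abs_mult using h(1)[of n] abs_fst_le_norm[of y] by (intro mult_mono) auto
    have "\<bar>?D\<bar> \<le> (?h + norm y)\<^sup>2"
      using c2 f zero_le_power2[of "?h * ?c"] zero_le_power2[of "norm y"] unfolding power2_sum power_mult_distrib by linarith
    then have "sqrt \<bar>?D\<bar> \<le> ?h + norm y" using h(1)[of n] by (intro real_le_lsqrt) auto
    moreover have sqrt_abs: "\<bar>sqrt d\<bar> = sqrt \<bar>d\<bar>" for d :: real by (cases "d < 0") (simp_all add: real_sqrt_minus)
    moreover have "\<bar>?h * ?c\<bar> \<le> ?h * 1" unfolding abs_mult using h(1)[of n] by (intro mult_mono) auto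
    ultimately show ?thesis unfolding R_def using h(2)[of n] sqrt_abs[of ?D] by linarith
  qed
  have "I \<longlonglongrightarrow> crescent_rate y"
    unfolding I_def crescent_rate_def
  proof (rule nn_integral_dominated_convergence[where w="\<lambda>\<psi>. ennreal (2 * norm y + 2 * v) * indicator {-pi..<pi} \<psi>"])
    show "(\<integral>\<^sup>+\<psi>\<in>{-pi..<pi}. ennreal (2 * norm y + 2 * v) \<partial>lborel) < \<infinity>"
      by (simp add: nn_integral_cmult ennreal_mult_less_top)
    show "AE \<psi> in lborel. ennreal (fst y - cos \<psi> * R n \<psi>) * indicator {-pi..<pi} \<psi> \<le> ennreal (2 * norm y + 2 * v) * indicator {-pi..<pi} \<psi>" for n
    proof (intro AE_I2 mult_right_mono ennreal_leI)
      fix \<psi> :: real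
      have "\<bar>cos \<psi> * R n \<psi>\<bar> \<le> 1 * (norm y + 2 * v)" unfolding abs_mult using Rb by (intro mult_mono) auto
      then have "- (cos \<psi> * R n \<psi>) \<le> norm y + 2 * v" by (simp add: abs_le_iff)
      moreover have "fst y \<le> norm y" using abs_fst_le_norm[of y] by (simp add: abs_le_iff)
      ultimately show "fst y - cos \<psi> * R n \<psi> \<le> 2 * norm y + 2 * v" by simp
    qed auto
    show "AE \<psi> in lborel. (\<lambda>n. ennreal (fst y - cos \<psi> * R n \<psi>) * indicator {-pi..<pi} \<psi>) \<longlonglongrightarrow> ennreal (fst y - cos \<psi> * norm y) * indicator {-pi..<pi} \<psi>"
    proof (intro AE_I2)
      fix \<psi> :: real
      have "(\<lambda>n. R n \<psi>) \<longlonglongrightarrow> - (0 * cos \<psi>) + sqrt (0\<^sup>2 * (cos \<psi>)\<^sup>2 + ((norm y)\<^sup>2 + 2 * 0 * fst y))"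
        unfolding R_def by (intro tendsto_intros vn)
      then have "(\<lambda>n. R n \<psi>) \<longlonglongrightarrow> norm y" by simp
      then have "(\<lambda>n. ennreal (fst y - cos \<psi> * R n \<psi>)) \<longlonglongrightarrow> ennreal (fst y - cos \<psi> * norm y)"
        by (intro tendsto_ennrealI tendsto_intros)
      then show "(\<lambda>n. ennreal (fst y - cos \<psi> * R n \<psi>) * indicator {-pi..<pi} \<psi>) \<longlonglongrightarrow> ennreal (fst y - cos \<psi> * norm y) * indicator {-pi..<pi} \<psi>"
        by (cases "\<psi> \<in> {-pi..<pi}") auto
    qed
  qed auto
  then have "(\<lambda>n. ennreal v * I n) \<longlonglongrightarrow> ennreal v * crescent_rate y"
    using v by (intro tendsto_mult_ennreal) auto
  also have "ennreal v * crescent_rate y = ennreal (v * enn2real (crescent_rate y))"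
    using v crescent_rate_finite[of y] by (simp add: ennreal_mult)
  finally have "(\<lambda>n. ennreal (real n * measure lborel (crescent (v / real n) y))) \<longlonglongrightarrow> ennreal (v * enn2real (crescent_rate y))"
  proof (rule Lim_transform_eventually)
    have "(\<lambda>n. (norm y)\<^sup>2 + 2 * (v / real n) * fst y) \<longlonglongrightarrow> (norm y)\<^sup>2 + 2 * 0 * fst y"
      by (intro tendsto_intros vn)
    then have "\<forall>\<^sub>F n in sequentially. (norm y)\<^sup>2 + 2 * (v / real n) * fst y > 0"
      by (rule order_tendstoD(1)) (use y in simp)
    moreover have "\<forall>\<^sub>F n in sequentially. n > (0::nat)" by (rule eventually_gt_at_top)
    ultimately show "\<forall>\<^sub>F n in sequentially. ennreal v * I n = ennreal (real n * measure lborel (crescent (v / real n) y))"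
    proof eventually_elim
      case (elim n)
      have "emeasure lborel (crescent (v / real n) y) = ennreal (v / real n) * I n"
        unfolding crescent_def I_def R_def using elim v y by (intro emeasure_crescent) auto
      moreover have "emeasure lborel (crescent (v / real n) y) = ennreal (measure lborel (crescent (v / real n) y))"
        using fmeasurable_crescent[of "v / real n" y] by (intro emeasure_eq_ennreal_measure) (auto simp: fmeasurable_def)
      ultimately have "ennreal (real n * measure lborel (crescent (v / real n) y)) = ennreal (real n) * (ennreal (v / real n) * I n)"
        by (simp add: ennreal_mult)
      also have "\<dots> = ennreal v * I n"
        using elim v by (simp add: mult.assoc[symmetric] ennreal_mult[symmetric])
      finally show ?case by simp
    qed
  qed
  then show ?thesis using v by (subst (asm) tendsto_ennreal_iff) (auto intro!: mult_nonneg_nonneg)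
qed

text \<open>The sandwich \<open>x / (1 + x) \<le> 1 - exp (- x) \<le> x\<close> is multiplied by
  \<open>n\<close>; convergence of \<open>n * x n\<close> forces \<open>x n\<close> to 0, so both
  bounds have the limit \<open>L\<close>.\<close>

lemma one_minus_exp_tendsto:
  fixes x :: "nat \<Rightarrow> real"
  assumes x: "\<And>n. x n \<ge> 0" and lim: "(\<lambda>n. real n * x n) \<longlonglongrightarrow> L"
  shows "(\<lambda>n. real n * (1 - exp (- x n))) \<longlonglongrightarrow> L"
proof (rule tendsto_sandwich)
  have "(\<lambda>n. (real n * x n) * (1 / real n)) \<longlonglongrightarrow> L * 0"
    by (intro tendsto_mult lim lim_const_over_n)
  then have "(\<lambda>n. (real n * x n) * (1 / real n)) \<longlonglongrightarrow> 0" by simp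
  then have x0: "x \<longlonglongrightarrow> 0"
  proof (rule Lim_transform_eventually)
    show "\<forall>\<^sub>F n in sequentially. (real n * x n) * (1 / real n) = x n"
      using eventually_gt_at_top[of 0] by eventually_elim simp
  qed
  have "(\<lambda>n. real n * x n / (1 + x n)) \<longlonglongrightarrow> L / (1 + 0)"
    by (intro tendsto_intros lim x0) auto
  then show "(\<lambda>n. real n * x n / (1 + x n)) \<longlonglongrightarrow> L" by simp
  show "\<forall>\<^sub>F n in sequentially. real n * x n / (1 + x n) \<le> real n * (1 - exp (- x n))"
  proof (intro always_eventually allI)
    fix n
    have "inverse (exp (x n)) \<le> inverse (1 + x n)" using x[of n] by (intro le_imp_inverse_le exp_ge_add_one_self) auto
    then have "x n / (1 + x n) \<le> 1 - exp (- x n)" using x[of n] by (simp add: exp_minus field_simps)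
    then have "real n * (x n / (1 + x n)) \<le> real n * (1 - exp (- x n))" by (intro mult_left_mono) auto
    then show "real n * x n / (1 + x n) \<le> real n * (1 - exp (- x n))" by simp
  qed
  show "\<forall>\<^sub>F n in sequentially. real n * (1 - exp (- x n)) \<le> real n * x n"
  proof (intro always_eventually allI mult_left_mono)
    fix n show "1 - exp (- x n) \<le> x n" using exp_ge_add_one_self[of "- x n"] by linarith
  qed auto
qed (use lim in auto)

text \<open>The angular integral of the rate is \<open>16 r\<close>, leaving
  \<open>16 lam^2 v\<close> times the integral of \<open>r^2 exp (- lam pi r^2)\<close>. The latter
  equals \<open>sqrt pi / 4\<close> divided by \<open>(lam pi)^(3/2)\<close>, that is
  \<open>1 / (4 pi lam^(3/2))\<close>.\<close>

lemma nn_integral_crescent_rate: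
  assumes lam: "lam > 0" and v: "v > 0"
  shows "(\<integral>\<^sup>+y. ennreal (lam * exp (- (lam * (pi * (norm y)\<^sup>2))) * (lam * v)) * crescent_rate y \<partial>lborel) = ennreal (4 * v * sqrt lam / pi)"
proof -
  define T where "T \<phi> = (\<integral>\<^sup>+\<psi>\<in>{-pi..<pi}. ennreal (cos \<phi> - cos \<psi>) \<partial>lborel)" for \<phi>
  have [measurable]: "T \<in> borel_measurable borel" unfolding T_def[abs_def] by measurable
  let ?g = "\<lambda>r. lam * exp (- (lam * (pi * r\<^sup>2))) * (lam * v)"
  let ?K = "\<lambda>r. \<integral>\<^sup>+\<phi>\<in>{-pi..<pi}. ennreal (?g (norm (r * cos \<phi>, r * sin \<phi>))) * crescent_rate (r * cos \<phi>, r * sin \<phi>) \<partial>lborel"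
  have rate: "crescent_rate (r * cos \<phi>, r * sin \<phi>) = ennreal r * T \<phi>" if "r > 0" for r \<phi>
  proof -
    have "crescent_rate (r * cos \<phi>, r * sin \<phi>) = (\<integral>\<^sup>+\<psi>. ennreal r * (ennreal (cos \<phi> - cos \<psi>) * indicator {-pi..<pi} \<psi>) \<partial>lborel)"
      unfolding crescent_rate_def norm_polar[OF that] using that
      by (intro nn_integral_cong) (simp add: ennreal_mult'[symmetric] mult.assoc[symmetric] right_diff_distrib mult.commute)
    also have "\<dots> = ennreal r * T \<phi>" unfolding T_def by (rule nn_integral_cmult) measurable
    finally show ?thesis .
  qed
  have "(\<integral>\<^sup>+y. ennreal (?g (norm y)) * crescent_rate y \<partial>lborel) =
    (\<integral>\<^sup>+r. ennreal r * indicator {0<..} r * ?K r \<partial>lborel)"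
    by (rule nn_integral_polar) measurable
  also have "\<dots> = (\<integral>\<^sup>+r. ennreal (16 * lam\<^sup>2 * v) * (ennreal (exp (- ((lam * pi) * r\<^sup>2)) * r ^ 2) * indicator {0<..} r) \<partial>lborel)"
  proof (rule nn_integral_cong)
    fix r :: real
    show "ennreal r * indicator {0<..} r * ?K r =
      ennreal (16 * lam\<^sup>2 * v) * (ennreal (exp (- ((lam * pi) * r\<^sup>2)) * r ^ 2) * indicator {0<..} r)"
    proof (cases "r > 0")
      case True
      have "?K r =
         (\<integral>\<^sup>+\<phi>. (ennreal (?g r) * ennreal r) * (T \<phi> * indicator {-pi..<pi} \<phi>) \<partial>lborel)"
        unfolding rate[OF True] norm_polar[OF True] by (simp only: mult.assoc)
      also have "\<dots> = (ennreal (?g r) * ennreal r) * (\<integral>\<^sup>+\<phi>\<in>{-pi..<pi}. T \<phi> \<partial>lborel)"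
        by (rule nn_integral_cmult) measurable
      also have "(\<integral>\<^sup>+\<phi>\<in>{-pi..<pi}. T \<phi> \<partial>lborel) = ennreal 16"
        unfolding T_def nn_integral_cos_diff_double by simp
      also have "(ennreal (?g r) * ennreal r) * ennreal 16 = ennreal (?g r * r * 16)"
        using True lam v by (simp only: ennreal_mult[symmetric] mult_nonneg_nonneg exp_ge_zero less_imp_le zero_le_numeral)
      finally have "ennreal r * ?K r
          = ennreal (r * (?g r * r * 16))"
        using True by (simp only: ennreal_mult'[symmetric] less_imp_le)
      also have "r * (?g r * r * 16) = (16 * lam\<^sup>2 * v) * (exp (- ((lam * pi) * r\<^sup>2)) * r ^ 2)"
        by (simp add: power2_eq_square mult_ac)
      also have "ennreal \<dots> = ennreal (16 * lam\<^sup>2 * v) * ennreal (exp (- ((lam * pi) * r\<^sup>2)) * r ^ 2)"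
        using v by (intro ennreal_mult') simp
      finally show ?thesis using True by simp
    qed simp
  qed
  also have "\<dots> = ennreal (16 * lam\<^sup>2 * v) * (\<integral>\<^sup>+r\<in>{0<..}. ennreal (exp (- ((lam * pi) * r\<^sup>2)) * r ^ 2) \<partial>lborel)"
    by (rule nn_integral_cmult) measurable
  also have "(\<integral>\<^sup>+r\<in>{0<..}. ennreal (exp (- ((lam * pi) * r\<^sup>2)) * r ^ 2) \<partial>lborel) = ennreal ((sqrt pi / 4) / sqrt (lam * pi) ^ Suc 2)"
  proof (rule nn_integral_gaussian_moment_scaled)
    have "(sqrt pi / 2) * (fact (2 * 1) / (2 ^ (2 * 1) * fact 1)) = sqrt pi / 4" by (simp add: numeral_eq_Suc)
    with gaussian_moment_even_pos[of 1]
    show "has_bochner_integral lborel (\<lambda>x::real. indicator {0..} x *\<^sub>R (exp (- x\<^sup>2) * x ^ 2)) (sqrt pi / 4)" by simp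
  qed (use lam in auto)
  also have "ennreal (16 * lam\<^sup>2 * v) * \<dots> = ennreal ((16 * lam\<^sup>2 * v) * ((sqrt pi / 4) / sqrt (lam * pi) ^ Suc 2))"
    using v by (intro ennreal_mult'[symmetric]) simp
  also have "(16 * lam\<^sup>2 * v) * ((sqrt pi / 4) / sqrt (lam * pi) ^ Suc 2) = 4 * v * sqrt lam / pi"
  proof -
    define s where "s = sqrt lam"
    have s: "s > 0" "lam = s\<^sup>2" using lam by (auto simp: s_def)
    define p where "p = sqrt pi"
    have p: "p > 0" "pi = p\<^sup>2" by (auto simp: p_def)
    have "sqrt (lam * pi) = s * p" by (simp add: s_def p_def real_sqrt_mult)
    then show ?thesis
      using s(1) p(1) unfolding s_def[symmetric] p_def[symmetric] unfolding s(2) p(2)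
      by (simp add: power2_eq_square power3_eq_cube field_simps)
  qed
  finally show ?thesis .
qed

text \<open>The weight \<open>g\<close> has total mass 1, so \<open>n * (1 - Q)\<close> is the
  integral of \<open>g\<close> times \<open>n * (1 - exp (- lam * W n y))\<close>. The integrand
  converges for every \<open>y\<close> except the origin, and the annulus bound dominates it by
  \<open>g\<close> times a linear function of \<open>norm y\<close>, which has finite Gaussian
  moments.\<close>

lemma change_rate_tendsto:
  assumes lam: "lam > 0" and v: "v > 0"
  shows "(\<lambda>n. of_nat n * (1 - both_nearest_prob lam (v / real n))) \<longlonglongrightarrow> ennreal (4 * v * sqrt lam / pi)"
proof -
  define g where "g y = lam * exp (- (lam * (pi * (norm y)\<^sup>2)))" for y :: "real \<times> real"
  define W where "W n y = measure lborel (crescent (v / real n) y)" for n :: nat and y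
  let ?u = "\<lambda>n y. ennreal (g y * (real n * (1 - exp (- (lam * W n y)))))"
  let ?m = "\<lambda>k r. ennreal (exp (- ((lam * pi) * r\<^sup>2)) * r ^ k) * indicator {0<..} r"
  let ?b = "\<lambda>y. ennreal (g y * (lam * (4 * pi * v * (norm y + v))))"
  let ?l = "\<lambda>y. ennreal (g y * (lam * v)) * crescent_rate y"
  have gm[measurable]: "g \<in> borel_measurable borel" unfolding g_def[abs_def] by measurable
  have [measurable]: "W n \<in> borel_measurable borel" for n
  proof -
    have "(\<lambda>y :: real \<times> real. measure lborel (ball 0 (norm y) \<union> ball (- (v / real n), 0 :: real) (dist (- (v / real n), 0) y))) \<in> borel_measurable borel"
      by (intro borel_measurable_measure_two_balls) measurable
    then have "(\<lambda>y. pi * (norm y)\<^sup>2 + W n y) \<in> borel_measurable borel" unfolding measure_union_crescent W_def .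
    moreover have "(\<lambda>y :: real \<times> real. pi * (norm y)\<^sup>2) \<in> borel_measurable borel" by measurable
    ultimately have "(\<lambda>y. (pi * (norm y)\<^sup>2 + W n y) - pi * (norm y)\<^sup>2) \<in> borel_measurable borel" by (rule borel_measurable_diff)
    then show ?thesis by simp
  qed
  have g0: "g y > 0" for y using lam by (simp add: g_def)
  have W0: "W n y \<ge> 0" for n y by (simp add: W_def)
  have e1: "g y * exp (- (lam * W n y)) \<le> g y" for n y
    using g0[of y] W0[of n y] lam by simp
  have Q: "both_nearest_prob lam (v / real n) = (\<integral>\<^sup>+y. ennreal (g y * exp (- (lam * W n y))) \<partial>lborel)" for n
    unfolding both_nearest_prob_def measure_union_crescent W_def[symmetric] g_def
    by (simp add: distrib_left exp_add mult.assoc exp_diff exp_minus divide_inverse)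
  have one: "(\<integral>\<^sup>+y. ennreal (g y) \<partial>lborel) = 1" unfolding g_def by (rule nn_integral_gaussian_plane[OF lam])
  have eq: "of_nat n * (1 - both_nearest_prob lam (v / real n)) = (\<integral>\<^sup>+y. ?u n y \<partial>lborel)" for n
  proof -
    have "1 - both_nearest_prob lam (v / real n) = (\<integral>\<^sup>+y. ennreal (g y) - ennreal (g y * exp (- (lam * W n y))) \<partial>lborel)"
      unfolding Q one[symmetric]
    proof (rule nn_integral_diff[symmetric])
      have "(\<integral>\<^sup>+y. ennreal (g y * exp (- (lam * W n y))) \<partial>lborel) \<le> (\<integral>\<^sup>+y. ennreal (g y) \<partial>lborel)"
        by (intro nn_integral_mono ennreal_leI e1)
      then show "(\<integral>\<^sup>+y. ennreal (g y * exp (- (lam * W n y))) \<partial>lborel) \<noteq> \<infinity>" unfolding one by (auto simp: top_unique)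
    qed (auto intro!: AE_I2 ennreal_leI e1)
    also have "\<dots> = (\<integral>\<^sup>+y. ennreal (g y * (1 - exp (- (lam * W n y)))) \<partial>lborel)"
      using g0 by (intro nn_integral_cong) (simp add: ennreal_minus less_imp_le right_diff_distrib)
    finally have "of_nat n * (1 - both_nearest_prob lam (v / real n)) = (\<integral>\<^sup>+y. ennreal (real n) * ennreal (g y * (1 - exp (- (lam * W n y)))) \<partial>lborel)"
      by (simp add: nn_integral_cmult ennreal_of_nat_eq_real_of_nat)
    also have "\<dots> = (\<integral>\<^sup>+y. ?u n y \<partial>lborel)"
      by (intro nn_integral_cong) (simp add: ennreal_mult'[symmetric] mult.left_commute)
    finally show ?thesis .
  qed
  have "(\<lambda>n. \<integral>\<^sup>+y. ?u n y \<partial>lborel) \<longlonglongrightarrow> (\<integral>\<^sup>+y. ?l y \<partial>lborel)"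
  proof (rule nn_integral_dominated_convergence[where w="\<lambda>y. ?b y"])
    show "AE y in lborel. ?u n y \<le> ?b y" for n
    proof (intro AE_I2 ennreal_leI mult_left_mono)
      fix y
      show "g y \<ge> 0" using g0[of y] by simp
      have h: "0 \<le> v / real n" "v / real n \<le> v" using v by (cases "n = 0"; simp add: divide_le_eq mult_left_le_one_le)+
      have "real n * (1 - exp (- (lam * W n y))) \<le> real n * (lam * W n y)"
        using exp_ge_add_one_self[of "- (lam * W n y)"] by (intro mult_left_mono) auto
      also have "\<dots> \<le> real n * (lam * (4 * pi * (v / real n) * (norm y + v / real n)))"
        unfolding W_def using measure_crescent_le[OF h(1), of y] lam by (intro mult_left_mono) auto
      also have "\<dots> = lam * (4 * pi * (real n * (v / real n)) * (norm y + v / real n))" by (simp add: mult_ac)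
      also have "\<dots> \<le> lam * (4 * pi * v * (norm y + v))"
        using h v lam by (intro mult_left_mono mult_mono) auto
      finally show "real n * (1 - exp (- (lam * W n y))) \<le> lam * (4 * pi * v * (norm y + v))" .
    qed
    show "AE y in lborel. (\<lambda>n. ?u n y) \<longlonglongrightarrow> ?l y"
    proof (rule AE_I[of _ _ "{0}"])
      show "{y \<in> space lborel. \<not> (\<lambda>n. ?u n y) \<longlonglongrightarrow> ?l y} \<subseteq> {0}"
      proof safe
        fix y :: "real \<times> real"
        assume no: "\<not> (\<lambda>n. ?u n y) \<longlonglongrightarrow> ?l y"
        show "y = 0"
        proof (rule ccontr)
          assume "y \<noteq> 0"
          have "(\<lambda>n. lam * (real n * W n y)) \<longlonglongrightarrow> lam * (v * enn2real (crescent_rate y))"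
            unfolding W_def by (intro tendsto_mult_left crescent_tendsto \<open>y \<noteq> 0\<close> v)
          then have "(\<lambda>n. real n * (1 - exp (- (lam * W n y)))) \<longlonglongrightarrow> lam * (v * enn2real (crescent_rate y))"
            using W0 lam by (intro one_minus_exp_tendsto) (auto simp: mult.left_commute)
          then have "(\<lambda>n. ?u n y) \<longlonglongrightarrow> ennreal (g y * (lam * (v * enn2real (crescent_rate y))))"
            by (intro tendsto_ennrealI tendsto_mult_left)
          also have "ennreal (g y * (lam * (v * enn2real (crescent_rate y)))) = ?l y"
          proof -
            have "g y * (lam * (v * enn2real (crescent_rate y))) = (g y * (lam * v)) * enn2real (crescent_rate y)" by simp
            also have "ennreal \<dots> = ennreal (g y * (lam * v)) * ennreal (enn2real (crescent_rate y))"
              using g0[of y] lam v by (intro ennreal_mult') (simp add: less_imp_le)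
            finally show ?thesis using crescent_rate_finite[of y] by simp
          qed
          finally show False using no by contradiction
        qed
      qed
    qed auto
    show "(\<integral>\<^sup>+y. ?b y \<partial>lborel) < \<infinity>"
    proof -
      let ?k = "2 * pi * lam * (lam * (4 * pi * v))"
      have k: "?k \<ge> 0" using lam v by simp
      have "(\<integral>\<^sup>+y. ?b y \<partial>lborel) =
          (\<integral>\<^sup>+r. ennreal (2 * pi * r) * indicator {0<..} r * ennreal (lam * exp (- (lam * (pi * r\<^sup>2))) * (lam * (4 * pi * v * (r + v)))) \<partial>lborel)"
        unfolding g_def by (rule nn_integral_radial) measurable
      also have "\<dots> = (\<integral>\<^sup>+r. ennreal ?k * ?m 2 r
         + ennreal (?k * v) * ?m 1 r \<partial>lborel)"
      proof (rule nn_integral_cong)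
        fix r :: real
        show "ennreal (2 * pi * r) * indicator {0<..} r * ennreal (lam * exp (- (lam * (pi * r\<^sup>2))) * (lam * (4 * pi * v * (r + v)))) =
          ennreal ?k * ?m 2 r
         + ennreal (?k * v) * ?m 1 r"
        proof (cases "r > 0")
          case True
          have "ennreal ?k * ennreal (exp (- ((lam * pi) * r\<^sup>2)) * r ^ 2) + ennreal (?k * v) * ennreal (exp (- ((lam * pi) * r\<^sup>2)) * r ^ 1)
            = ennreal (?k * (exp (- ((lam * pi) * r\<^sup>2)) * r ^ 2) + (?k * v) * (exp (- ((lam * pi) * r\<^sup>2)) * r ^ 1))"
            using True k v by (subst ennreal_plus) (auto simp: ennreal_mult intro!: mult_nonneg_nonneg)
          also have "?k * (exp (- ((lam * pi) * r\<^sup>2)) * r ^ 2) + (?k * v) * (exp (- ((lam * pi) * r\<^sup>2)) * r ^ 1) =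
             (2 * pi * r) * (lam * exp (- (lam * (pi * r\<^sup>2))) * (lam * (4 * pi * v * (r + v))))"
            by (simp add: power2_eq_square algebra_simps)
          also have "ennreal \<dots> = ennreal (2 * pi * r) * ennreal (lam * exp (- (lam * (pi * r\<^sup>2))) * (lam * (4 * pi * v * (r + v))))"
            using True by (intro ennreal_mult') simp
          finally show ?thesis using True by simp
        qed simp
      qed
      also have "\<dots> = ennreal ?k * (\<integral>\<^sup>+r\<in>{0<..}. ennreal (exp (- ((lam * pi) * r\<^sup>2)) * r ^ 2) \<partial>lborel)
         + ennreal (?k * v) * (\<integral>\<^sup>+r\<in>{0<..}. ennreal (exp (- ((lam * pi) * r\<^sup>2)) * r ^ 1) \<partial>lborel)"
        by (subst nn_integral_add) (auto simp: nn_integral_cmult)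
      also have "\<dots> < \<infinity>"
        using nn_integral_gaussian_moment_scaled[OF gaussian_moment_even_pos[of 1], of "lam * pi"]
          nn_integral_gaussian_moment_scaled[OF gaussian_moment_odd_pos[of 0], of "lam * pi"] lam
        by (simp add: ennreal_mult_less_top ennreal_add_less_top)
      finally show ?thesis .
    qed
  qed measurable
  then show ?thesis unfolding eq nn_integral_crescent_rate[OF lam v, folded g_def] .
qed

section \<open>Random rotations\<close>

text \<open>Rotation by \<open>- \<theta>\<close>.\<close>

definition rot :: "real \<Rightarrow> real \<times> real \<Rightarrow> real \<times> real" where
  "rot \<theta> x = (fst x * cos \<theta> + snd x * sin \<theta>, snd x * cos \<theta> - fst x * sin \<theta>)"

lemma norm_rot: "norm (rot \<theta> x) = norm x"
proof -
  obtain p q where x: "x = (p, q)" by (cases x)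
  have "(p * cos \<theta> + q * sin \<theta>)\<^sup>2 + (q * cos \<theta> - p * sin \<theta>)\<^sup>2 = (p\<^sup>2 + q\<^sup>2) * ((cos \<theta>)\<^sup>2 + (sin \<theta>)\<^sup>2)"
    by algebra
  then show ?thesis by (simp add: x rot_def norm_Pair)
qed

lemma rot_polar: "rot \<theta> (r * cos \<psi>, r * sin \<psi>) = (r * cos (\<psi> - \<theta>), r * sin (\<psi> - \<theta>))"
  by (simp add: rot_def cos_diff sin_diff algebra_simps)

lemma measurable_rot [measurable (raw)]:
  assumes [measurable]: "f \<in> borel_measurable M" "g \<in> borel_measurable M"
  shows "(\<lambda>x. rot (f x) (g x)) \<in> borel_measurable M"
proof -
  have "(\<lambda>p :: real \<times> real \<times> real. rot (fst p) (snd p)) \<in> borel_measurable borel"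
    unfolding rot_def by (intro borel_measurable_continuous_onI continuous_intros)
  moreover have "(\<lambda>x. (f x, g x)) \<in> borel_measurable M" by measurable
  ultimately have "(\<lambda>x. rot (fst (f x, g x)) (snd (f x, g x))) \<in> borel_measurable M"
    by (rule measurable_compose[rotated])
  then show ?thesis by simp
qed

text \<open>The conditional mean of \<open>g\<close> at the rotated point, given that the initial
  position is \<open>x\<close>.\<close>

definition rot_mean :: "(real \<times> real \<Rightarrow> ennreal) \<Rightarrow> real \<times> real \<Rightarrow> ennreal" where
  "rot_mean g x = (\<integral>\<^sup>+\<theta>\<in>{-pi..<pi}. g (rot \<theta> x) \<partial>lborel) / ennreal (2 * pi)"

lemma borel_measurable_rot_mean [measurable]:
  assumes [measurable]: "g \<in> borel_measurable borel"
  shows "rot_mean g \<in> borel_measurable borel"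
  unfolding rot_mean_def[abs_def] by measurable

text \<open>On the circle of radius \<open>r\<close> the function \<open>rot_mean g\<close> is
  constant, equal to the mean of \<open>g\<close> over that circle. Averaging over circles does not
  change an integral in polar coordinates.\<close>

lemma nn_integral_rot_mean:
  assumes [measurable]: "g \<in> borel_measurable borel"
  shows "(\<integral>\<^sup>+x. rot_mean g x \<partial>lborel) = (\<integral>\<^sup>+x. g x \<partial>lborel)"
proof -
  define G where "G r = (\<integral>\<^sup>+u\<in>{-pi..<pi}. g (r * cos u, r * sin u) \<partial>lborel)" for r
  have shift: "(\<integral>\<^sup>+\<theta>\<in>{-pi..<pi}. g (rot \<theta> (r * cos \<psi>, r * sin \<psi>)) \<partial>lborel) = G r"
    if \<psi>: "\<psi> \<in> {-pi..<pi}" for r \<psi>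
  proof -
    let ?k = "\<lambda>u. g (r * cos u, r * sin u)"
    have "(\<integral>\<^sup>+\<theta>\<in>{-pi..<pi}. g (rot \<theta> (r * cos \<psi>, r * sin \<psi>)) \<partial>lborel) =
       (\<integral>\<^sup>+\<theta>\<in>{-pi..<pi}. ?k (\<psi> - \<theta>) \<partial>lborel)" by (simp only: rot_polar)
    also have "\<dots> = (\<integral>\<^sup>+u. ?k u * indicator {-pi..<pi} (\<psi> - u) \<partial>lborel)"
      by (subst nn_integral_real_affine[where c="-1" and t=\<psi>]) auto
    also have "\<dots> = (\<integral>\<^sup>+u\<in>{\<psi> - pi..<\<psi> - pi + 2 * pi}. ?k u \<partial>lborel)"
      by (intro nn_integral_cong_AE AE_I[of _ _ "{\<psi> - pi, \<psi> + pi}"]) (auto simp: indicator_def emeasure_lborel_countable)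
    also have "\<dots> = (\<integral>\<^sup>+u\<in>{-pi..<-pi + 2 * pi}. ?k u \<partial>lborel)"
      using \<psi> by (intro nn_integral_periodic_shift) auto
    finally show ?thesis by (simp add: G_def)
  qed
  have "(\<integral>\<^sup>+x. rot_mean g x \<partial>lborel) =
     (\<integral>\<^sup>+r. ennreal r * indicator {0<..} r * (\<integral>\<^sup>+\<psi>\<in>{-pi..<pi}. rot_mean g (r * cos \<psi>, r * sin \<psi>) \<partial>lborel) \<partial>lborel)"
    by (rule nn_integral_polar) measurable
  also have "\<dots> = (\<integral>\<^sup>+r. ennreal r * indicator {0<..} r * G r \<partial>lborel)"
  proof (rule nn_integral_cong)
    fix r :: real
    have "(\<integral>\<^sup>+\<psi>\<in>{-pi..<pi}. rot_mean g (r * cos \<psi>, r * sin \<psi>) \<partial>lborel) =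
        (\<integral>\<^sup>+\<psi>\<in>{-pi..<pi}. G r / ennreal (2 * pi) \<partial>lborel)"
      unfolding rot_mean_def using shift by (intro nn_integral_cong) (auto split: split_indicator)
    also have "\<dots> = G r / ennreal (2 * pi) * ennreal (2 * pi)"
      by (simp add: nn_integral_cmult)
    also have "\<dots> = G r"
      by (subst ennreal_divide_times) (simp add: ennreal_mult_divide_eq)
    finally show "ennreal r * indicator {0<..} r * (\<integral>\<^sup>+\<psi>\<in>{-pi..<pi}. rot_mean g (r * cos \<psi>, r * sin \<psi>) \<partial>lborel) =
       ennreal r * indicator {0<..} r * G r" by simp
  qed
  also have "\<dots> = (\<integral>\<^sup>+x. g x \<partial>lborel)"
    unfolding G_def by (rule nn_integral_polar[symmetric]) measurable
  finally show ?thesis .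
qed

lemma rot_mean_const: "rot_mean (\<lambda>_. c) x = c"
  unfolding rot_mean_def
  by (simp add: nn_integral_cmult) (simp add: ennreal_mult_divide_eq)

lemma rot_mean_indicator_compl:
  assumes [measurable]: "B \<in> sets borel"
  shows "rot_mean (indicator (- B)) x = 1 - rot_mean (indicator B) x" "rot_mean (indicator B) x \<le> 1"
proof -
  have "rot_mean (indicator (- B)) x + rot_mean (indicator B) x =
      (\<integral>\<^sup>+\<theta>. indicator (- B) (rot \<theta> x) * indicator {-pi..<pi} \<theta> + indicator B (rot \<theta> x) * indicator {-pi..<pi} \<theta> \<partial>lborel) / ennreal (2 * pi)"
    unfolding rot_mean_def divide_ennreal_def by (subst nn_integral_add) (auto simp: distrib_right)
  also have "\<dots> = (\<integral>\<^sup>+\<theta>\<in>{-pi..<pi}. 1 \<partial>lborel) / ennreal (2 * pi)"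
    by (intro arg_cong2[where f="(/)"] refl nn_integral_cong) (auto split: split_indicator)
  also have "\<dots> = 1" using rot_mean_const[of 1 x] unfolding rot_mean_def by simp
  finally have s: "rot_mean (indicator (- B)) x + rot_mean (indicator B) x = 1" .
  have "rot_mean (indicator B) x \<le> rot_mean (indicator (- B)) x + rot_mean (indicator B) x"
    by (rule add_increasing) auto
  then show le: "rot_mean (indicator B) x \<le> 1" unfolding s .
  show "rot_mean (indicator (- B)) x = 1 - rot_mean (indicator B) x"
    using le by (subst s[symmetric], intro ennreal_add_diff_cancel_right[symmetric]) (auto simp: top_unique)
qed

section \<open>Poisson process in the plane\<close>

definition poisson_density :: "real \<Rightarrow> nat \<Rightarrow> real" where
  "poisson_density a k = a ^ k / fact k * exp (- a)"

lemma poisson_density_nonneg: "a \<ge> 0 \<Longrightarrow> poisson_density a k \<ge> 0"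
  by (simp add: poisson_density_def)

text \<open>The generating function of the Poisson law: \<open>z = 1\<close> gives total mass 1, and
  smaller \<open>z\<close> will be the weight attached to each point in the Laplace
  functional.\<close>

lemma poisson_density_power_sums: "(\<lambda>k. z ^ k * poisson_density a k) sums exp (- (a * (1 - z)))"
proof -
  have "(\<lambda>k. (z * a) ^ k /\<^sub>R fact k * exp (- a)) sums (exp (z * a) * exp (- a))"
    by (intro sums_mult2 exp_converges)
  also have "(\<lambda>k. (z * a) ^ k /\<^sub>R fact k * exp (- a)) = (\<lambda>k. z ^ k * poisson_density a k)"
    by (simp add: poisson_density_def power_mult_distrib field_simps)
  also have "exp (z * a) * exp (- a) = exp (- (a * (1 - z)))"
    by (simp add: exp_add[symmetric] algebra_simps)
  finally show ?thesis .
qed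

lemma poisson_density_mean_sums: "(\<lambda>k. real k * poisson_density a k) sums a"
proof -
  have "(\<lambda>k. a * (1 ^ k * poisson_density a k)) sums (a * exp (- (a * (1 - 1))))"
    by (intro sums_mult poisson_density_power_sums)
  then have "(\<lambda>k. a * poisson_density a k) sums a" by simp
  moreover have "a * poisson_density a k = real (Suc k) * poisson_density a (Suc k)" for k
    by (simp add: poisson_density_def fact_Suc del: of_nat_Suc)
  ultimately have "(\<lambda>k. real (Suc k) * poisson_density a (Suc k)) sums a" by (simp only:)
  then show ?thesis by (subst (asm) sums_Suc_iff) simp
qed

locale plane_ppp = prob_space M for M :: "'w measure" +
  fixes lam :: real and X :: "'w \<Rightarrow> nat \<Rightarrow> real \<times> real"
  assumes lam_pos: "lam > 0" and PPP: "homogeneous_PPP M lam X"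
begin

lemma X_measurable [measurable]: "(\<lambda>\<omega>. X \<omega> n) \<in> borel_measurable M"
  using PPP unfolding homogeneous_PPP_def by blast

lemma pp_count_prob:
  assumes "B \<in> sets borel" "bounded B"
  shows "prob {\<omega> \<in> space M. pp_count X \<omega> B = of_nat k} = (lam * measure lborel B) ^ k / fact k * exp (- (lam * measure lborel B))"
  using PPP[unfolded homogeneous_PPP_def, THEN conjunct2, THEN conjunct2, THEN conjunct1, rule_format, of B k] assms
  by simp

lemma pp_count_indep:
  assumes "finite (I :: nat set)" "\<And>i. i \<in> I \<Longrightarrow> B i \<in> sets borel" "\<And>i. i \<in> I \<Longrightarrow> bounded (B i)" "disjoint_family_on B I"
  shows "indep_vars (\<lambda>_. borel) (\<lambda>i \<omega>. pp_count X \<omega> (B i)) I"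
  using PPP[unfolded homogeneous_PPP_def, THEN conjunct2, THEN conjunct2, THEN conjunct2, rule_format, of I B] assms
  by simp

lemma pp_count_eq_suminf: "pp_count X \<omega> B = (\<Sum>k. indicator B (X \<omega> k))"
proof -
  have "pp_count X \<omega> B = (\<integral>\<^sup>+k. indicator {k. X \<omega> k \<in> B} k \<partial>count_space UNIV)"
    unfolding pp_count_def by simp
  also have "\<dots> = (\<integral>\<^sup>+k. indicator B (X \<omega> k) \<partial>count_space UNIV)"
    by (intro nn_integral_cong) (auto split: split_indicator)
  finally show ?thesis by (simp add: nn_integral_count_space_nat)
qed

lemma pp_count_measurable [measurable]:
  assumes [measurable]: "B \<in> sets borel" shows "(\<lambda>\<omega>. pp_count X \<omega> B) \<in> borel_measurable M"
  unfolding pp_count_eq_suminf by measurable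

text \<open>The probabilities of the values 0, 1, 2, ... add up to 1, which excludes an infinite
  count; the mean of a function of the count then splits over these values.\<close>

lemma
  assumes B[measurable]: "B \<in> sets borel" and bB: "bounded B"
  shows AE_pp_count_finite: "AE \<omega> in M. \<exists>k. pp_count X \<omega> B = of_nat k"
    and nn_integral_pp_count: "(\<integral>\<^sup>+\<omega>. \<phi> (pp_count X \<omega> B) \<partial>M) = (\<Sum>k. \<phi> (of_nat k) * ennreal (poisson_density (lam * measure lborel B) k))"
proof -
  let ?a = "lam * measure lborel B"
  let ?E = "\<lambda>k. {\<omega> \<in> space M. pp_count X \<omega> B = of_nat k}"
  have a: "?a \<ge> 0" using lam_pos by simp
  have Em: "?E k \<in> sets M" for k by measurable
  have P: "emeasure M (?E k) = ennreal (poisson_density ?a k)" for k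
    unfolding emeasure_eq_measure poisson_density_def using pp_count_prob[OF B bB] by simp
  have "emeasure M (\<Union>k. ?E k) = (\<Sum>k. emeasure M (?E k))"
    using Em by (intro suminf_emeasure[symmetric]) (auto simp: disjoint_family_on_def)
  also have "\<dots> = ennreal (\<Sum>k. 1 ^ k * poisson_density ?a k)"
    unfolding P using poisson_density_power_sums[of 1 ?a] poisson_density_nonneg[OF a] by (subst suminf_ennreal2) (auto simp: sums_iff)
  also have "\<dots> = 1" using poisson_density_power_sums[of 1 ?a] by (simp add: sums_iff)
  finally have "prob (\<Union>k. ?E k) = 1" by (simp add: emeasure_eq_measure)
  then have "AE \<omega> in M. \<omega> \<in> (\<Union>k. ?E k)" using Em by (subst (asm) prob_eq_1) auto
  then show fin: "AE \<omega> in M. \<exists>k. pp_count X \<omega> B = of_nat k" by eventually_elim auto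
  have "(\<integral>\<^sup>+\<omega>. \<phi> (pp_count X \<omega> B) \<partial>M) = (\<integral>\<^sup>+\<omega>. (\<Sum>k. \<phi> (of_nat k) * indicator (?E k) \<omega>) \<partial>M)"
  proof (rule nn_integral_cong_AE)
    show "AE \<omega> in M. \<phi> (pp_count X \<omega> B) = (\<Sum>k. \<phi> (of_nat k) * indicator (?E k) \<omega>)"
      using fin AE_space
    proof eventually_elim
      case (elim \<omega>)
      then obtain k where k: "pp_count X \<omega> B = of_nat k" by blast
      have "(\<Sum>j. \<phi> (of_nat j) * indicator (?E j) \<omega>) = (\<Sum>j\<in>{k}. \<phi> (of_nat j) * indicator (?E j) \<omega>)"
        using k by (intro suminf_finite) (auto simp: indicator_def)
      then show ?case using k elim(2) by simp
    qed
  qed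
  also have "\<dots> = (\<Sum>k. \<integral>\<^sup>+\<omega>\<in>(?E k). \<phi> (of_nat k) \<partial>M)"
    by (rule nn_integral_suminf) measurable
  also have "\<dots> = (\<Sum>k. \<phi> (of_nat k) * ennreal (poisson_density ?a k))"
    using Em by (simp add: nn_integral_cmult_indicator P)
  finally show "(\<integral>\<^sup>+\<omega>. \<phi> (pp_count X \<omega> B) \<partial>M) = (\<Sum>k. \<phi> (of_nat k) * ennreal (poisson_density ?a k))" .
qed

lemma mean_pp_count:
  assumes "B \<in> sets borel" and "bounded B"
  shows "(\<integral>\<^sup>+\<omega>. pp_count X \<omega> B \<partial>M) = ennreal (lam * measure lborel B)"
proof -
  let ?a = "lam * measure lborel B"
  have a: "?a \<ge> 0" using lam_pos by simp
  have "(\<integral>\<^sup>+\<omega>. pp_count X \<omega> B \<partial>M) = (\<Sum>k. of_nat k * ennreal (poisson_density ?a k))"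
    by (rule nn_integral_pp_count[OF assms, of "\<lambda>x. x"])
  also have "\<dots> = (\<Sum>k. ennreal (real k * poisson_density ?a k))"
    using poisson_density_nonneg[OF a] by (simp add: ennreal_mult ennreal_of_nat_eq_real_of_nat)
  also have "\<dots> = ennreal ?a"
    using poisson_density_mean_sums[of ?a] poisson_density_nonneg[OF a] by (subst suminf_ennreal2) (auto simp: sums_iff)
  finally show ?thesis .
qed

text \<open>The left side is the integral of \<open>f\<close> against the image \<open>\<mu>\<close>
  of counting measure times \<open>M\<close> under the points. By the Poisson mean,
  \<open>\<mu>\<close> divided by \<open>lam\<close> gives every box its volume, and this
  characterises Lebesgue measure.\<close>

lemma campbell:
  assumes f[measurable]: "f \<in> borel_measurable borel"
  shows "(\<Sum>k. \<integral>\<^sup>+\<omega>. f (X \<omega> k) \<partial>M) = ennreal lam * (\<integral>\<^sup>+x. f x \<partial>lborel)"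
proof -
  define \<mu> where "\<mu> = distr (count_space UNIV \<Otimes>\<^sub>M M) borel (\<lambda>p. X (snd p) (fst p))"
  have [measurable]: "(\<lambda>p. X (snd p) (fst p)) \<in> borel_measurable (count_space UNIV \<Otimes>\<^sub>M M)"
    by (rule measurable_pair_measure_countable1) auto
  have int: "(\<integral>\<^sup>+x. g x \<partial>\<mu>) = (\<Sum>k. \<integral>\<^sup>+\<omega>. g (X \<omega> k) \<partial>M)" if [measurable]: "g \<in> borel_measurable borel" for g
  proof -
    have "(\<integral>\<^sup>+x. g x \<partial>\<mu>) = (\<integral>\<^sup>+p. g (X (snd p) (fst p)) \<partial>(count_space UNIV \<Otimes>\<^sub>M M))"
      unfolding \<mu>_def by (rule nn_integral_distr) auto
    also have "\<dots> = (\<integral>\<^sup>+k. \<integral>\<^sup>+\<omega>. g (X \<omega> k) \<partial>M \<partial>count_space UNIV)"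
      by (subst nn_integral_fst[symmetric]) auto
    finally show ?thesis by (simp add: nn_integral_count_space_nat)
  qed
  have em: "emeasure \<mu> B = ennreal (lam * measure lborel B)" if B[measurable]: "B \<in> sets borel" and bB: "bounded B" for B
  proof -
    have "emeasure \<mu> B = (\<integral>\<^sup>+x. indicator B x \<partial>\<mu>)" by (simp add: \<mu>_def)
    also have "\<dots> = (\<Sum>k. \<integral>\<^sup>+\<omega>. indicator B (X \<omega> k) \<partial>M)" by (rule int) measurable
    also have "\<dots> = (\<integral>\<^sup>+\<omega>. pp_count X \<omega> B \<partial>M)"
      unfolding pp_count_eq_suminf by (rule nn_integral_suminf[symmetric]) measurable
    finally show ?thesis using mean_pp_count[OF B bB] by simp
  qed
  have leb: "lborel = scale_measure (ennreal (1 / lam)) \<mu>"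
  proof (rule lborel_eqI)
    fix l u :: "real \<times> real" assume lu: "\<And>b. b \<in> Basis \<Longrightarrow> l \<bullet> b \<le> u \<bullet> b"
    have "emeasure (scale_measure (ennreal (1 / lam)) \<mu>) (box l u) = ennreal (1 / lam) * ennreal (lam * measure lborel (box l u))"
      using em[of "box l u"] by simp
    also have "\<dots> = ennreal (measure lborel (box l u))"
      using lam_pos by (simp add: ennreal_mult'[symmetric])
    also have "\<dots> = emeasure lborel (box l u)"
      using emeasure_bounded_finite[OF bounded_box[of l u]] by (intro emeasure_eq_ennreal_measure[symmetric]) auto
    also have "\<dots> = (\<Prod>b\<in>Basis. (u - l) \<bullet> b)" using lu by (simp add: emeasure_lborel_box)
    finally show "emeasure (scale_measure (ennreal (1 / lam)) \<mu>) (box l u) = (\<Prod>b\<in>Basis. (u - l) \<bullet> b)" .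
  qed (simp add: \<mu>_def)
  have "(\<integral>\<^sup>+x. f x \<partial>scale_measure (ennreal (1 / lam)) \<mu>) = ennreal (1 / lam) * (\<integral>\<^sup>+x. f x \<partial>\<mu>)"
    by (rule nn_integral_scale_measure) (simp add: \<mu>_def)
  then have "(\<integral>\<^sup>+x. f x \<partial>lborel) = ennreal (1 / lam) * (\<integral>\<^sup>+x. f x \<partial>\<mu>)"
    unfolding leb[symmetric] .
  then have "ennreal lam * (\<integral>\<^sup>+x. f x \<partial>lborel) = (ennreal lam * ennreal (1 / lam)) * (\<integral>\<^sup>+x. f x \<partial>\<mu>)"
    by (simp add: mult.assoc)
  also have "ennreal lam * ennreal (1 / lam) = 1" using lam_pos by (simp add: ennreal_mult'[symmetric])
  finally show ?thesis using int[OF f] by simp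
qed

end

section \<open>The Laplace functional of the Poisson process\<close>

context plane_ppp
begin

text \<open>The infimum is the infinite product, since only factors at most 1 are used.\<close>

definition Zprod :: "(real \<times> real \<Rightarrow> ennreal) \<Rightarrow> 'w \<Rightarrow> ennreal" where
  "Zprod w \<omega> = (INF K. \<Prod>k<K. w (X \<omega> k))"

lemma borel_measurable_Zprod [measurable]:
  assumes [measurable]: "w \<in> borel_measurable borel" shows "Zprod w \<in> borel_measurable M"
  unfolding Zprod_def[abs_def] by measurable

lemma Zprod_mono: "(\<And>x. w x \<le> w' x) \<Longrightarrow> Zprod w \<omega> \<le> Zprod w' \<omega>"
  unfolding Zprod_def by (intro INF_mono' prod_mono_ennreal)

lemma Zprod_eventually:
  assumes w: "\<And>x. w x \<le> 1" and S: "finite S" "\<And>k. k \<notin> S \<Longrightarrow> w (X \<omega> k) = 1"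
  shows "Zprod w \<omega> = (\<Prod>k\<in>S. w (X \<omega> k))"
proof -
  let ?P = "\<lambda>K. \<Prod>k<K. w (X \<omega> k)"
  have "decseq ?P"
  proof (rule decseq_SucI)
    fix K
    have "?P K * w (X \<omega> K) \<le> ?P K * 1" by (intro mult_left_mono w) auto
    then show "?P (Suc K) \<le> ?P K" by (simp add: mult.commute)
  qed
  then have "?P \<longlonglongrightarrow> Zprod w \<omega>" unfolding Zprod_def by (rule LIMSEQ_INF)
  moreover have "?P \<longlonglongrightarrow> (\<Prod>k\<in>S. w (X \<omega> k))"
  proof (rule tendsto_eventually)
    obtain K0 where K0: "\<And>k. k \<in> S \<Longrightarrow> k < K0" using S(1) by (meson finite_nat_set_iff_bounded)
    show "\<forall>\<^sub>F K in sequentially. ?P K = (\<Prod>k\<in>S. w (X \<omega> k))"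
      using eventually_ge_at_top[of K0]
    proof eventually_elim
      case (elim K)
      have "S \<subseteq> {..<K}"
      proof
        fix k assume "k \<in> S" then have "k < K0" by (rule K0)
        with elim show "k \<in> {..<K}" by simp
      qed
      then show ?case using S(2) by (intro prod.mono_neutral_right) auto
    qed
  qed
  ultimately show ?thesis by (rule LIMSEQ_unique)
qed

text \<open>The weight is constant on each level set \<open>B j\<close>, and level 0 contributes
  factors 1, so the product is that of \<open>(1 - j / m)\<close> to the power of the count in
  \<open>B j\<close>. The level sets with \<open>j \<ge> 1\<close> are bounded and disjoint, their
  counts independent Poisson variables, and the generating function evaluates each factor.\<close>

lemma nn_integral_Zprod_step:
  fixes u :: "real \<times> real \<Rightarrow> nat"
  assumes u[measurable]: "u \<in> measurable borel (count_space UNIV)" and um: "\<And>x. u x \<le> m" and m: "m > 0"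
    and supp: "bounded {x. u x \<noteq> 0}"
    and s: "(\<integral>\<^sup>+x. ennreal (real (u x) / real m) \<partial>lborel) = ennreal s" "s \<ge> 0"
  shows "(\<integral>\<^sup>+\<omega>. Zprod (\<lambda>x. ennreal (1 - real (u x) / real m)) \<omega> \<partial>M) = ennreal (exp (- (lam * s)))"
proof -
  define B where "B j = {x. u x = j}" for j
  define w where "w j = ennreal (1 - real j / real m)" for j
  \<comment> \<open>The power \<open>w j ^ k\<close> as a Borel function of an
    \<open>ennreal\<close> count: it is 0 off the naturals, values which the count almost surely
    avoids.\<close>
  define \<phi> where "\<phi> j z = (\<Sum>k. w j ^ k * indicator {of_nat k} z)" for j and z :: ennreal
  have Bm[measurable]: "B j \<in> sets borel" for j
  proof -
    have "B j = u -` {j} \<inter> space borel" by (auto simp: B_def)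
    also have "\<dots> \<in> sets borel" by (rule measurable_sets[OF u]) simp
    finally show ?thesis .
  qed
  have bB: "bounded (B j)" if "j \<in> {1..m}" for j
    using supp by (rule bounded_subset) (use that in \<open>auto simp: B_def\<close>)
  have [measurable]: "\<phi> j \<in> borel_measurable borel" for j unfolding \<phi>_def[abs_def] by measurable
  have \<phi>nat: "\<phi> j (of_nat k) = w j ^ k" for j k
  proof -
    have "\<phi> j (of_nat k) = (\<Sum>i\<in>{k}. w j ^ i * indicator {of_nat i :: ennreal} (of_nat k))"
      unfolding \<phi>_def by (intro suminf_finite) auto
    then show ?thesis by simp
  qed
  have AEfin: "AE \<omega> in M. \<forall>j\<in>{1..m}. \<exists>k. pp_count X \<omega> (B j) = of_nat k"
    by (intro AE_finite_allI AE_pp_count_finite bB Bm) auto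
  have "(\<integral>\<^sup>+\<omega>. Zprod (\<lambda>x. w (u x)) \<omega> \<partial>M) = (\<integral>\<^sup>+\<omega>. (\<Prod>j\<in>{1..m}. \<phi> j (pp_count X \<omega> (B j))) \<partial>M)"
  proof (rule nn_integral_cong_AE)
    show "AE \<omega> in M. Zprod (\<lambda>x. w (u x)) \<omega> = (\<Prod>j\<in>{1..m}. \<phi> j (pp_count X \<omega> (B j)))"
      using AEfin
    proof eventually_elim
      case (elim \<omega>)
      define S where "S j = {k. X \<omega> k \<in> B j}" for j
      have finS: "finite (S j)" if j: "j \<in> {1..m}" for j
      proof (rule ccontr)
        assume "infinite (S j)"
        then have "pp_count X \<omega> (B j) = \<infinity>" unfolding pp_count_def S_def by simp
        moreover obtain k where "pp_count X \<omega> (B j) = of_nat k" using bspec[OF elim j] by (rule exE)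
        moreover have "of_nat k < (\<infinity> :: ennreal)" by (simp add: of_nat_less_top)
        ultimately show False by simp
      qed
      have "Zprod (\<lambda>x. w (u x)) \<omega> = (\<Prod>k\<in>(\<Union>j\<in>{1..m}. S j). w (u (X \<omega> k)))"
      proof (rule Zprod_eventually)
        show "w (u x) \<le> 1" for x unfolding w_def using m by (simp add: ennreal_le_1)
        show "finite (\<Union>j\<in>{1..m}. S j)" using finS by auto
        fix k assume "k \<notin> (\<Union>j\<in>{1..m}. S j)"
        then have "u (X \<omega> k) = 0" using um[of "X \<omega> k"] by (auto simp: S_def B_def not_less_eq_eq)
        then show "w (u (X \<omega> k)) = 1" by (simp add: w_def)
      qed
      also have "\<dots> = (\<Prod>j\<in>{1..m}. \<Prod>k\<in>S j. w (u (X \<omega> k)))"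
        using finS by (intro prod.UNION_disjoint) (auto simp: S_def B_def)
      also have "\<dots> = (\<Prod>j\<in>{1..m}. w j ^ card (S j))"
        by (intro prod.cong refl) (simp add: S_def B_def)
      also have "\<dots> = (\<Prod>j\<in>{1..m}. \<phi> j (pp_count X \<omega> (B j)))"
        using finS by (intro prod.cong refl) (simp add: \<phi>nat[symmetric] pp_count_def S_def)
      finally show ?case .
    qed
  qed
  also have "\<dots> = (\<Prod>j\<in>{1..m}. \<integral>\<^sup>+\<omega>. \<phi> j (pp_count X \<omega> (B j)) \<partial>M)"
  proof (rule indep_vars_nn_integral)
    have "indep_vars (\<lambda>_. borel) (\<lambda>j \<omega>. pp_count X \<omega> (B j)) {1..m}"
      by (rule pp_count_indep) (use bB in \<open>auto simp: disjoint_family_on_def B_def\<close>)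
    then show "indep_vars (\<lambda>_. borel) (\<lambda>j \<omega>. \<phi> j (pp_count X \<omega> (B j))) {1..m}"
      by (rule indep_vars_compose2) auto
  qed auto
  also have "\<dots> = (\<Prod>j\<in>{1..m}. ennreal (exp (- (lam * (real j / real m * measure lborel (B j))))))"
  proof (rule prod.cong[OF refl])
    fix j assume j: "j \<in> {1..m}"
    let ?a = "lam * measure lborel (B j)" and ?z = "1 - real j / real m"
    have a: "?a \<ge> 0" using lam_pos by simp
    have z: "?z \<ge> 0" using j m by simp
    have "(\<integral>\<^sup>+\<omega>. \<phi> j (pp_count X \<omega> (B j)) \<partial>M) = (\<Sum>k. w j ^ k * ennreal (poisson_density ?a k))"
      unfolding nn_integral_pp_count[OF Bm bB[OF j]] \<phi>nat ..
    also have "\<dots> = (\<Sum>k. ennreal (?z ^ k * poisson_density ?a k))"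
      unfolding w_def using z poisson_density_nonneg[OF a] by (simp add: ennreal_mult ennreal_power)
    also have "\<dots> = ennreal (exp (- (?a * (1 - ?z))))"
      using poisson_density_power_sums[of ?z ?a] poisson_density_nonneg[OF a] z by (subst suminf_ennreal2) (auto simp: sums_iff)
    finally show "(\<integral>\<^sup>+\<omega>. \<phi> j (pp_count X \<omega> (B j)) \<partial>M) = ennreal (exp (- (lam * (real j / real m * measure lborel (B j)))))"
      by (simp add: mult_ac)
  qed
  also have "\<dots> = ennreal (exp (- (lam * (\<Sum>j\<in>{1..m}. real j / real m * measure lborel (B j)))))"
    by (simp add: prod_ennreal exp_sum[symmetric] sum_distrib_left sum_negf)
  also have "(\<Sum>j\<in>{1..m}. real j / real m * measure lborel (B j)) = s"
  proof -
    have "ennreal s = (\<integral>\<^sup>+x. (\<Sum>j\<in>{1..m}. ennreal (real j / real m) * indicator (B j) x) \<partial>lborel)"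
      unfolding s(1)[symmetric]
    proof (rule nn_integral_cong)
      fix x :: "real \<times> real"
      show "ennreal (real (u x) / real m) = (\<Sum>j\<in>{1..m}. ennreal (real j / real m) * indicator (B j) x)"
      proof (cases "u x = 0")
        case True
        then show ?thesis by (auto simp: B_def intro!: sum.neutral[symmetric])
      next
        case False
        have "(\<Sum>j\<in>{1..m}. ennreal (real j / real m) * indicator (B j) x) = (\<Sum>j\<in>{u x}. ennreal (real j / real m) * indicator (B j) x)"
          using um[of x] False by (intro sum.mono_neutral_right) (auto simp: B_def)
        then show ?thesis by (simp add: B_def)
      qed
    qed
    also have "\<dots> = (\<Sum>j\<in>{1..m}. ennreal (real j / real m) * emeasure lborel (B j))"
      by (subst nn_integral_sum) (auto simp: nn_integral_cmult)
    also have "\<dots> = (\<Sum>j\<in>{1..m}. ennreal (real j / real m * measure lborel (B j)))"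
    proof (rule sum.cong[OF refl])
      fix j assume j: "j \<in> {1..m}"
      have "emeasure lborel (B j) = ennreal (measure lborel (B j))"
        using emeasure_bounded_finite[OF bB[OF j]] by (intro emeasure_eq_ennreal_measure) auto
      then show "ennreal (real j / real m) * emeasure lborel (B j) = ennreal (real j / real m * measure lborel (B j))"
        by (simp add: ennreal_mult[symmetric])
    qed
    also have "\<dots> = ennreal (\<Sum>j\<in>{1..m}. real j / real m * measure lborel (B j))"
      by (intro sum_ennreal) auto
    finally show ?thesis using s(2) by (subst (asm) ennreal_inj) (auto intro!: sum_nonneg)
  qed
  finally show ?thesis unfolding w_def .
qed

text \<open>The product decreases when \<open>b\<close> increases. Rounding \<open>b\<close> down
  and up to multiples of \<open>1 / m\<close> therefore encloses the mean between two step cases,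
  whose exponents differ from \<open>lam * \<beta>\<close> by at most \<open>lam * V / m\<close>,
  with \<open>V\<close> the area of a disc containing the support.\<close>

lemma nn_integral_Zprod:
  fixes b :: "real \<times> real \<Rightarrow> real"
  assumes b[measurable]: "b \<in> borel_measurable borel" and b01: "\<And>x. 0 \<le> b x" "\<And>x. b x \<le> 1"
    and supp: "\<And>x. x \<notin> ball 0 R \<Longrightarrow> b x = 0"
    and \<beta>: "(\<integral>\<^sup>+x. ennreal (b x) \<partial>lborel) = ennreal \<beta>" "\<beta> \<ge> 0"
  shows "(\<integral>\<^sup>+\<omega>. Zprod (\<lambda>x. ennreal (1 - b x)) \<omega> \<partial>M) = ennreal (exp (- (lam * \<beta>)))"
proof -
  let ?S = "\<lambda>(u :: real \<times> real \<Rightarrow> nat) (m :: nat). \<integral>\<^sup>+x. ennreal (real (u x) / real m) \<partial>lborel"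
  let ?Z = "\<lambda>(u :: real \<times> real \<Rightarrow> nat) (m :: nat). \<integral>\<^sup>+\<omega>. Zprod (\<lambda>x. ennreal (1 - real (u x) / real m)) \<omega> \<partial>M"
  let ?D = "ball 0 R :: (real \<times> real) set"
  let ?I = "\<integral>\<^sup>+\<omega>. Zprod (\<lambda>x. ennreal (1 - b x)) \<omega> \<partial>M"
  define V where "V = measure lborel ?D"
  have Vem: "emeasure lborel ?D = ennreal V"
    using emeasure_bounded_finite[of ?D] unfolding V_def by (intro emeasure_eq_ennreal_measure) auto
  have [measurable]: "?D \<in> sets borel" by simp
  have V0: "V \<ge> 0" by (simp add: V_def)
  have step: "?Z u m =
      ennreal (exp (- (lam * enn2real (?S u m))))"
    and fin: "?S u m < \<infinity>"
    if m: "m > 0" and u[measurable]: "u \<in> measurable borel (count_space UNIV)" and um: "\<And>x. u x \<le> m" and u0: "\<And>x. x \<notin> ?D \<Longrightarrow> u x = 0" for u m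
  proof -
    have "?S u m \<le> (\<integral>\<^sup>+x. indicator ?D x \<partial>lborel)"
    proof (rule nn_integral_mono)
      fix x
      have "real (u x) / real m \<le> 1" using um[of x] m by simp
      then show "ennreal (real (u x) / real m) \<le> indicator ?D x"
        by (cases "x \<in> ?D") (simp_all add: u0 ennreal_le_1 del: mem_ball_0 mem_ball)
    qed
    also have "\<dots> < \<infinity>" using Vem by simp
    finally show fin: "?S u m < \<infinity>" .
    have "{x. u x \<noteq> 0} \<subseteq> ?D"
    proof (rule subsetI, rule ccontr)
      fix x assume "x \<in> {x. u x \<noteq> 0}" "x \<notin> ?D"
      then show False using u0[of x] by simp
    qed
    then have "bounded {x. u x \<noteq> 0}" by (rule bounded_subset[OF bounded_ball])
    then show "?Z u m =
      ennreal (exp (- (lam * enn2real (?S u m))))"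
      using fin by (intro nn_integral_Zprod_step um m) auto
  qed
  have upper: "?I \<le> ennreal (exp (- (lam * (\<beta> - V / real m))))" if m: "m > 0" for m :: nat
  proof -
    define u where "u x = nat \<lfloor>real m * b x\<rfloor>" for x
    have [measurable]: "u \<in> measurable borel (count_space UNIV)" unfolding u_def[abs_def] by measurable
    have u: "real (u x) \<le> real m * b x" "real m * b x \<le> real (u x) + 1" for x
      using mult_nonneg_nonneg[OF of_nat_0_le_iff b01(1), of m x] unfolding u_def by linarith+
    have um: "u x \<le> m" for x
    proof -
      have "real m * b x \<le> real m * 1" using b01 by (intro mult_left_mono) auto
      then have "real (u x) \<le> real m" using u(1)[of x] by linarith
      then show ?thesis by simp
    qed
    have u0: "u x = 0" if "x \<notin> ?D" for x using supp[OF that] by (simp add: u_def)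
    note st = step[OF m _ um u0] and fn = fin[OF m _ um u0]
    define s where "s = enn2real (?S u m)"
    have s: "?S u m = ennreal s" "s \<ge> 0"
      using fn unfolding s_def by auto
    have "ennreal \<beta> \<le> (\<integral>\<^sup>+x. ennreal (real (u x) / real m) + ennreal (1 / real m) * indicator ?D x \<partial>lborel)"
      unfolding \<beta>(1)[symmetric]
    proof (rule nn_integral_mono)
      fix x
      show "ennreal (b x) \<le> ennreal (real (u x) / real m) + ennreal (1 / real m) * indicator ?D x"
      proof (cases "x \<in> ?D")
        case True
        have "b x \<le> real (u x) / real m + 1 / real m" using u(2)[of x] m by (simp add: field_simps)
        then show ?thesis using True by (simp add: ennreal_plus[symmetric] ennreal_leI del: ennreal_plus)
      qed (simp add: supp)
    qed
    also have "\<dots> = ennreal s + ennreal (1 / real m) * ennreal V"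
      using s Vem by (subst nn_integral_add) (auto simp: nn_integral_cmult_indicator intro!: borel_measurable_times borel_measurable_indicator)
    also have "\<dots> = ennreal (s + V / real m)"
      using s V0 m by (simp add: ennreal_mult'[symmetric] ennreal_plus)
    finally have "\<beta> \<le> s + V / real m" using s V0 by (subst (asm) ennreal_le_iff) auto
    then have le: "- (lam * s) \<le> - (lam * (\<beta> - V / real m))" using lam_pos by simp
    have "?I \<le> ?Z u m"
      using u(1) m by (intro nn_integral_mono Zprod_mono ennreal_leI) (simp add: field_simps)
    also have "\<dots> = ennreal (exp (- (lam * s)))" unfolding s_def by (rule st) measurable
    also have "\<dots> \<le> ennreal (exp (- (lam * (\<beta> - V / real m))))" using le by (intro ennreal_leI) simp
    finally show ?thesis .
  qed
  have lower: "ennreal (exp (- (lam * (\<beta> + V / real m)))) \<le> ?I" if m: "m > 0" for m :: nat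
  proof -
    define u where "u x = nat \<lceil>real m * b x\<rceil>" for x
    have [measurable]: "u \<in> measurable borel (count_space UNIV)" unfolding u_def[abs_def] by measurable
    have u: "real m * b x \<le> real (u x)" "real (u x) \<le> real m * b x + 1" for x
      using mult_nonneg_nonneg[OF of_nat_0_le_iff b01(1), of m x] unfolding u_def by linarith+
    have um: "u x \<le> m" for x
    proof -
      have "real m * b x \<le> real m * 1" using b01 by (intro mult_left_mono) auto
      then have "\<lceil>real m * b x\<rceil> \<le> int m" by (simp add: ceiling_le_iff)
      then have "nat \<lceil>real m * b x\<rceil> \<le> nat (int m)" by (rule nat_mono)
      then show ?thesis unfolding u_def nat_int .
    qed
    have u0: "u x = 0" if "x \<notin> ?D" for x using supp[OF that] by (simp add: u_def)
    note st = step[OF m _ um u0] and fn = fin[OF m _ um u0]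
    define s where "s = enn2real (?S u m)"
    have s: "?S u m = ennreal s" "s \<ge> 0"
      using fn unfolding s_def by auto
    have "ennreal s \<le> (\<integral>\<^sup>+x. ennreal (b x) + ennreal (1 / real m) * indicator ?D x \<partial>lborel)"
      unfolding s(1)[symmetric]
    proof (rule nn_integral_mono)
      fix x
      show "ennreal (real (u x) / real m) \<le> ennreal (b x) + ennreal (1 / real m) * indicator ?D x"
      proof (cases "x \<in> ?D")
        case True
        have "real (u x) / real m \<le> b x + 1 / real m" using u(2)[of x] m by (simp add: field_simps)
        then show ?thesis using True b01(1)[of x] by (simp add: ennreal_plus[symmetric] ennreal_leI del: ennreal_plus)
      qed (simp add: u0)
    qed
    also have "\<dots> = ennreal \<beta> + ennreal (1 / real m) * ennreal V"
      using \<beta> Vem by (subst nn_integral_add) (auto simp: nn_integral_cmult_indicator intro!: borel_measurable_times borel_measurable_indicator)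
    also have "\<dots> = ennreal (\<beta> + V / real m)"
      using \<beta> V0 m by (simp add: ennreal_mult'[symmetric] ennreal_plus)
    finally have "s \<le> \<beta> + V / real m" using \<beta> V0 by (subst (asm) ennreal_le_iff) auto
    then have le: "- (lam * (\<beta> + V / real m)) \<le> - (lam * s)" using lam_pos by simp
    then have "ennreal (exp (- (lam * (\<beta> + V / real m)))) \<le> ennreal (exp (- (lam * s)))" by (intro ennreal_leI) simp
    also have "\<dots> = ?Z u m"
      unfolding s_def by (rule st[symmetric]) measurable
    also have "\<dots> \<le> ?I"
      using u(1) m by (intro nn_integral_mono Zprod_mono ennreal_leI) (simp add: field_simps)
    finally show ?thesis .
  qed
  show ?thesis
  proof (rule antisym)
    have "(\<lambda>m. ennreal (exp (- (lam * (\<beta> - V / real m))))) \<longlonglongrightarrow> ennreal (exp (- (lam * (\<beta> - 0))))"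
      by (intro tendsto_ennrealI tendsto_intros lim_const_over_n)
    then show "?I \<le> ennreal (exp (- (lam * \<beta>)))"
      unfolding diff_0_right
      by (rule LIMSEQ_le_const) (intro exI[of _ 1] allI impI upper, simp)
    have "(\<lambda>m. ennreal (exp (- (lam * (\<beta> + V / real m))))) \<longlonglongrightarrow> ennreal (exp (- (lam * (\<beta> + 0))))"
      by (intro tendsto_ennrealI tendsto_intros lim_const_over_n)
    then show "ennreal (exp (- (lam * \<beta>))) \<le> ?I"
      unfolding add_0_right
      by (rule LIMSEQ_le_const2) (intro exI[of _ 1] allI impI lower, simp)
  qed
qed

end

section \<open>Moving stations\<close>

locale moving_stations = plane_ppp M lam X for M :: "'w measure" and lam X +
  fixes \<Theta> :: "'w \<Rightarrow> nat \<Rightarrow> real"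
  assumes Theta_unif: "\<And>n A. A \<in> sets borel \<Longrightarrow>
        measure M {\<omega> \<in> space M. \<Theta> \<omega> n \<in> A} = measure lborel (A \<inter> {-pi..<pi}) / (2 * pi)"
    and Theta_iid: "indep_vars (\<lambda>_. borel) (\<lambda>n \<omega>. \<Theta> \<omega> n) UNIV"
    and Theta_indep_Phi: "indep_set
        (sigma_sets (space M) {(\<lambda>\<omega>. \<Theta> \<omega>) -` A \<inter> space M | A. A \<in> sets (PiM UNIV (\<lambda>_. borel))})
        (sigma_sets (space M) {X -` A \<inter> space M | A. A \<in> sets (PiM UNIV (\<lambda>_. borel))})"
begin

lemma Theta_measurable [measurable]: "(\<lambda>\<omega>. \<Theta> \<omega> n) \<in> borel_measurable M"
  using Theta_iid unfolding indep_vars_def by simp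

lemma distr_Theta: "distr M borel (\<lambda>\<omega>. \<Theta> \<omega> n) = uniform_measure lborel {-pi..<pi}"
proof (rule measure_eqI)
  fix A assume "A \<in> sets (distr M borel (\<lambda>\<omega>. \<Theta> \<omega> n))"
  then have A[measurable]: "A \<in> sets borel" by simp
  have "emeasure (distr M borel (\<lambda>\<omega>. \<Theta> \<omega> n)) A = emeasure M {\<omega> \<in> space M. \<Theta> \<omega> n \<in> A}"
    by (subst emeasure_distr) (auto intro!: arg_cong[where f="emeasure M"])
  also have "\<dots> = ennreal (measure lborel (A \<inter> {-pi..<pi}) / (2 * pi))"
    unfolding emeasure_eq_measure Theta_unif[OF A] ..
  also have "\<dots> = ennreal (measure lborel (A \<inter> {-pi..<pi})) / ennreal (2 * pi)"
    by (simp add: divide_ennreal)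
  also have "ennreal (measure lborel (A \<inter> {-pi..<pi})) = emeasure lborel ({-pi..<pi} \<inter> A)"
  proof -
    have "A \<inter> {-pi..<pi} \<subseteq> {-pi..pi}" by auto
    then have "bounded (A \<inter> {-pi..<pi})" by (rule bounded_subset[OF bounded_closed_interval])
    then show ?thesis
      using emeasure_bounded_finite[of "A \<inter> {-pi..<pi}"]
      by (subst emeasure_eq_ennreal_measure[symmetric]) (auto simp: Int_commute)
  qed
  also have "emeasure lborel ({-pi..<pi} \<inter> A) / ennreal (2 * pi) = emeasure (uniform_measure lborel {-pi..<pi}) A"
    by (subst emeasure_uniform_measure) auto
  finally show "emeasure (distr M borel (\<lambda>\<omega>. \<Theta> \<omega> n)) A = emeasure (uniform_measure lborel {-pi..<pi}) A" .
qed simp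

lemma nn_integral_rot_Theta:
  assumes [measurable]: "g \<in> borel_measurable borel"
  shows "(\<integral>\<^sup>+\<omega>. g (rot (\<Theta> \<omega> n) x) \<partial>M) = rot_mean g x"
proof -
  have "(\<integral>\<^sup>+\<omega>. g (rot (\<Theta> \<omega> n) x) \<partial>M) = (\<integral>\<^sup>+\<theta>. g (rot \<theta> x) \<partial>distr M borel (\<lambda>\<omega>. \<Theta> \<omega> n))"
    by (subst nn_integral_distr) auto
  also have "\<dots> = (\<integral>\<^sup>+\<theta>\<in>{-pi..<pi}. g (rot \<theta> x) \<partial>lborel) / emeasure lborel {-pi..<pi}"
    unfolding distr_Theta by (rule nn_integral_uniform_measure) auto
  finally show ?thesis by (simp add: rot_mean_def)
qed

text \<open>The angle sequence is independent of the position sequence, so their joint law is a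
  product measure and the angles can be integrated first with the positions frozen. Independence
  among the angles then turns the mean of the product into the product of the means
  \<open>rot_mean g\<close>.\<close>

lemma nn_integral_prod_rot:
  assumes [measurable]: "g \<in> borel_measurable borel" and J: "finite J"
  shows "(\<integral>\<^sup>+\<omega>. (\<Prod>k\<in>J. g (rot (\<Theta> \<omega> k) (X \<omega> k))) \<partial>M) = (\<integral>\<^sup>+\<omega>. (\<Prod>k\<in>J. rot_mean g (X \<omega> k)) \<partial>M)"
proof -
  let ?P = "PiM UNIV (\<lambda>_. borel) :: (nat \<Rightarrow> real) measure"
  let ?Q = "PiM UNIV (\<lambda>_. borel) :: (nat \<Rightarrow> real \<times> real) measure"
  have T[measurable]: "\<Theta> \<in> measurable M ?P"
    using measurable_PiM_single'[of UNIV "\<lambda>n \<omega>. \<Theta> \<omega> n" M "\<lambda>_. borel"] by simp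
  have X[measurable]: "X \<in> measurable M ?Q"
    using measurable_PiM_single'[of UNIV "\<lambda>n \<omega>. X \<omega> n" M "\<lambda>_. borel"] by simp
  interpret DT: prob_space "distr M ?P \<Theta>" by (rule prob_space_distr) fact
  interpret DX: prob_space "distr M ?Q X" by (rule prob_space_distr) fact
  have pair: "distr M ?P \<Theta> \<Otimes>\<^sub>M distr M ?Q X = distr M (?P \<Otimes>\<^sub>M ?Q) (\<lambda>\<omega>. (\<Theta> \<omega>, X \<omega>))"
  proof (rule pair_measure_eqI)
    fix A B assume "A \<in> sets (distr M ?P \<Theta>)" "B \<in> sets (distr M ?Q X)"
    then have A[measurable]: "A \<in> sets ?P" and B[measurable]: "B \<in> sets ?Q" by simp_all
    have "prob ((\<Theta> -` A \<inter> space M) \<inter> (X -` B \<inter> space M)) = prob (\<Theta> -` A \<inter> space M) * prob (X -` B \<inter> space M)"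
      using A B by (intro indep_setD[OF Theta_indep_Phi] sigma_sets.Basic) auto
    moreover have "(\<Theta> -` A \<inter> space M) \<inter> (X -` B \<inter> space M) = (\<lambda>\<omega>. (\<Theta> \<omega>, X \<omega>)) -` (A \<times> B) \<inter> space M" by auto
    ultimately have "emeasure M ((\<lambda>\<omega>. (\<Theta> \<omega>, X \<omega>)) -` (A \<times> B) \<inter> space M) = emeasure M (\<Theta> -` A \<inter> space M) * emeasure M (X -` B \<inter> space M)"
      by (simp add: emeasure_eq_measure ennreal_mult)
    then show "emeasure (distr M ?P \<Theta>) A * emeasure (distr M ?Q X) B = emeasure (distr M (?P \<Otimes>\<^sub>M ?Q) (\<lambda>\<omega>. (\<Theta> \<omega>, X \<omega>))) (A \<times> B)"
      by (subst (1 2 3) emeasure_distr) auto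
  qed (auto intro: DT.sigma_finite_measure_axioms DX.sigma_finite_measure_axioms)
  interpret DP: pair_sigma_finite "distr M ?P \<Theta>" "distr M ?Q X" ..
  define F where "F p = (\<Prod>k\<in>J. g (rot (fst p k) (snd p k)))" for p :: "(nat \<Rightarrow> real) \<times> (nat \<Rightarrow> real \<times> real)"
  have F[measurable]: "F \<in> borel_measurable (?P \<Otimes>\<^sub>M ?Q)" unfolding F_def[abs_def] by measurable
  have F': "F \<in> borel_measurable (distr M ?P \<Theta> \<Otimes>\<^sub>M distr M ?Q X)"
    using F by (simp add: measurable_def sets_pair_measure_cong[OF sets_distr sets_distr] space_pair_measure)
  have "(\<integral>\<^sup>+\<omega>. F (\<Theta> \<omega>, X \<omega>) \<partial>M) = (\<integral>\<^sup>+p. F p \<partial>distr M (?P \<Otimes>\<^sub>M ?Q) (\<lambda>\<omega>. (\<Theta> \<omega>, X \<omega>)))"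
    by (rule nn_integral_distr[symmetric]) measurable
  also have "\<dots> = (\<integral>\<^sup>+p. F p \<partial>(distr M ?P \<Theta> \<Otimes>\<^sub>M distr M ?Q X))" unfolding pair ..
  also have "\<dots> = (\<integral>\<^sup>+x. \<integral>\<^sup>+\<theta>. F (\<theta>, x) \<partial>distr M ?P \<Theta> \<partial>distr M ?Q X)"
    by (rule DP.nn_integral_snd[symmetric, OF F'])
  also have "\<dots> = (\<integral>\<^sup>+x. (\<Prod>k\<in>J. rot_mean g (x k)) \<partial>distr M ?Q X)"
  proof (rule nn_integral_cong)
    fix x :: "nat \<Rightarrow> real \<times> real"
    have "(\<integral>\<^sup>+\<theta>. F (\<theta>, x) \<partial>distr M ?P \<Theta>) = (\<integral>\<^sup>+\<omega>. F (\<Theta> \<omega>, x) \<partial>M)"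
      unfolding F_def by (subst nn_integral_distr) auto
    also have "\<dots> = (\<integral>\<^sup>+\<omega>. (\<Prod>k\<in>J. g (rot (\<Theta> \<omega> k) (x k))) \<partial>M)" by (simp add: F_def)
    also have "\<dots> = (\<Prod>k\<in>J. \<integral>\<^sup>+\<omega>. g (rot (\<Theta> \<omega> k) (x k)) \<partial>M)"
    proof (rule indep_vars_nn_integral[OF J])
      show "indep_vars (\<lambda>_. borel) (\<lambda>k \<omega>. g (rot (\<Theta> \<omega> k) (x k))) J"
        by (rule indep_vars_compose2[OF indep_vars_subset[OF Theta_iid]]) auto
    qed simp
    also have "\<dots> = (\<Prod>k\<in>J. rot_mean g (x k))" by (simp add: nn_integral_rot_Theta)
    finally show "(\<integral>\<^sup>+\<theta>. F (\<theta>, x) \<partial>distr M ?P \<Theta>) = (\<Prod>k\<in>J. rot_mean g (x k))" .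
  qed
  also have "\<dots> = (\<integral>\<^sup>+\<omega>. (\<Prod>k\<in>J. rot_mean g (X \<omega> k)) \<partial>M)"
    by (subst nn_integral_distr) auto
  finally show ?thesis by (simp add: F_def)
qed

definition Y :: "nat \<Rightarrow> 'w \<Rightarrow> real \<times> real" where
  "Y k \<omega> = rot (\<Theta> \<omega> k) (X \<omega> k)"

lemma Y_meas [measurable]: "Y k \<in> borel_measurable M"
  unfolding Y_def[abs_def] by measurable

lemma Y_mean:
  assumes [measurable]: "A \<in> sets borel"
  shows "(\<Sum>k. emeasure M {\<omega> \<in> space M. Y k \<omega> \<in> A}) = ennreal lam * emeasure lborel A"
proof -
  have "emeasure M {\<omega> \<in> space M. Y k \<omega> \<in> A} = (\<integral>\<^sup>+\<omega>. rot_mean (indicator A) (X \<omega> k) \<partial>M)" for k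
  proof -
    have "emeasure M {\<omega> \<in> space M. Y k \<omega> \<in> A} = (\<integral>\<^sup>+\<omega>. indicator {\<omega> \<in> space M. Y k \<omega> \<in> A} \<omega> \<partial>M)" by simp
    also have "\<dots> = (\<integral>\<^sup>+\<omega>. (\<Prod>k\<in>{k}. indicator A (rot (\<Theta> \<omega> k) (X \<omega> k))) \<partial>M)"
      by (intro nn_integral_cong) (simp add: Y_def indicator_def)
    also have "\<dots> = (\<integral>\<^sup>+\<omega>. (\<Prod>k\<in>{k}. rot_mean (indicator A) (X \<omega> k)) \<partial>M)"
      by (rule nn_integral_prod_rot) auto
    finally show ?thesis by simp
  qed
  then have "(\<Sum>k. emeasure M {\<omega> \<in> space M. Y k \<omega> \<in> A}) = ennreal lam * (\<integral>\<^sup>+x. rot_mean (indicator A) x \<partial>lborel)"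
    by (simp add: campbell)
  also have "(\<integral>\<^sup>+x. rot_mean (indicator A) x \<partial>lborel) = (\<integral>\<^sup>+x. indicator A x \<partial>lborel)"
    by (rule nn_integral_rot_mean) measurable
  finally show ?thesis by simp
qed

text \<open>With the angles integrated out, the void probability is the mean of \<open>Zprod\<close>
  for the weight \<open>1 - b\<close>. Rotations preserve norms, so \<open>b\<close> vanishes
  outside a ball containing \<open>B\<close> and the Laplace functional applies.\<close>

lemma Y_void:
  assumes B[measurable]: "B \<in> sets borel" and "bounded B"
  shows "prob {\<omega> \<in> space M. \<forall>k. Y k \<omega> \<notin> B} = exp (- (lam * measure lborel B))"
proof -
  define b where "b x = enn2real (rot_mean (indicator B) x)" for x
  have b_le: "rot_mean (indicator B) x \<le> 1" for x by (rule rot_mean_indicator_compl(2)[OF B])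
  have b: "rot_mean (indicator B) x = ennreal (b x)" for x
    unfolding b_def using le_less_trans[OF b_le[of x] ennreal_one_less_top] by simp
  have b0: "b x \<ge> 0" for x by (simp add: b_def)
  have b1: "b x \<le> 1" for x using b_le[of x] unfolding b by (simp add: ennreal_le_1)
  have [measurable]: "b \<in> borel_measurable borel" unfolding b_def[abs_def] by measurable
  have w: "rot_mean (indicator (- B)) x = ennreal (1 - b x)" for x
    using b0[of x] unfolding rot_mean_indicator_compl(1)[OF B] b by (simp add: ennreal_minus flip: ennreal_1)
  \<comment> \<open>Angles can be integrated out for finitely many points at a time; the events
    decrease to the void event and the products to \<open>Zprod\<close>.\<close>
  define E where "E K = {\<omega> \<in> space M. \<forall>k<K. Y k \<omega> \<notin> B}" for K :: nat
  have Em: "E K \<in> sets M" for K unfolding E_def by measurable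
  have E: "emeasure M (E K) = (\<integral>\<^sup>+\<omega>. (\<Prod>k<K. ennreal (1 - b (X \<omega> k))) \<partial>M)" for K
  proof -
    have "emeasure M (E K) = (\<integral>\<^sup>+\<omega>. indicator (E K) \<omega> \<partial>M)" using Em by simp
    also have "\<dots> = (\<integral>\<^sup>+\<omega>. (\<Prod>k<K. indicator (- B) (rot (\<Theta> \<omega> k) (X \<omega> k))) \<partial>M)"
    proof (rule nn_integral_cong)
      fix \<omega> assume \<omega>: "\<omega> \<in> space M"
      show "indicator (E K) \<omega> = (\<Prod>k<K. indicator (- B) (rot (\<Theta> \<omega> k) (X \<omega> k)) :: ennreal)"
      proof (cases "\<omega> \<in> E K")
        case True
        then have "(\<Prod>k<K. indicator (- B) (rot (\<Theta> \<omega> k) (X \<omega> k)) :: ennreal) = 1"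
          by (intro prod.neutral) (auto simp: E_def Y_def)
        with True show ?thesis by simp
      next
        case False
        then obtain k where "k < K" "rot (\<Theta> \<omega> k) (X \<omega> k) \<in> B" using \<omega> by (auto simp: E_def Y_def)
        then have "(\<Prod>k<K. indicator (- B) (rot (\<Theta> \<omega> k) (X \<omega> k)) :: ennreal) = 0"
          by (intro prod_zero bexI[of _ k]) auto
        with False show ?thesis by simp
      qed
    qed
    also have "\<dots> = (\<integral>\<^sup>+\<omega>. (\<Prod>k<K. rot_mean (indicator (- B)) (X \<omega> k)) \<partial>M)"
      by (rule nn_integral_prod_rot) auto
    finally show ?thesis unfolding w .
  qed
  obtain R where R: "B \<subseteq> ball 0 R" using \<open>bounded B\<close> bounded_subset_ballD by blast
  have "{\<omega> \<in> space M. \<forall>k. Y k \<omega> \<notin> B} = (\<Inter>K. E K)" by (auto simp: E_def)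
  then have "emeasure M {\<omega> \<in> space M. \<forall>k. Y k \<omega> \<notin> B} = (INF K. emeasure M (E K))"
    using Em by (simp only:) (rule INF_emeasure_decseq[symmetric], auto simp: decseq_def E_def)
  also have "\<dots> = (INF K. \<integral>\<^sup>+\<omega>. (\<Prod>k<K. ennreal (1 - b (X \<omega> k))) \<partial>M)" unfolding E ..
  also have "\<dots> = (\<integral>\<^sup>+\<omega>. Zprod (\<lambda>x. ennreal (1 - b x)) \<omega> \<partial>M)"
    unfolding Zprod_def
  proof (rule nn_integral_monotone_convergence_INF_decseq[symmetric])
    show "decseq (\<lambda>K \<omega>. \<Prod>k<K. ennreal (1 - b (X \<omega> k)))"
    proof (intro decseq_SucI le_funI)
      fix K \<omega>
      have "ennreal (1 - b (X \<omega> K)) \<le> 1" using b0[of "X \<omega> K"] by (simp add: ennreal_le_1)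
      then have "(\<Prod>k<K. ennreal (1 - b (X \<omega> k))) * ennreal (1 - b (X \<omega> K)) \<le> (\<Prod>k<K. ennreal (1 - b (X \<omega> k))) * 1"
        by (intro mult_left_mono) auto
      then show "(\<Prod>k<Suc K. ennreal (1 - b (X \<omega> k))) \<le> (\<Prod>k<K. ennreal (1 - b (X \<omega> k)))"
        by (simp add: mult.commute)
    qed
    show "(\<integral>\<^sup>+\<omega>. (\<Prod>k<(0::nat). ennreal (1 - b (X \<omega> k))) \<partial>M) < \<infinity>" by (simp add: emeasure_space_1)
  qed measurable
  also have "\<dots> = ennreal (exp (- (lam * measure lborel B)))"
  proof (rule nn_integral_Zprod[OF _ b0 b1])
    fix x :: "real \<times> real" assume x: "x \<notin> ball 0 R"
    have "rot \<theta> x \<notin> B" for \<theta>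
    proof
      assume "rot \<theta> x \<in> B"
      then have "norm (rot \<theta> x) < R" using R by auto
      with x show False by (simp add: norm_rot)
    qed
    then have "rot_mean (indicator B) x = 0" by (simp add: rot_mean_def)
    then show "b x = 0" by (simp add: b_def)
  next
    have "(\<integral>\<^sup>+x. ennreal (b x) \<partial>lborel) = (\<integral>\<^sup>+x. indicator B x \<partial>lborel)"
      unfolding b[symmetric] by (rule nn_integral_rot_mean) measurable
    also have "\<dots> = ennreal (measure lborel B)"
      using emeasure_bounded_finite[OF \<open>bounded B\<close>] by (simp add: emeasure_eq_ennreal_measure)
    finally show "(\<integral>\<^sup>+x. ennreal (b x) \<partial>lborel) = ennreal (measure lborel B)" .
  qed auto
  finally show ?thesis by (simp add: emeasure_eq_measure)
qed

sublocale Y: planar_poisson M lam Y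
  by unfold_locales (use lam_pos Y_void Y_mean in auto)

lemma norm_station_pos: "norm (station_pos X \<Theta> v \<omega> i t) = dist (- (v * t), 0) (Y i \<omega>)"
proof -
  obtain p q where pq: "X \<omega> i = (p, q)" by (cases "X \<omega> i")
  define s c d where "s = v * t" and "c = cos (\<Theta> \<omega> i)" and "d = sin (\<Theta> \<omega> i)"
  have cd: "c\<^sup>2 + d\<^sup>2 = 1" by (simp add: c_def d_def)
  have "(norm (station_pos X \<Theta> v \<omega> i t))\<^sup>2 = (p + s * c)\<^sup>2 + (q + s * d)\<^sup>2"
    by (simp add: station_pos_def pq norm_Pair s_def c_def d_def)
  also have "\<dots> = s\<^sup>2 * (c\<^sup>2 + d\<^sup>2) + (p\<^sup>2 + q\<^sup>2) + 2 * s * (p * c + q * d)" by algebra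
  also have "\<dots> = (dist (- s, 0) (Y i \<omega>))\<^sup>2"
    unfolding dist_sq_shift Y_def norm_rot cd by (simp add: pq norm_Pair rot_def c_def d_def)
  finally show ?thesis by (simp add: s_def)
qed

lemma handover_epoch_iff:
  "handover_epoch X \<Theta> v \<omega> t \<longleftrightarrow> (\<exists>i j. i \<noteq> j \<and> Y.nearest (- (v * t), 0) i \<omega> \<and> Y.nearest (- (v * t), 0) j \<omega>)"
  unfolding handover_epoch_def norm_station_pos Y.nearest_def by (metis order_antisym order_refl)

lemma handover_intensity_eq:
  assumes "v > 0"
  shows "handover_intensity M X \<Theta> v = ennreal (4 * v * sqrt lam / pi)"
proof -
  have "{t \<in> {0..1}. handover_epoch X \<Theta> v \<omega> t} = Y.crossings v \<omega>" for \<omega>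
    unfolding Y.crossings_def handover_epoch_iff ..
  then show ?thesis
    unfolding handover_intensity_def
    using Y.nn_integral_crossings[OF assms change_rate_tendsto[OF lam_pos assms]] by simp
qed

end

theorem theorem4p26:
  fixes M :: "'w measure"
    and lam v :: real
    and X :: "'w \<Rightarrow> nat \<Rightarrow> real \<times> real"
    and \<Theta> :: "'w \<Rightarrow> nat \<Rightarrow> real"
  assumes lam_pos: "lam > 0"
    and v_pos: "v > 0"
    and PPP: "homogeneous_PPP M lam X"
    and Theta_unif: "\<And>n A. A \<in> sets borel \<Longrightarrow>
        measure M {\<omega> \<in> space M. \<Theta> \<omega> n \<in> A} = measure lborel (A \<inter> {-pi..<pi}) / (2 * pi)"
    and Theta_iid: "prob_space.indep_vars M (\<lambda>_. borel) (\<lambda>n \<omega>. \<Theta> \<omega> n) UNIV"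
    and Theta_indep_Phi: "prob_space.indep_set M
        (sigma_sets (space M) {(\<lambda>\<omega>. \<Theta> \<omega>) -` A \<inter> space M | A. A \<in> sets (PiM UNIV (\<lambda>_. borel))})
        (sigma_sets (space M) {X -` A \<inter> space M | A. A \<in> sets (PiM UNIV (\<lambda>_. borel))})"
  shows "handover_intensity M X \<Theta> v = ennreal (4 * v * sqrt lam / pi)"
proof -
  interpret prob_space M using PPP unfolding homogeneous_PPP_def by blast
  interpret moving_stations M lam X \<Theta>
    using lam_pos PPP Theta_unif Theta_iid Theta_indep_Phi by unfold_locales
  show ?thesis using v_pos by (rule handover_intensity_eq)
qed

end
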